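(* Let $d\geq 2$ and $n\geq 3$ be two integers, and let $S=K[x_1,\ldots,x_n]$ be the polynomial ring over a field $K$ in $n$ indeterminates. Let $u$ be a monomial of degree $d$ in $S$, and let $B(u)$ be the principal Borel ideal generated by $u$. (a) If $d=2$, then $B(u)$ is Freiman if and only if $u$ is a minimal monomial generator of $(x_1,x_2,x_3)^2$, or of $x_1(x_4,\ldots,x_n)$, or of $x_2(x_4,\ldots,x_n)$. (b) If $d=3$, then $B(u)$ is Freiman if and only if $u$ is a minimal monomial generator of $x_1(x_1,x_2,x_3)^2$, or of $x_1(x_1,x_2)x_i$ for some $i>3$, or of $x_2^2(x_2,\ldots,x_n)$. (c) If $d\geq 4$, then $B(u)$ is Freiman if and only if $u=x_1^{d-2}x_3^2$, or $u$ is a minimal monomial generator of $x_1^{d-1}(x_1,\ldots,x_n)$, or of $x_1^{d-r-1}x_2^{r}(x_i,\ldots,x_n)$ for some $r$ and $i$ with $1\leq r\leq d-1$ and $i\geq 2$.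
   Context: A monomial ideal $I\subset S$, with minimal set of monomial generators $G(I)$, is called strongly stable if for all $v\in G(I)$, all $j$ such that $x_j$ divides $v$, and all $i<j$, one has $x_i(v/x_j)\in I$. For a monomial $v\in S$, $B(v)$ denotes the unique smallest strongly stable ideal containing $v$; such ideals are called principal Borel ideals. They are equigenerated (all minimal generators have the same degree). For an equigenerated monomial ideal $I\subset S$, let $\mu(I)$ denote its minimal number of generators and $\ell(I)$ its analytic spread, i.e. the Krull dimension of the fiber cone $F(I)=\bigoplus_{j\ge 0} I^j/\mathfrak{m}I^j$, where $\mathfrak{m}=(x_1,\ldots,x_n)$. The ideal $I$ is called Freiman if $\mu(I^2)=\ell(I)\mu(I)-\binom{\ell(I)}{2}$. Convention: an ideal $(x_i,\ldots,x_n)$ with $i>n$ is the zero ideal and has no minimal monomial generators; indices of variables are always at most $n$. *)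

theory Defs
  imports
    "HOL-Algebra.QuotRing"
    "HOL-Algebra.Ideal_Product"
    "HOL-Library.Poly_Mapping"
    "HOL-Library.Extended_Nat"
    "HOL-Computational_Algebra.Polynomial"
begin

section \<open>The polynomial ring \<open>K[x\<^sub>1, \<dots>, x\<^sub>n]\<close>\<close>

text \<open>
  The type \<open>'a mpoly\<close> consists of the polynomials in countably many variables
  \<open>x\<^sub>0, x\<^sub>1, x\<^sub>2, \<dots>\<close>: finitely supported functions from exponent vectors to coefficients, with the
  convolution product of \<^theory>\<open>HOL-Library.Poly_Mapping\<close>.
  The ring \<open>S n\<close> is the subring of those polynomials that involve only \<open>x\<^sub>1, \<dots>, x\<^sub>n\<close>.
\<close>

type_synonym 'a mpoly = "(nat \<Rightarrow>\<^sub>0 nat) \<Rightarrow>\<^sub>0 'a"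

definition S :: "nat \<Rightarrow> 'a::field mpoly ring" where
  "S n = \<lparr>carrier = {p. \<forall>t\<in>Poly_Mapping.keys p. Poly_Mapping.keys t \<subseteq> {1..n}},
          monoid.mult = (*), one = 1, zero = 0, add = (+)\<rparr>"

definition mon :: "(nat \<Rightarrow>\<^sub>0 nat) \<Rightarrow> 'a::field mpoly" where
  "mon t = Poly_Mapping.single t 1"

definition var :: "nat \<Rightarrow> 'a::field mpoly" where
  "var i = mon (Poly_Mapping.single i 1)"

definition monomials :: "nat \<Rightarrow> 'a::field mpoly set" where
  "monomials n = {mon t |t. Poly_Mapping.keys t \<subseteq> {1..n}}"

definition monomials_of_degree :: "nat \<Rightarrow> nat \<Rightarrow> 'a::field mpoly set" where
  "monomials_of_degree n d =
     {mon t |t. Poly_Mapping.keys t \<subseteq> {1..n} \<and>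
                (\<Sum>i\<in>Poly_Mapping.keys t. Poly_Mapping.lookup t i) = d}"

section \<open>Ideals\<close>

primrec ideal_power :: "('r, 'b) ring_scheme \<Rightarrow> 'r set \<Rightarrow> nat \<Rightarrow> 'r set" where
  "ideal_power R I 0 = carrier R"
| "ideal_power R I (Suc k) = ideal_prod R I (ideal_power R I k)"

text \<open>The least cardinality of a generating set; meaningful for finitely generated ideals.\<close>

definition min_num_gens :: "('r, 'b) ring_scheme \<Rightarrow> 'r set \<Rightarrow> nat" where
  "min_num_gens R I =
     (LEAST k. \<exists>A. A \<subseteq> carrier R \<and> finite A \<and> card A = k \<and> Idl\<^bsub>R\<^esub> A = I)"

text \<open>The supremum of the lengths \<open>k\<close> of chains \<open>P 0 \<subset> P 1 \<subset> \<dots> \<subset> P k\<close> of prime ideals.\<close>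

definition krull_dim :: "('r, 'b) ring_scheme \<Rightarrow> enat" where
  "krull_dim R =
     Sup {enat k |k. \<exists>P. (\<forall>i\<le>k. primeideal (P i) R) \<and> (\<forall>i<k. P i \<subset> P (Suc i))}"

section \<open>Monomial ideals and principal Borel ideals\<close>

definition monomial_ideal :: "nat \<Rightarrow> 'a::field mpoly set \<Rightarrow> bool" where
  "monomial_ideal n I \<longleftrightarrow> (\<exists>A \<subseteq> monomials n. I = Idl\<^bsub>S n\<^esub> A)"

text \<open>The minimal set of monomial generators of a monomial ideal, which is unique.\<close>

definition G :: "nat \<Rightarrow> 'a::field mpoly set \<Rightarrow> 'a mpoly set" where
  "G n I = (THE A. A \<subseteq> monomials n \<and> Idl\<^bsub>S n\<^esub> A = I \<and> (\<forall>A'. A' \<subset> A \<longrightarrow> Idl\<^bsub>S n\<^esub> A' \<noteq> I))"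

text \<open>Below, \<open>w\<close> is the quotient \<open>v / x\<^sub>j\<close>; it exists precisely when \<open>x\<^sub>j\<close> divides \<open>v\<close>.\<close>

definition strongly_stable :: "nat \<Rightarrow> 'a::field mpoly set \<Rightarrow> bool" where
  "strongly_stable n I \<longleftrightarrow>
     monomial_ideal n I \<and>
     (\<forall>v\<in>G n I. \<forall>j\<in>{1..n}. \<forall>i\<in>{1..n}. \<forall>w\<in>carrier (S n).
        v = var j * w \<and> i < j \<longrightarrow> var i * w \<in> I)"

text \<open>The smallest such ideal with respect to inclusion.\<close>

definition B :: "nat \<Rightarrow> 'a::field mpoly \<Rightarrow> 'a mpoly set" where
  "B n v = (LEAST I. strongly_stable n I \<and> v \<in> I)"

section \<open>Fiber cone, analytic spread, Freiman ideals\<close>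

definition max_ideal :: "nat \<Rightarrow> 'a::field mpoly set" where
  "max_ideal n = Idl\<^bsub>S n\<^esub> (var ` {1..n})"

text \<open>
  The direct sum of the \<open>I\<^sup>j\<close> is realised as the Rees algebra, the ring of all polynomials
  \<open>\<Sum>\<^sub>j f\<^sub>j t\<^sup>j\<close> in one further variable \<open>t\<close> with \<open>f\<^sub>j \<in> I\<^sup>j\<close>. The fiber cone, the direct sum of the
  \<open>I\<^sup>j / \<mm>I\<^sup>j\<close> with its induced multiplication, is the quotient of the Rees algebra by the direct sum of
  the \<open>\<mm>I\<^sup>j\<close>.
\<close>

definition rees_algebra :: "nat \<Rightarrow> 'a::field mpoly set \<Rightarrow> 'a mpoly poly ring" where
  "rees_algebra n I =
     \<lparr>carrier = {f. \<forall>j. poly.coeff f j \<in> ideal_power (S n) I j},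
      monoid.mult = (*), one = 1, zero = 0, add = (+)\<rparr>"

definition fiber_cone :: "nat \<Rightarrow> 'a::field mpoly set \<Rightarrow> 'a mpoly poly set ring" where
  "fiber_cone n I =
     rees_algebra n I Quot
       {f. \<forall>j. poly.coeff f j \<in> ideal_prod (S n) (max_ideal n) (ideal_power (S n) I j)}"

definition analytic_spread :: "nat \<Rightarrow> 'a::field mpoly set \<Rightarrow> enat" where
  "analytic_spread n I = krull_dim (fiber_cone n I)"

text \<open>
  To be used for equigenerated monomial ideals. The equation is stated in \<open>\<int>\<close>, so that the
  subtraction is not truncated.
\<close>

definition freiman :: "nat \<Rightarrow> 'a::field mpoly set \<Rightarrow> bool" where
  "freiman n I \<longleftrightarrow>
     (\<exists>l. analytic_spread n I = enat l \<and>
          int (min_num_gens (S n) (ideal_power (S n) I 2)) =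
            int l * int (min_num_gens (S n) I) - int (l choose 2))"

end

theory Submission
  imports Defs
begin

text \<open>
  Why the theorem holds. Write a monomial as its exponent vector \<open>t\<close>. If \<open>u\<close> has degree \<open>d\<close>, then
  \<open>B(u)\<close> is generated by the set \<open>A\<close> of the exponent vectors \<open>t\<close> of degree \<open>d\<close> whose tail sums
  \<open>t\<^sub>k + t\<^sub>k\<^sub>+\<^sub>1 + \<dots>\<close> are all at most those of \<open>u\<close> (\<open>B_mon\<close>). All these generators have the
  same degree, so \<open>\<mu>(B(u)) = |A|\<close> and \<open>\<mu>(B(u)\<^sup>2) = |A + A|\<close> (\<open>min_num_gens_mideal\<close>), and
  the analytic spread is the largest index \<open>m\<close> of a variable dividing \<open>u\<close> (\<open>analytic_spread_eq\<close>).
  The ideal is therefore Freiman if and only if \<open>|A + A| = m |A| - (m choose 2)\<close>, a question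
  about a finite set of lattice points.

  The analytic spread. The fiber cone is the ring generated by the monomials in \<open>A\<close>. The vectors
  \<open>x\<^sub>1\<^sup>d\<^sup>-\<^sup>1 x\<^sub>j\<close> with \<open>j \<le> m\<close> all lie in \<open>A\<close>, and setting \<open>x\<^sub>m, x\<^sub>m\<^sub>-\<^sub>1, \<dots>, x\<^sub>1\<close> to zero one
  after the other gives a chain of \<open>m + 1\<close> distinct primes. Conversely, pick an element in each
  step of a chain of primes: the chosen elements are algebraically independent
  (\<open>chain_independent\<close>), and a count of monomials of bounded degree in \<open>m\<close> variables allows at most
  \<open>m\<close> of them (\<open>chain_length_le\<close>).

  The lattice points. For every \<open>A\<close> that is closed under Borel moves there are \<open>m |A| - (m choose 2)\<close>
  sums that are visibly distinct (\<open>freiman_bound\<close>). Order \<open>A\<close> lexicographically, the largest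
  index dominating, and call \<open>w \<le> v\<close> a new partner of \<open>v\<close> if \<open>v + w\<close> is not a sum of two elements
  below \<open>v\<close>. Sums of new partners for different \<open>v\<close> never coincide, and every \<open>v\<close> whose largest
  index is \<open>k\<close> has at least \<open>k\<close> new partners (\<open>top_var_new_partners\<close>). Adding to these the sums of \<open>v\<close> and
  \<open>x\<^sub>1\<^sup>d\<^sup>-\<^sup>1 x\<^sub>j\<close> with \<open>j > k\<close> gives \<open>m\<close> sums for each \<open>v\<close> that is not itself of the form
  \<open>x\<^sub>1\<^sup>d\<^sup>-\<^sup>1 x\<^sub>j\<close>, and \<open>(m + 1 choose 2)\<close> for the remaining ones together.

  Equality fails as soon as one \<open>v\<close> of the former kind has an additional new partner. If the last two of the \<open>d\<close>
  variables of \<open>u\<close>, in increasing order, have index at least 3, then \<open>x\<^sub>1\<^sup>d\<^sup>-\<^sup>2 x\<^sub>2 x\<^sub>m\<close> has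
  one when \<open>m \<ge> 4\<close>, and \<open>x\<^sub>1\<^sup>d\<^sup>-\<^sup>2 x\<^sub>3\<^sup>2\<close> has one when \<open>m = 3\<close>, unless
  \<open>u = x\<^sub>1\<^sup>d\<^sup>-\<^sup>2 x\<^sub>3\<^sup>2\<close> (\<open>sumset_gt\<close>). In all other cases \<open>A\<close> is so small that \<open>A\<close> and \<open>A + A\<close>
  can be counted, and equality holds (\<open>freiman_iff\<close>). The lists in the theorem spell out the
  resulting condition, for \<open>d = 2\<close>, \<open>d = 3\<close> and \<open>d \<ge> 4\<close>.
\<close>

section \<open>Exponent vectors\<close>

abbreviation lookup :: "('b \<Rightarrow>\<^sub>0 'c::zero) \<Rightarrow> 'b \<Rightarrow> 'c" where "lookup \<equiv> Poly_Mapping.lookup"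
abbreviation keys :: "('b \<Rightarrow>\<^sub>0 'c::zero) \<Rightarrow> 'b set" where "keys \<equiv> Poly_Mapping.keys"
abbreviation single :: "'b \<Rightarrow> 'c \<Rightarrow> ('b \<Rightarrow>\<^sub>0 'c::zero)" where "single \<equiv> Poly_Mapping.single"

type_synonym expo = "nat \<Rightarrow>\<^sub>0 nat"

definition tdeg :: "expo \<Rightarrow> nat" where
  "tdeg t = (\<Sum>i\<in>keys t. lookup t i)"

definition tail :: "expo \<Rightarrow> nat \<Rightarrow> nat" where
  "tail t k = (\<Sum>i | i \<in> keys t \<and> k \<le> i. lookup t i)"

definition sumset :: "expo set \<Rightarrow> expo set \<Rightarrow> expo set" where
  "sumset X Y = {a + b |a b. a \<in> X \<and> b \<in> Y}"

lemma lookup_single_if: "lookup (single i c) j = (if i = j then c else 0)"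
  by (simp add: lookup_single when_def)

lemma lookup_minus_nat: "lookup (s - t) i = lookup s i - (lookup t i :: nat)"
  by transfer simp

lemma keys_add_expo: "keys (s + t :: expo) = keys s \<union> keys t"
  by (auto simp: in_keys_iff lookup_add)

lemma tail_superset:
  assumes "finite X" "keys t \<subseteq> X"
  shows "tail t k = (\<Sum>i | i \<in> X \<and> k \<le> i. lookup t i)"
  unfolding tail_def using assms by (intro sum.mono_neutral_left) (auto simp: in_keys_iff)

lemma tdeg_superset:
  assumes "finite X" "keys t \<subseteq> X"
  shows "tdeg t = (\<Sum>i\<in>X. lookup t i)"
  unfolding tdeg_def using assms by (intro sum.mono_neutral_left) (auto simp: in_keys_iff)

lemma tail_0: "tail t 0 = tdeg t"
  by (simp add: tail_def tdeg_def)

lemma tail_add: "tail (s + t) k = tail s k + tail t k"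
  using tail_superset[of "keys s \<union> keys t"]
  by (simp add: keys_add_expo lookup_add sum.distrib)

lemma tdeg_add: "tdeg (s + t) = tdeg s + tdeg t"
  using tail_add[of s t 0] by (simp add: tail_0)

lemma tail_single: "tail (single i c) k = (if k \<le> i then c else 0)"
proof -
  have "{j. j \<in> {i} \<and> k \<le> j} = (if k \<le> i then {i} else {})" by auto
  then show ?thesis using tail_superset[of "{i}" "single i c" k] by (auto simp: lookup_single_if)
qed

lemma tdeg_single: "tdeg (single i c) = c"
  using tail_single[of i c 0] by (simp add: tail_0)

lemma tdeg_zero: "tdeg 0 = 0"
  by (simp add: tdeg_def)

lemma tdeg_eq_0: "tdeg t = 0 \<longleftrightarrow> t = 0"
proof
  assume "tdeg t = 0"
  then have "\<forall>i\<in>keys t. lookup t i = 0" by (simp add: tdeg_def)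
  then have "\<And>i. lookup t i = 0" by (metis in_keys_iff)
  then show "t = 0" by (intro poly_mapping_eqI) simp
qed (simp add: tdeg_zero)

lemma lookup_le_tdeg: "lookup t i \<le> tdeg t"
  by (cases "i \<in> keys t") (auto simp: tdeg_def in_keys_iff intro: member_le_sum)

lemma tail_Suc: "tail t k = lookup t k + tail t (Suc k)"
proof -
  have "{i. i \<in> insert k (keys t) \<and> k \<le> i} = insert k {i. i \<in> insert k (keys t) \<and> Suc k \<le> i}"
    by auto
  then show ?thesis
    by (subst (1 2) tail_superset[of "insert k (keys t)"]) auto
qed

lemma tail_antimono: "j \<le> k \<Longrightarrow> tail t k \<le> tail t j"
  unfolding tail_def by (intro sum_mono2) auto

lemma tail_eq_0: "tail t k = 0 \<longleftrightarrow> (\<forall>i\<ge>k. lookup t i = 0)"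
  by (auto simp: tail_def in_keys_iff)

lemma lookup_le_tail: "k \<le> i \<Longrightarrow> lookup t i \<le> tail t k"
  using tail_Suc[of t i] tail_antimono[of k i t] by simp

section \<open>Sums that are new in the lexicographic order\<close>

text \<open>
  The largest index dominates, so a Borel move, which replaces a variable by one of smaller index,
  makes an exponent vector smaller.
\<close>

definition rlex :: "expo \<Rightarrow> expo \<Rightarrow> bool" where
  "rlex a b \<longleftrightarrow> (\<exists>i. lookup a i < lookup b i \<and> (\<forall>j>i. lookup a j = lookup b j))"

lemma rlexI: "lookup a i < lookup b i \<Longrightarrow> (\<And>j. j > i \<Longrightarrow> lookup a j = lookup b j) \<Longrightarrow> rlex a b"
  by (auto simp: rlex_def)

lemma rlex_irrefl: "\<not> rlex a a"
  by (simp add: rlex_def)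

lemma rlex_trans: "rlex a b \<Longrightarrow> rlex b c \<Longrightarrow> rlex a c"
proof -
  assume "rlex a b" "rlex b c"
  then obtain i j where i: "lookup a i < lookup b i" "\<forall>k>i. lookup a k = lookup b k"
    and j: "lookup b j < lookup c j" "\<forall>k>j. lookup b k = lookup c k"
    unfolding rlex_def by blast
  show "rlex a c"
    by (rule rlexI[of _ "max i j"]) (use i j in \<open>cases i j rule: linorder_cases; auto simp: max_def\<close>)+
qed

lemma rlex_total: assumes "a \<noteq> b" shows "rlex a b \<or> rlex b a"
proof -
  let ?D = "{i. lookup a i \<noteq> lookup b i}"
  have "?D \<subseteq> keys a \<union> keys b" by (auto simp: in_keys_iff)
  then have fin: "finite ?D" by (rule finite_subset) simp
  have ne: "?D \<noteq> {}" using assms poly_mapping_eqI[of a b] by blast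
  define i where "i = Max ?D"
  have "i \<in> ?D" unfolding i_def using fin ne by (rule Max_in)
  then have "lookup a i \<noteq> lookup b i" by blast
  then have "lookup a i < lookup b i \<or> lookup b i < lookup a i" by linarith
  moreover have eq: "lookup a j = lookup b j" if "j > i" for j
  proof (rule ccontr)
    assume "lookup a j \<noteq> lookup b j"
    then have "j \<in> ?D" by blast
    then have "j \<le> i" unfolding i_def by (rule Max_ge[OF fin])
    with that show False by simp
  qed
  have "rlex a b" if "lookup a i < lookup b i" using rlexI[OF that eq] .
  moreover have "rlex b a" if "lookup b i < lookup a i" using rlexI[OF that eq[symmetric]] .
  ultimately show ?thesis by blast
qed

lemma rlex_cancel:
  assumes "rlex a b" "a + x = b + y" shows "rlex y x"
proof -
  from assms(1) obtain i where i: "lookup a i < lookup b i" "\<forall>j>i. lookup a j = lookup b j"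
    unfolding rlex_def by blast
  have "lookup a j + lookup x j = lookup b j + lookup y j" for j
    using assms(2) by (metis lookup_add)
  note s = this
  show ?thesis
  proof (rule rlexI[of _ i])
    show "lookup y i < lookup x i" using i(1) s[of i] by linarith
    show "lookup y j = lookup x j" if "j > i" for j using i(2) that s[of j] by simp
  qed
qed

lemma rlex_le_lookup:
  assumes "rlex a b" "\<And>j. j > i \<Longrightarrow> lookup a j = lookup b j"
  shows "lookup a i \<le> lookup b i"
proof -
  from assms(1) obtain p where p: "lookup a p < lookup b p" "\<forall>j>p. lookup a j = lookup b j"
    unfolding rlex_def by blast
  have "p \<le> i" using p(1) assms(2)[of p] by (cases "p > i") auto
  then show ?thesis using p by (cases "p = i") auto
qed

lemma rlex_max_exists:
  assumes "finite C" "C \<noteq> {}"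
  shows "\<exists>w\<in>C. \<forall>c\<in>C. c = w \<or> rlex c w"
  using assms
proof (induction rule: finite_ne_induct)
  case (insert x F)
  then obtain w where w: "w \<in> F" "\<forall>c\<in>F. c = w \<or> rlex c w" by blast
  show ?case
  proof (cases "rlex w x")
    case True
    then have "\<forall>c\<in>insert x F. c = x \<or> rlex c x" using w(2) rlex_trans[OF _ True] by auto
    then show ?thesis by blast
  next
    case False
    then have "\<forall>c\<in>insert x F. c = w \<or> rlex c w" using w rlex_total[of x w] by auto
    then show ?thesis using w(1) by blast
  qed
qed auto

text \<open>
  Where the order first distinguishes \<open>a\<close> from \<open>v\<close> the exponent of \<open>a\<close> is too small, so that of
  \<open>b\<close> would have to be too large; but \<open>b\<close> is also below \<open>v\<close>.
\<close>

lemma rlex_sum_agree_left: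
  assumes ab: "rlex a v" "rlex b v" "\<And>i. i > q \<Longrightarrow> lookup a i + lookup b i = 2 * lookup v i" "i > q"
  shows "lookup a i = lookup v i"
  proof (rule ccontr)
    assume "lookup a i \<noteq> lookup v i"
    from ab(1) obtain p where p: "lookup a p < lookup v p" "\<forall>j>p. lookup a j = lookup v j"
      unfolding rlex_def by blast
    have "i \<le> p" using p(2) \<open>lookup a i \<noteq> lookup v i\<close> by (cases "p < i") auto
    then have "p > q" using ab(4) by simp
    have "lookup b p \<le> lookup v p"
    proof (rule rlex_le_lookup[OF ab(2)])
      fix j assume "j > p"
      then have "j > q" using  \<open>p > q\<close> by simp
      from ab(3)[OF this] p(2) \<open>j > p\<close> show "lookup b j = lookup v j" by simp
    qed
    with ab(3)[OF \<open>p > q\<close>] p(1) show False by linarith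
  qed

lemma rlex_sum_agree:
  assumes "rlex a v" "rlex b v" "\<And>i. i > q \<Longrightarrow> lookup a i + lookup b i = 2 * lookup v i" "i > q"
  shows "lookup a i = lookup v i \<and> lookup b i = lookup v i"
  using rlex_sum_agree_left[OF assms(1,2,3,4)] assms(3)[OF assms(4)] by simp

text \<open>
  Attaching to every \<open>v\<close> the sums \<open>v + w\<close> with its new partners counts every sum at most once: the
  larger summand of a sum counted for \<open>v\<close> cannot lie below \<open>v\<close>.
\<close>

definition new_partners :: "expo set \<Rightarrow> expo \<Rightarrow> expo set" where
  "new_partners A v = {w \<in> A. (w = v \<or> rlex w v) \<and>
     \<not> (\<exists>a\<in>A. \<exists>b\<in>A. rlex a v \<and> rlex b v \<and> a + b = v + w)}"

lemma self_new_partner: "v \<in> A \<Longrightarrow> v \<in> new_partners A v"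
proof -
  have False if "rlex a v" "rlex b v" "a + b = v + v" for a b
    using rlex_cancel[OF that(1,3)] that(2) rlex_trans rlex_irrefl by blast
  then show "v \<in> A \<Longrightarrow> v \<in> new_partners A v"
    unfolding new_partners_def by blast
qed

text \<open>
  The basic source of new partners. The set \<open>C\<close> prescribes \<open>w\<close> above an index \<open>j\<close>: it copies \<open>v\<close> above \<open>q\<close>,
  loses one at \<open>q\<close>, and has a given pattern \<open>g\<close> on the gap between \<open>j\<close> and \<open>q\<close> where \<open>v\<close> vanishes.
  If \<open>v + w = a + b\<close> with \<open>a, b < v\<close>, then \<open>a\<close> and \<open>b\<close> agree with \<open>v\<close> above \<open>q\<close>, one of them, say
  \<open>a\<close>, agrees with \<open>v\<close> also at \<open>q\<close> and hence vanishes on the gap, so \<open>b\<close> lies in \<open>C\<close>. Now \<open>a < v\<close> forces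
  \<open>b > w\<close>, which is impossible when \<open>w\<close> is the largest element of \<open>C\<close>.
\<close>

lemma pattern_new_partner:
  assumes "finite A" and q: "q \<in> keys v" and jq: "j < q"
    and gap: "\<And>i. j < i \<Longrightarrow> i < q \<Longrightarrow> lookup v i = 0"
    and C_def: "C = {w \<in> A. (\<forall>i>q. lookup w i = lookup v i) \<and> lookup w q + 1 = lookup v q
                       \<and> (\<forall>i. j < i \<and> i < q \<longrightarrow> lookup w i = g i)}"
    and "C \<noteq> {}"
  obtains w where "w \<in> C" "w \<in> new_partners A v" "\<And>c. c \<in> C \<Longrightarrow> c = w \<or> rlex c w"
proof -
  have "finite C" using assms(1) C_def by simp
  from rlex_max_exists[OF this \<open>C \<noteq> {}\<close>] obtain w
    where w: "w \<in> C" and max: "\<And>c. c \<in> C \<Longrightarrow> c = w \<or> rlex c w" by blast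
  have wv: "rlex w v" using w unfolding C_def by (intro rlexI[of _ q]) auto
  have aux: False if ab: "a \<in> A" "b \<in> A" "rlex a v" "rlex b v" "a + b = v + w" "lookup a q = lookup v q" for a b
  proof -
    have s: "lookup a i + lookup b i = lookup v i + lookup w i" for i
      using arg_cong[OF ab(5), of "\<lambda>t. lookup t i"] by (simp add: lookup_add)
    have agree: "lookup a i = lookup v i \<and> lookup b i = lookup v i" if "i > q" for i
      using rlex_sum_agree[OF ab(3,4) _ that] s w unfolding C_def by simp
    have a0: "lookup a i = 0" if "j < i" "i < q" for i
    proof (rule ccontr)
      assume ne: "lookup a i \<noteq> 0"
      from ab(3) obtain p where p: "lookup a p < lookup v p" "\<forall>j>p. lookup a j = lookup v j"
        unfolding rlex_def by blast
      have "\<not> p \<ge> q" using p(1) agree ab(6) by (metis le_eq_less_or_eq less_irrefl)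
      moreover have "\<not> (j < p \<and> p < q)" using p(1) gap by auto
      ultimately have "p \<le> j" by auto
      then show False using p(2) gap that ne by auto
    qed
    have "b \<in> C"
      using ab(2) agree s[of q] ab(6) w s a0 gap unfolding C_def
      by (auto) (metis add_cancel_right_left add_0)
    then have "b = w \<or> rlex b w" by (rule max)
    moreover have "rlex w b" using rlex_cancel[OF ab(3,5)] .
    ultimately show False using rlex_irrefl rlex_trans by blast
  qed
  have "w \<in> new_partners A v"
    unfolding new_partners_def
  proof (intro CollectI conjI notI)
    show "w \<in> A" using w C_def by simp
    show "w = v \<or> rlex w v" using wv by simp
    assume "\<exists>a\<in>A. \<exists>b\<in>A. rlex a v \<and> rlex b v \<and> a + b = v + w"
    then obtain a b where ab: "a \<in> A" "b \<in> A" "rlex a v" "rlex b v" "a + b = v + w" by blast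
    have s: "lookup a i + lookup b i = lookup v i + lookup w i" for i
      using arg_cong[OF ab(5), of "\<lambda>t. lookup t i"] by (simp add: lookup_add)
    have agree: "lookup a i = lookup v i \<and> lookup b i = lookup v i" if "i > q" for i
      using rlex_sum_agree[OF ab(3,4) _ that] s w unfolding C_def by simp
    have "lookup a q \<le> lookup v q" "lookup b q \<le> lookup v q"
      using rlex_le_lookup[of _ v q] ab(3,4) agree by blast+
    then have "lookup a q = lookup v q \<or> lookup b q = lookup v q"
      using s[of q] w unfolding C_def by auto
    then show False using aux[OF ab] aux[OF ab(2,1,4,3)] ab(5) by (auto simp: add.commute)
  qed
  then show thesis using that w max by blast
qed

definition borel_move :: "expo \<Rightarrow> nat \<Rightarrow> nat \<Rightarrow> expo" where
  "borel_move t j i = t - single j 1 + single i 1"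

definition borel_closed :: "expo set \<Rightarrow> bool" where
  "borel_closed A \<longleftrightarrow> (\<forall>t\<in>A. \<forall>j\<in>keys t. \<forall>i. 1 \<le> i \<and> i < j \<longrightarrow> borel_move t j i \<in> A)"

text \<open>
  All facts on a move are read off from this equation, which avoids the truncated subtraction.
\<close>

lemma borel_move_add:
  assumes "j \<in> keys t" shows "borel_move t j i + single j 1 = t + single i 1"
proof (rule poly_mapping_eqI)
  fix k
  have "lookup t j \<noteq> 0" using assms by (simp add: in_keys_iff)
  then show "lookup (borel_move t j i + single j 1) k = lookup (t + single i 1) k"
    by (auto simp: borel_move_def lookup_add lookup_minus_nat lookup_single_if)
qed

lemma lookup_borel_move:
  assumes "i < j"
  shows "lookup (borel_move t j i) k =
    (if k = j then lookup t k - 1 else if k = i then lookup t k + 1 else lookup t k)"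
  using assms by (simp add: borel_move_def lookup_add lookup_minus_nat lookup_single_if)

definition top_var :: "expo \<Rightarrow> nat" where
  "top_var t = Max (keys t)"

definition slice :: "expo set \<Rightarrow> expo \<Rightarrow> nat \<Rightarrow> nat \<Rightarrow> expo set" where
  "slice A v q l = {w \<in> A. (\<forall>i>q. lookup w i = lookup v i) \<and> lookup w q + 1 = lookup v q
                       \<and> (\<forall>i. l < i \<and> i < q \<longrightarrow> lookup w i = 0)}"

text \<open>
  For every \<open>l\<close> below the largest index of \<open>v\<close>, the preceding lemma is applied with \<open>j = l\<close>, with the next
  index \<open>q > l\<close> occurring in \<open>v\<close>, and with the zero pattern; the move of \<open>x\<^sub>q\<close> to \<open>x\<^sub>l\<close> shows that
  this slice is nonempty and that its maximum has a larger exponent at \<open>l\<close> than \<open>v\<close>. Together with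
  \<open>v\<close> itself (at \<open>l = 0\<close>) these maxima are distinct new partners. The description of \<open>w l\<close> serves
  to recognise further new partners as different from all of these.
\<close>

lemma top_var_new_partners:
  assumes "finite A" "borel_closed A" "v \<in> A" "v \<noteq> 0"
  shows "\<exists>w. inj_on w {0..<top_var v} \<and> w ` {0..<top_var v} \<subseteq> new_partners A v \<and> w 0 = v \<and>
    (\<forall>l. 1 \<le> l \<and> l < top_var v \<longrightarrow> (\<exists>q>l. q \<in> keys v \<and> (\<forall>i. l < i \<and> i < q \<longrightarrow> lookup v i = 0) \<and>
       w l \<in> slice A v q l \<and> (\<forall>c\<in>slice A v q l. lookup c l \<le> lookup (w l) l) \<and> lookup v l < lookup (w l) l))"
proof -
  define k where "k = top_var v"
  have kne: "keys v \<noteq> {}" using \<open>v \<noteq> 0\<close> by simp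
  have kv: "k \<in> keys v" unfolding k_def top_var_def using kne by simp
  define Q where "Q l = Min {i \<in> keys v. i > l}" for l
  have Q: "Q l \<in> keys v" "l < Q l" "\<And>i. l < i \<Longrightarrow> i < Q l \<Longrightarrow> lookup v i = 0" if "l < k" for l
  proof -
    have ne: "{i \<in> keys v. i > l} \<noteq> {}" using kv that by auto
    have "Q l \<in> {i \<in> keys v. i > l}" unfolding Q_def using ne by (intro Min_in) auto
    then show "Q l \<in> keys v" "l < Q l" by auto
    fix i assume i: "l < i" "i < Q l"
    show "lookup v i = 0"
    proof (rule ccontr)
      assume "lookup v i \<noteq> 0"
      then have "Q l \<le> i" unfolding Q_def using i by (intro Min_le) (auto simp: in_keys_iff)
      with i show False by simp
    qed
  qed
  define C where "C l = slice A v (Q l) l" for l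
  note C_slice = C_def
  note C_def = C_slice[unfolded slice_def]
  have mem: "borel_move v (Q l) l \<in> C l" if "1 \<le> l" "l < k" for l
  proof -
    have "lookup v (Q l) \<noteq> 0" using Q(1)[OF that(2)] by (simp add: in_keys_iff)
    moreover have "borel_move v (Q l) l \<in> A"
      using assms(2,3) Q[OF that(2)] that unfolding borel_closed_def by blast
    ultimately show ?thesis using Q[OF that(2)] unfolding C_def by (auto simp: lookup_borel_move)
  qed
  have "\<exists>w. w \<in> C l \<and> w \<in> new_partners A v \<and> (\<forall>c. c \<in> C l \<longrightarrow> c = w \<or> rlex c w)"
    if l: "1 \<le> l" "l < k" for l
  proof -
    have "C l \<noteq> {}" using mem[OF l] by blast
    from pattern_new_partner[OF assms(1) Q(1)[OF l(2)] Q(2)[OF l(2)] Q(3)[OF l(2)] C_def this]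
    obtain w where "w \<in> C l" "w \<in> new_partners A v" "\<And>c. c \<in> C l \<Longrightarrow> c = w \<or> rlex c w" by blast
    then show ?thesis by blast
  qed
  then obtain f where f: "\<And>l. 1 \<le> l \<Longrightarrow> l < k \<Longrightarrow> f l \<in> C l \<and> f l \<in> new_partners A v \<and> (\<forall>c. c \<in> C l \<longrightarrow> c = f l \<or> rlex c (f l))"
    by metis
  have fmax: "lookup c l \<le> lookup (f l) l" if "1 \<le> l" "l < k" "c \<in> C l" for c l
  proof -
    have "c = f l \<or> rlex c (f l)" using f that by blast
    moreover have "lookup c i = lookup (f l) i" if "i > l" for i
      using \<open>c \<in> C l\<close> f[of l] \<open>1 \<le> l\<close> \<open>l < k\<close> that unfolding C_def
      by (auto) (metis Suc_eq_plus1 add_right_cancel linorder_neqE_nat)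
    ultimately show ?thesis using rlex_le_lookup[of c "f l" l] by auto
  qed
  have fgt: "lookup v l < lookup (f l) l" if "1 \<le> l" "l < k" for l
    using fmax[OF that mem[OF that]] Q[OF that(2)] by (simp add: lookup_borel_move)
  define w where "w l = (if l = 0 then v else f l)" for l
  \<comment> \<open>If the gap of \<open>l\<close> contains \<open>l'\<close>, the exponents at \<open>l'\<close> differ; otherwise those at \<open>Q l'\<close> do.\<close>
  have "f l \<noteq> f l'" if "1 \<le> l" "l < l'" "l' < k" for l l'
  proof (cases "Q l > l'")
    case True
    have "lookup (f l) l' = 0" using f[of l] that True unfolding C_def by auto
    moreover have "lookup (f l') l' > 0" using fgt[of l'] that by simp
    ultimately show ?thesis by auto
  next
    case False
    then have "Q l < Q l'" using Q(2)[of l'] that by simp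
    then have "lookup (f l) (Q l') = lookup v (Q l')" using f[of l] that unfolding C_def by auto
    moreover have "lookup (f l') (Q l') + 1 = lookup v (Q l')" using f[of l'] that unfolding C_def by auto
    ultimately show ?thesis by auto
  qed
  then have neq: "f l \<noteq> f l'" if "1 \<le> l" "l \<noteq> l'" "1 \<le> l'" "l < k" "l' < k" for l l'
    using that by (metis linorder_neqE_nat)
  have nv: "f l \<noteq> v" if "1 \<le> l" "l < k" for l using fgt[OF that] by auto
  have inj: "inj_on w {0..<k}"
  proof (rule inj_onI)
    fix a b assume "a \<in> {0..<k}" "b \<in> {0..<k}" "w a = w b"
    then show "a = b" using neq[of a b] nv[of a] nv[of b] unfolding w_def
      by (auto split: if_splits)
  qed
  have sub: "w ` {0..<k} \<subseteq> new_partners A v"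
    using f self_new_partner[OF assms(3)] by (auto simp: w_def)
  have w0: "w 0 = v" by (simp add: w_def)
  have "\<exists>q>l. q \<in> keys v \<and> (\<forall>i. l < i \<and> i < q \<longrightarrow> lookup v i = 0) \<and>
       w l \<in> slice A v q l \<and> (\<forall>c\<in>slice A v q l. lookup c l \<le> lookup (w l) l) \<and> lookup v l < lookup (w l) l"
    if "1 \<le> l \<and> l < k" for l
  proof (intro exI[of _ "Q l"] conjI)
    have l: "1 \<le> l" "l < k" using that by auto
    have wl: "w l = f l" using l by (simp add: w_def)
    show "Q l > l" "Q l \<in> keys v" using Q l by auto
    show "\<forall>i. l < i \<and> i < Q l \<longrightarrow> lookup v i = 0" using Q(3)[OF l(2)] by blast
    show "w l \<in> slice A v (Q l) l" using f[OF l] unfolding wl C_slice by blast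
    show "\<forall>c\<in>slice A v (Q l) l. lookup c l \<le> lookup (w l) l"
      using fmax[OF l] unfolding wl C_slice by blast
    show "lookup v l < lookup (w l) l" using fgt[OF l] unfolding wl .
  qed
  then have 5: "\<forall>l. 1 \<le> l \<and> l < k \<longrightarrow> (\<exists>q>l. q \<in> keys v \<and> (\<forall>i. l < i \<and> i < q \<longrightarrow> lookup v i = 0) \<and>
       w l \<in> slice A v q l \<and> (\<forall>c\<in>slice A v q l. lookup c l \<le> lookup (w l) l) \<and> lookup v l < lookup (w l) l)"
    by blast
  show ?thesis unfolding k_def[symmetric]
    by (rule exI[of _ w], intro conjI inj sub w0 5)
qed

section \<open>A Freiman inequality for Borel closed sets\<close>

text \<open>
  The vectors \<open>x\<^sub>1\<^sup>d\<^sup>-\<^sup>1 x\<^sub>j\<close>. After setting \<open>x\<^sub>1 = 1\<close> they are the constant 1 and the variables, a standard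
  simplex in the dehomogenised set.
\<close>

definition lin :: "nat \<Rightarrow> nat \<Rightarrow> expo" where
  "lin d j = single 1 (d - 1) + single j 1"

lemma lookup_lin: "lookup (lin d j) i = (if i = 1 then d - 1 else 0) + (if i = j then 1 else 0)"
  by (auto simp: lin_def lookup_add lookup_single_if)

locale borel_set =
  fixes A :: "expo set" and d m :: nat
  assumes finite_A: "finite A"
    and closed: "borel_closed A"
    and keys_A: "t \<in> A \<Longrightarrow> keys t \<subseteq> {1..m}"
    and tdeg_A: "t \<in> A \<Longrightarrow> tdeg t = d"
    and d_pos: "d \<ge> 1"
    and lin_A: "1 \<le> j \<Longrightarrow> j \<le> m \<Longrightarrow> lin d j \<in> A"
begin

definition L where "L = lin d ` {1..m}"

definition partners where "partners v = (if v \<in> L then {v} else new_partners A v)"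

lemma nonzero: "t \<in> A \<Longrightarrow> t \<noteq> 0"
  using tdeg_A[of t] d_pos by (auto simp: tdeg_zero)

lemma top_var_keys: assumes "t \<in> A" shows "top_var t \<in> keys t"
  unfolding top_var_def using nonzero[OF assms] by (intro Max_in) auto

lemma top_var_range: assumes "t \<in> A" shows "1 \<le> top_var t" "top_var t \<le> m" "lookup t (top_var t) \<ge> 1"
proof -
  have "top_var t \<in> {1..m}" using top_var_keys[OF assms] keys_A[OF assms] by blast
  then show "1 \<le> top_var t" "top_var t \<le> m" by auto
  show "lookup t (top_var t) \<ge> 1" using top_var_keys[OF assms] by (simp add: in_keys_iff Suc_le_eq)
qed

lemma above_top_var: assumes "i > top_var t" shows "lookup t i = 0"
proof (rule ccontr)
  assume "lookup t i \<noteq> 0"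
  then have "i \<in> keys t" by (simp add: in_keys_iff)
  then have "i \<le> top_var t" unfolding top_var_def by simp
  with assms show False by simp
qed

lemma lookup_0: "t \<in> A \<Longrightarrow> lookup t 0 = 0"
  using keys_A[of t] by (metis atLeastAtMost_iff in_keys_iff not_one_le_zero subsetD)

lemma top_var_lin: assumes "1 \<le> j" shows "top_var (lin d j) = j"
proof -
  have "keys (lin d j) = (if d = 1 then {j} else {1, j})"
    using assms d_pos by (auto simp: in_keys_iff lookup_lin split: if_splits)
  then show ?thesis using assms unfolding top_var_def by auto
qed

lemma L_subset: "L \<subseteq> A"
  using lin_A by (auto simp: L_def)

lemma partners_subset: "v \<in> A \<Longrightarrow> partners v \<subseteq> new_partners A v"
  using self_new_partner by (auto simp: partners_def)

lemma new_partner_cases: "w \<in> new_partners A v \<Longrightarrow> w \<in> A \<and> (w = v \<or> rlex w v)"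
  by (simp add: new_partners_def)

lemma new_partner_not_sum:
  assumes "w \<in> new_partners A v" "a \<in> A" "b \<in> A" "rlex a v" "rlex b v" shows "a + b \<noteq> v + w"
  using assms unfolding new_partners_def by blast

text \<open>
  A vector in \<open>A\<close> with largest index \<open>j\<close> and exponent 1 there can be below \<open>x\<^sub>1\<^sup>d\<^sup>-\<^sup>1 x\<^sub>j\<close> only if the
  exponent of \<open>x\<^sub>1\<close> is smaller, and then its degree is too small.
\<close>

lemma lin_rlex:
  assumes "v \<in> A" "v \<notin> L" "lookup v j = 1" "\<And>i. i > j \<Longrightarrow> lookup v i = 0" "2 \<le> j" "j \<le> m"
  shows "rlex (lin d j) v"
proof (rule ccontr)
  assume "\<not> rlex (lin d j) v"
  moreover have "lin d j \<noteq> v" using assms(2,5,6) by (auto simp: L_def)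
  ultimately have "rlex v (lin d j)" using rlex_total by blast
  then obtain i where i: "lookup v i < lookup (lin d j) i" "\<forall>k>i. lookup v k = lookup (lin d j) k"
    unfolding rlex_def by blast
  have "\<not> i > j" using i(1) assms(4)[of i] assms(5) by (auto simp: lookup_lin)
  moreover have "i \<noteq> j" using i(1) assms(3,5) by (auto simp: lookup_lin)
  ultimately have "i = 1" using i(1) by (auto simp: lookup_lin split: if_splits)
  have small: "lookup v k = 0" if "k \<noteq> 1" "k \<noteq> j" for k
  proof (cases "k = 0")
    case True then show ?thesis using lookup_0[OF assms(1)] by simp
  next
    case False
    then have "k > i" using that \<open>i = 1\<close> by simp
    then show ?thesis using i(2) that by (simp add: lookup_lin)
  qed
  have "keys v \<subseteq> {1, j}" using small by (auto simp: in_keys_iff)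
  then have "tdeg v = lookup v 1 + lookup v j"
    using assms(5) by (subst tdeg_superset[of "{1, j}"]) auto
  then have "lookup v 1 = d - 1" using tdeg_A[OF assms(1)] assms(3) by simp
  then show False using i(1) \<open>i = 1\<close> assms(5) by (simp add: lookup_lin)
qed

lemma finite_partners: "v \<in> A \<Longrightarrow> finite (partners v)"
  using finite_A finite_subset[of "partners v" A] partners_subset new_partner_cases by blast

text \<open>
  Two families of sums: \<open>F1\<close> adds to \<open>v\<close> a vector \<open>x\<^sub>1\<^sup>d\<^sup>-\<^sup>1 x\<^sub>j\<close> with \<open>j\<close> beyond all indices of \<open>v\<close>, so that
  \<open>j\<close> and \<open>v\<close> can be read off from the sum; \<open>F2\<close> adds new partners. A sum in both would have
  exponent 1 at its largest index, and its decomposition in \<open>F1\<close> would contradict newness in \<open>F2\<close>.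
\<close>

lemma card_sumset_ge_sums:
  "(\<Sum>v\<in>A. m - top_var v) + (\<Sum>v\<in>A. card (partners v)) \<le> card (sumset A A)"
proof -
  define F1 where "F1 = (\<lambda>(v, j). v + lin d j) ` (SIGMA v:A. {top_var v<..m})"
  define F2 where "F2 = (\<lambda>(v, w). v + w) ` (SIGMA v:A. partners v)"
  have inj1: "inj_on (\<lambda>(v, j). v + lin d j) (SIGMA v:A. {top_var v<..m})"
  proof (rule inj_onI, clarify)
    fix v j v' j'
    assume a: "v \<in> A" "v' \<in> A" "j \<in> {top_var v<..m}" "j' \<in> {top_var v'<..m}" "v + lin d j = v' + lin d j'"
    have "\<not> j < j'" if "v \<in> A" "v' \<in> A" "top_var v < j" "top_var v' < j'" "v + lin d j = v' + lin d j'" for v v' j j'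
    proof
      assume "j < j'"
      have "1 \<le> top_var v" using top_var_range that by blast
      then have "j' \<noteq> 1" "j \<noteq> j'" "lookup v j' = 0" using above_top_var[of v j'] that \<open>j < j'\<close> by auto
      then have "lookup (v + lin d j) j' = 0" by (simp only: lookup_add lookup_lin) simp
      moreover have "lookup (v' + lin d j') j' \<ge> 1" by (simp add: lookup_add lookup_lin)
      ultimately show False using that(5) by simp
    qed
    from this[of v v' j j'] this[of v' v j' j] a have "j = j'" by (auto simp: not_less)
    with a(5) show "v = v' \<and> j = j'" by simp
  qed
  have inj2: "inj_on (\<lambda>(v, w). v + w) (SIGMA v:A. partners v)"
  proof (rule inj_onI, clarify)
    fix v w v' w'
    assume a: "v \<in> A" "v' \<in> A" "w \<in> partners v" "w' \<in> partners v'" "v + w = v' + w'"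
    have no: False if h: "v \<in> A" "v' \<in> A" "w \<in> partners v" "w' \<in> partners v'" "v + w = v' + w'" "rlex v' v" for v w v' w'
    proof -
      have w: "w \<in> new_partners A v" "w' \<in> new_partners A v'" using partners_subset h by blast+
      then have "rlex w' v" using new_partner_cases[of w' v'] h(6) rlex_trans by blast
      then show False using new_partner_not_sum[OF w(1), of v' w'] h new_partner_cases[OF w(2)] by simp
    qed
    have "v = v'"
      using no[OF a] no[OF a(2,1,4,3) a(5)[symmetric]] rlex_total[of v v'] by blast
    with a(5) show "v = v' \<and> w = w'" by simp
  qed
  have disj: "F1 \<inter> F2 = {}"
  proof (rule ccontr)
    assume "F1 \<inter> F2 \<noteq> {}"
    then obtain u j v w where h: "u \<in> A" "top_var u < j" "j \<le> m" "v \<in> A" "w \<in> partners v" "u + lin d j = v + w"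
      unfolding F1_def F2_def by auto
    have w: "w \<in> new_partners A v" using partners_subset h by blast
    then have wv: "w \<in> A" "w = v \<or> rlex w v" using new_partner_cases by auto
    have j2: "2 \<le> j" using top_var_range(1)[OF h(1)] h(2) by simp
    have s: "lookup u i + lookup (lin d j) i = lookup v i + lookup w i" for i
      using arg_cong[OF h(6), of "\<lambda>t. lookup t i"] by (simp add: lookup_add)
    have above: "lookup v i = 0" "lookup w i = 0" if "i > j" for i
      using s[of i] above_top_var[of u i] h(2) that j2 by (auto simp: lookup_lin)
    have sj: "lookup v j + lookup w j = 1" using s[of j] above_top_var[OF h(2)] j2 by (simp add: lookup_lin)
    have neq: "w \<noteq> v"
    proof
      assume "w = v" with sj have "lookup v j + lookup v j = 1" by (simp only:)
      then show False by presburger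
    qed
    have "lookup w j \<le> lookup v j" using rlex_le_lookup[of w v j] wv(2) above by auto
    then have vj: "lookup v j = 1" using sj by simp
    have "v \<notin> L" using neq h(5) by (auto simp: partners_def)
    then have lin: "rlex (lin d j) v" by (rule lin_rlex[OF h(4) _ vj above(1) j2 h(3)])
    have "rlex u v"
    proof (rule rlexI[of _ j])
      show "lookup u j < lookup v j" using above_top_var[OF h(2)] vj by simp
      show "lookup u k = lookup v k" if "k > j" for k using above_top_var[of u k] h(2) above(1)[OF that] that by simp
    qed
    from new_partner_not_sum[OF w h(1) lin_A this lin] h(3,6) j2 show False by simp
  qed
  have sub: "F1 \<union> F2 \<subseteq> sumset A A"
  proof
    fix z assume "z \<in> F1 \<union> F2"
    then show "z \<in> sumset A A"
    proof
      assume "z \<in> F1"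
      then obtain v j where h: "v \<in> A" "top_var v < j" "j \<le> m" "z = v + lin d j" unfolding F1_def by auto
      then have "lin d j \<in> A" using lin_A by simp
      with h show ?thesis unfolding sumset_def by blast
    next
      assume "z \<in> F2"
      then obtain v w where h: "v \<in> A" "w \<in> partners v" "z = v + w" unfolding F2_def by auto
      then have "w \<in> A" using partners_subset new_partner_cases by blast
      with h show ?thesis unfolding sumset_def by blast
    qed
  qed
  have "sumset A A = (\<lambda>(a, b). a + b) ` (A \<times> A)" unfolding sumset_def by auto
  then have fin: "finite (sumset A A)" using finite_A by simp
  have "card F1 = (\<Sum>v\<in>A. m - top_var v)"
    unfolding F1_def card_image[OF inj1] using finite_A by (subst card_SigmaI) auto
  moreover have "card F2 = (\<Sum>v\<in>A. card (partners v))"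
    unfolding F2_def card_image[OF inj2] using finite_A finite_partners by (subst card_SigmaI) auto
  moreover have "card (F1 \<union> F2) = card F1 + card F2"
    using finite_subset[OF sub fin] by (intro card_Un_disjoint disj) auto
  ultimately show ?thesis using card_mono[OF fin sub] by simp
qed

lemma card_new_partners_ge: assumes "v \<in> A" shows "top_var v \<le> card (new_partners A v)"
proof -
  obtain w where w: "inj_on w {0..<top_var v}" "w ` {0..<top_var v} \<subseteq> new_partners A v"
    using top_var_new_partners[OF finite_A closed assms nonzero[OF assms]] by blast
  have "finite (new_partners A v)" using finite_A unfolding new_partners_def by simp
  from card_mono[OF this w(2)] card_image[OF w(1)] show ?thesis by simp
qed

lemma inj_lin: "inj_on (lin d) {1..m}"
  by (rule inj_onI) (metis atLeastAtMost_iff top_var_lin)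

text \<open>
  The bookkeeping behind the number \<open>m |A| - (m choose 2)\<close>: each vector contributes \<open>m\<close> sums, except that
  \<open>x\<^sub>1\<^sup>d\<^sup>-\<^sup>1 x\<^sub>j\<close> contributes only \<open>m - j + 1\<close>.
\<close>

lemma weight_sum: "(\<Sum>v\<in>A. if v \<in> L then m - top_var v + 1 else m) + (m choose 2) = m * card A"
proof -
  have "(\<Sum>v\<in>L. m - top_var v + 1) = (\<Sum>j\<in>{1..m}. m - j + 1)"
    unfolding L_def by (subst sum.reindex[OF inj_lin]) (auto simp: top_var_lin intro!: sum.cong)
  also have "\<dots> + (m choose 2) = m * m"
  proof (induction m)
    case (Suc m)
    have "(\<Sum>j\<in>{1..Suc m}. Suc m - j + 1) = (\<Sum>j\<in>{1..m}. Suc m - j + 1) + 1" by simp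
    also have "(\<Sum>j\<in>{1..m}. Suc m - j + 1) = (\<Sum>j\<in>{1..m}. (m - j + 1) + 1)"
      by (intro sum.cong) auto
    also have "\<dots> = (\<Sum>j\<in>{1..m}. m - j + 1) + m" by (subst sum.distrib) simp
    finally show ?case using Suc by (simp add: numeral_2_eq_2)
  qed simp
  finally have L: "(\<Sum>v\<in>L. m - top_var v + 1) + (m choose 2) = m * m" .
  have cL: "card L = m" unfolding L_def using card_image[OF inj_lin] by simp
  have "(\<Sum>v\<in>A. if v \<in> L then m - top_var v + 1 else m) = (\<Sum>v\<in>L. m - top_var v + 1) + (\<Sum>v\<in>A-L. m)"
    using sum.subset_diff[OF L_subset finite_A, of "\<lambda>v. if v \<in> L then m - top_var v + 1 else m"]
    by (simp add: add.commute)
  also have "(\<Sum>v\<in>A-L. m) = m * (card A - m)"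
    using card_Diff_subset[of L A] finite_subset[OF L_subset finite_A] L_subset cL by simp
  finally have "(\<Sum>v\<in>A. if v \<in> L then m - top_var v + 1 else m) + (m choose 2) = m * m + m * (card A - m)"
    using L by simp
  also have "\<dots> = m * card A"
    using card_mono[OF finite_A L_subset] cL by (simp add: distrib_left[symmetric])
  finally show ?thesis .
qed

lemma partner_weight:
  assumes "v \<in> A"
  shows "(if v \<in> L then m - top_var v + 1 else m) \<le> (m - top_var v) + card (partners v)"
  using card_new_partners_ge[OF assms] top_var_range(2)[OF assms] by (auto simp: partners_def)

theorem freiman_bound: "m * card A \<le> card (sumset A A) + (m choose 2)"
proof -
  have "(\<Sum>v\<in>A. if v \<in> L then m - top_var v + 1 else m) \<le> (\<Sum>v\<in>A. (m - top_var v) + card (partners v))"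
    by (intro sum_mono partner_weight)
  then show ?thesis using weight_sum card_sumset_ge_sums by (simp add: sum.distrib)
qed

theorem freiman_bound_strict:
  assumes "v \<in> A" "v \<notin> L" "top_var v < card (new_partners A v)"
  shows "m * card A < card (sumset A A) + (m choose 2)"
proof -
  have "(\<Sum>v\<in>A. if v \<in> L then m - top_var v + 1 else m) < (\<Sum>v\<in>A. (m - top_var v) + card (partners v))"
    using finite_A partner_weight assms(1) top_var_range(2)[OF assms(1)] assms(2,3)
    by (intro sum_strict_mono_ex1 bexI[of _ v]) (auto simp: partners_def)
  then show ?thesis using weight_sum card_sumset_ge_sums by (simp add: sum.distrib)
qed

end

section \<open>Principal Borel sets and strictness\<close>

text \<open>
  The exponent vectors of the minimal generators of \<open>B(u)\<close>. If the variables of \<open>u\<close> are listed with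
  increasing indices, these are the lists of the same length whose indices are bounded entry by entry;
  comparing tail sums expresses the same without lists.
\<close>

definition borel_below :: "expo \<Rightarrow> expo set" where
  "borel_below u = {t. 0 \<notin> keys t \<and> tdeg t = tdeg u \<and> (\<forall>k. tail t k \<le> tail u k)}"

lemma inj_on_restrict_lookup: "inj_on (\<lambda>t :: expo. restrict (lookup t) X) {t. keys t \<subseteq> X}"
proof (rule inj_onI, rule poly_mapping_eqI)
  fix s t :: expo and i
  assume a: "s \<in> {t. keys t \<subseteq> X}" "t \<in> {t. keys t \<subseteq> X}" "restrict (lookup s) X = restrict (lookup t) X"
  show "lookup s i = lookup t i"
  proof (cases "i \<in> X")
    case True then show ?thesis using fun_cong[OF a(3), of i] by simp
  next
    case False
    then have "i \<notin> keys s" "i \<notin> keys t" using a by auto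
    then show ?thesis by (simp add: in_keys_iff)
  qed
qed

text \<open>
  The bound on the cardinality is crude; only its degree as a polynomial in \<open>d\<close> matters below.
\<close>

lemma bounded_expos:
  assumes "finite X"
  shows finite_expos: "finite {t :: expo. keys t \<subseteq> X \<and> tdeg t \<le> d}"
    and card_expos_le: "card {t :: expo. keys t \<subseteq> X \<and> tdeg t \<le> d} \<le> Suc d ^ card X"
proof -
  let ?f = "\<lambda>t :: expo. restrict (lookup t) X"
  have inj: "inj_on ?f {t. keys t \<subseteq> X \<and> tdeg t \<le> d}"
    by (rule inj_on_subset[OF inj_on_restrict_lookup]) auto
  have sub: "?f ` {t. keys t \<subseteq> X \<and> tdeg t \<le> d} \<subseteq> X \<rightarrow>\<^sub>E {..d}"
    using lookup_le_tdeg le_trans by fastforce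
  have fin: "finite (X \<rightarrow>\<^sub>E {..d})" by (rule finite_PiE[OF assms]) simp
  show "finite {t :: expo. keys t \<subseteq> X \<and> tdeg t \<le> d}"
    by (rule inj_on_finite[OF inj sub fin])
  show "card {t :: expo. keys t \<subseteq> X \<and> tdeg t \<le> d} \<le> Suc d ^ card X"
    using card_inj_on_le[OF inj sub fin] assms by (simp add: card_PiE)
qed

lemma tail_borel_move_le:
  assumes "j \<in> keys t" "i < j" shows "tail (borel_move t j i) k \<le> tail t k"
  using arg_cong[OF borel_move_add[OF assms(1), of i], of "\<lambda>t. tail t k"] assms(2)
  by (auto simp: tail_add tail_single split: if_splits)

lemma tdeg_borel_move:
  assumes "j \<in> keys t" shows "tdeg (borel_move t j i) = tdeg t"
  using arg_cong[OF borel_move_add[OF assms(1), of i], of tdeg] by (simp add: tdeg_add tdeg_single)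

lemma borel_closed_below: "borel_closed (borel_below u)"
  unfolding borel_closed_def
proof (intro ballI allI impI)
  fix t j i assume a: "t \<in> borel_below u" "j \<in> keys t" "1 \<le> i \<and> i < j"
  have "0 \<notin> keys (borel_move t j i)"
    using a by (auto simp: in_keys_iff lookup_borel_move borel_below_def)
  moreover have "tail (borel_move t j i) k \<le> tail u k" for k
    using tail_borel_move_le[OF a(2), of i k] a by (auto simp: borel_below_def intro: le_trans)
  ultimately show "borel_move t j i \<in> borel_below u"
    using a tdeg_borel_move by (auto simp: borel_below_def)
qed

lemma self_below: "0 \<notin> keys u \<Longrightarrow> u \<in> borel_below u"
  by (simp add: borel_below_def)

lemma tail_pos_iff_top:
  assumes "u \<noteq> 0" shows "0 < tail u k \<longleftrightarrow> k \<le> top_var u"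
proof
  assume "0 < tail u k"
  then obtain i where "i \<ge> k" "lookup u i \<noteq> 0" using tail_eq_0[of u k] by auto
  then have "i \<in> keys u" by (simp add: in_keys_iff)
  then have "i \<le> top_var u" by (simp add: top_var_def)
  then show "k \<le> top_var u" using \<open>i \<ge> k\<close> by simp
next
  assume k: "k \<le> top_var u"
  have "top_var u \<in> keys u" unfolding top_var_def using assms by (intro Max_in) auto
  then show "0 < tail u k" using lookup_le_tail[OF k, of u] by (simp add: in_keys_iff)
qed

locale borel_generator =
  fixes u :: expo
  assumes u0: "0 \<notin> keys u" and u_pos: "tdeg u \<ge> 1"
begin

abbreviation "d \<equiv> tdeg u"
abbreviation "m \<equiv> top_var u"
abbreviation "A \<equiv> borel_below u"

lemma u_nonzero: "u \<noteq> 0"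
  using u_pos by (auto simp: tdeg_zero)

lemma tail_low: "k \<le> 1 \<Longrightarrow> tail u k = d"
  using tail_Suc[of u 0] u0 by (cases k) (auto simp: tail_0 in_keys_iff)

lemma tail_ge1: "k \<le> m \<Longrightarrow> 1 \<le> tail u k"
  using tail_pos_iff_top[OF u_nonzero, of k] by simp

lemma keys_below: assumes "t \<in> A" shows "keys t \<subseteq> {1..m}"
proof
  fix i assume i: "i \<in> keys t"
  then have "i \<noteq> 0" using assms by (auto simp: borel_below_def intro: ccontr)
  have "0 < lookup t i" using i by (simp add: in_keys_iff)
  also have "\<dots> \<le> tail t i" by (rule lookup_le_tail) simp
  also have "\<dots> \<le> tail u i" using assms by (simp add: borel_below_def)
  finally show "i \<in> {1..m}" using tail_pos_iff_top[OF u_nonzero] \<open>i \<noteq> 0\<close> by simp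
qed

lemma finite_below: "finite A"
  by (rule finite_subset[OF _ finite_expos[of "{1..m}" d]]) (use keys_below in \<open>auto simp: borel_below_def\<close>)

lemma lin_below: assumes "1 \<le> j" "j \<le> m" shows "lin d j \<in> A"
proof -
  have "tail (lin d j) k \<le> tail u k" for k
    using tail_low[of k] tail_ge1[of k] u_pos assms by (auto simp: lin_def tail_add tail_single)
  moreover have "0 \<notin> keys (lin d j)" using assms by (auto simp: in_keys_iff lookup_lin)
  ultimately show ?thesis using u_pos by (simp add: borel_below_def lin_def tdeg_add tdeg_single)
qed

sublocale borel_set "borel_below u" "tdeg u" "top_var u"
  using finite_below borel_closed_below keys_below u_pos lin_below
  by unfold_locales (auto simp: borel_below_def)

lemma extra_partner:
  assumes w: "inj_on w {0..<top_var v}" "w ` {0..<top_var v} \<subseteq> new_partners A v"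
    and x: "x \<in> new_partners A v" "\<And>l. l < top_var v \<Longrightarrow> w l \<noteq> x"
  shows "top_var v < card (new_partners A v)"
proof -
  have "finite (new_partners A v)" using finite_below unfolding new_partners_def by simp
  moreover have "insert x (w ` {0..<top_var v}) \<subseteq> new_partners A v" using w x by auto
  moreover have "card (insert x (w ` {0..<top_var v})) = Suc (top_var v)"
  proof (subst card_insert_disjoint)
    show "x \<notin> w ` {0..<top_var v}" using x(2) by (metis atLeastLessThan_iff imageE)
  qed (auto simp: card_image[OF w(1)])
  ultimately show ?thesis by (metis Suc_le_eq card_mono)
qed

text \<open>
  Let \<open>v = x\<^sub>1\<^sup>d\<^sup>-\<^sup>2 x\<^sub>2 x\<^sub>m\<close>. Those among its \<open>m\<close> standard new partners that avoid \<open>x\<^sub>m\<close> have largest index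
  \<open>2, 3, \<dots>, m - 1\<close>, respectively. The one with largest index 3 has exponent at least 2 there, because
  \<open>x\<^sub>1\<^sup>d\<^sup>-\<^sup>2 x\<^sub>3\<^sup>2\<close> lies in \<open>A\<close>. Prescribing instead the exponent 1 at index 3, with \<open>x\<^sub>2\<close> left free,
  gives a further one.
\<close>

lemma strict_four:
  assumes t3: "2 \<le> tail u 3" and m4: "4 \<le> m"
  shows "\<exists>v\<in>A. v \<notin> L \<and> top_var v < card (new_partners A v)"
proof -
  have t2: "2 \<le> tail u k" if "k \<le> 3" for k using tail_antimono[OF that, of u] t3 by simp
  have d2: "2 \<le> d" using t2[of 0] by (simp add: tail_0)
  define v where "v = single 1 (d - 2) + single 2 1 + single m 1"
  have lv: "lookup v i = (if i = 1 then d - 2 else 0) + (if i = 2 then 1 else 0) + (if i = m then 1 else 0)" for i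
    by (auto simp: v_def lookup_add lookup_single_if)
  have mem: "single 1 (d - 2) + single i 1 + single j 1 \<in> A" if "1 \<le> i" "i \<le> 3" "1 \<le> j" "j \<le> m" for i j
  proof -
    have "tail (single 1 (d - 2) + single i 1 + single j 1) k \<le> tail u k" for k
      using t2[of k] tail_low[of k] tail_ge1[of k] d2 that m4 by (auto simp: tail_add tail_single)
    then show ?thesis using d2 that
      by (auto simp: borel_below_def tdeg_add tdeg_single in_keys_iff lookup_add lookup_single_if split: if_splits)
  qed
  have vA: "v \<in> A" unfolding v_def using mem[of 2 m] m4 by simp
  have kv: "keys v = (if d = 2 then {2, m} else {1, 2, m})" using m4 d2 by (auto simp: in_keys_iff lv split: if_splits)
  have top: "top_var v = m" unfolding top_var_def[of v] kv using m4 by (auto simp: max_def)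
  have vL: "v \<notin> L"
  proof
    assume "v \<in> L"
    then obtain j where "v = lin d j" by (auto simp: L_def)
    then have "lookup (lin d j) 2 = 1" "lookup (lin d j) m = 1" using m4 lv[of 2] lv[of m] by simp_all
    then have "j = 2" "j = m" using m4 unfolding lookup_lin by presburger+
    then show False using m4 by simp
  qed
  obtain w where w: "inj_on w {0..<m}" "w ` {0..<m} \<subseteq> new_partners A v" "w 0 = v" and
    wl: "\<And>l. 1 \<le> l \<and> l < m \<Longrightarrow> (\<exists>q>l. q \<in> keys v \<and> (\<forall>i. l < i \<and> i < q \<longrightarrow> lookup v i = 0) \<and>
       w l \<in> slice A v q l \<and> (\<forall>c\<in>slice A v q l. lookup c l \<le> lookup (w l) l) \<and> lookup v l < lookup (w l) l)"
    using top_var_new_partners[OF finite_below closed vA nonzero[OF vA]] unfolding top by blast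
  \<comment> \<open>The pattern between 2 and \<open>m\<close> is a single \<open>x\<^sub>3\<close>.\<close>
  define C where "C = {w \<in> A. (\<forall>i>m. lookup w i = lookup v i) \<and> lookup w m + 1 = lookup v m
                       \<and> (\<forall>i. 2 < i \<and> i < m \<longrightarrow> lookup w i = (if i = 3 then 1 else 0))}"
  have "single 1 (d - 2) + single 2 1 + single 3 1 \<in> C"
    using mem[of 2 3] m4 unfolding C_def by (auto simp: lookup_add lookup_single_if lv)
  then have ne: "C \<noteq> {}" by blast
  have mk: "m \<in> keys v" using kv by auto
  have gap: "lookup v i = 0" if "2 < i" "i < m" for i using that by (simp add: lv)
  have "2 < m" using m4 by simp
  from pattern_new_partner[OF finite_below mk this gap C_def ne]
  obtain x where x: "x \<in> C" "x \<in> new_partners A v" by blast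
  have xm: "lookup x m = 0" "lookup x 3 = 1" "\<And>i. 3 < i \<Longrightarrow> i < m \<Longrightarrow> lookup x i = 0"
    using x(1) m4 unfolding C_def by (auto simp: lv)
  have "w l \<noteq> x" if lm: "l < m" for l
  proof (cases "l = 0")
    case True
    then have "lookup (w l) m = 1" using w(3) m4 by (simp add: lv)
    then show ?thesis using xm(1) by auto
  next
    case False
    with lm have "1 \<le> l \<and> l < m" by simp
    from wl[OF this] obtain q where q: "q > l" "q \<in> keys v" "\<forall>i. l < i \<and> i < q \<longrightarrow> lookup v i = 0"
       "w l \<in> slice A v q l" "\<forall>c\<in>slice A v q l. lookup c l \<le> lookup (w l) l" "lookup v l < lookup (w l) l"
      by blast
    show ?thesis
    proof (cases "l = 1")
      case True
      have "q = 2 \<or> q = m" using q(1,2) True kv by (auto split: if_splits)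
      moreover have "q \<noteq> m" using q(3)[rule_format, of 2] True m4 by (auto simp: lv)
      ultimately have "lookup (w l) m = 1" using q(4) m4 by (auto simp: slice_def lv)
      then show ?thesis using xm(1) by auto
    next
      case False
      then have qm: "q = m" using q(1,2) \<open>l \<noteq> 0\<close> kv by (auto split: if_splits)
      consider "l = 2" | "l = 3" | "3 < l" using False \<open>l \<noteq> 0\<close> by linarith
      then show ?thesis
      proof cases
        case 1
        then have "lookup (w l) 3 = 0" using q(4) qm m4 by (auto simp: slice_def)
        then show ?thesis using xm(2) by auto
      next
        case 2
        have "single 1 (d - 2) + single 3 1 + single 3 1 \<in> slice A v q l"
          using mem[of 3 3] 2 qm m4 by (auto simp: slice_def lookup_add lookup_single_if lv)
        then have "2 \<le> lookup (w l) 3" using q(5) 2 by (fastforce simp: lookup_add lookup_single_if)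
        then show ?thesis using xm(2) by auto
      next
        case 3
        have "lookup x l = 0" by (rule xm(3)[OF 3 lm])
        moreover have "lookup (w l) l \<noteq> 0" using q(6) by simp
        ultimately show ?thesis by auto
      qed
    qed
  qed
  then have "top_var v < card (new_partners A v)" using extra_partner[of w v x] w x top by simp
  with vA vL show ?thesis by blast
qed

text \<open>
  For \<open>v = x\<^sub>1\<^sup>d\<^sup>-\<^sup>2 x\<^sub>3\<^sup>2\<close> the exponents of \<open>x\<^sub>2\<close> that are possible next to exponent 1 of \<open>x\<^sub>3\<close> include
  0, 1 and 2, since \<open>x\<^sub>1\<^sup>d\<^sup>-\<^sup>3 x\<^sub>2\<^sup>2 x\<^sub>3\<close> lies in \<open>A\<close>. The standard new partners use the least and the greatest;
  exponent 1 gives a further one.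
\<close>

lemma strict_three:
  assumes t3: "2 \<le> tail u 3" and t2: "3 \<le> tail u 2" and m3: "m = 3"
  shows "\<exists>v\<in>A. v \<notin> L \<and> top_var v < card (new_partners A v)"
proof -
  have d3: "3 \<le> d" using tail_antimono[of 0 2 u] t2 by (simp add: tail_0)
  define v :: expo where "v = single 1 (d - 2) + single 3 2"
  have lv: "lookup v i = (if i = 1 then d - 2 else 0) + (if i = 3 then 2 else 0)" for i
    by (auto simp: v_def lookup_add lookup_single_if)
  have mem: "single 1 (d - a - b) + single 2 a + single 3 b \<in> A" if "b \<le> 2" "a + b \<le> 3" for a b
  proof -
    have "tail (single 1 (d - a - b) + single 2 a + single 3 b) k \<le> tail u k" for k
    proof -
      consider "k \<le> 1" | "k = 2" | "k = 3" | "3 < k" by linarith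
      then show ?thesis using t2 t3 tail_low[of k] d3 that by cases (auto simp: tail_add tail_single)
    qed
    then show ?thesis using d3 that
      by (auto simp: borel_below_def tdeg_add tdeg_single in_keys_iff lookup_add lookup_single_if split: if_splits)
  qed
  have vA: "v \<in> A" unfolding v_def using mem[of 2 0] by simp
  have kv: "keys v = {1, 3}" using d3 by (auto simp: in_keys_iff lv split: if_splits)
  have top: "top_var v = 3" unfolding top_var_def kv by simp
  have vL: "v \<notin> L"
  proof
    assume "v \<in> L"
    then obtain j where "v = lin d j" by (auto simp: L_def)
    then have "lookup v 3 = lookup (lin d j) 3" by auto
    then show False by (auto simp: lv lookup_lin split: if_splits)
  qed
  obtain w where w: "inj_on w {0..<3}" "w ` {0..<3} \<subseteq> new_partners A v" "w 0 = v" and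
    wl: "\<And>l. 1 \<le> l \<and> l < 3 \<Longrightarrow> (\<exists>q>l. q \<in> keys v \<and> (\<forall>i. l < i \<and> i < q \<longrightarrow> lookup v i = 0) \<and>
       w l \<in> slice A v q l \<and> (\<forall>c\<in>slice A v q l. lookup c l \<le> lookup (w l) l) \<and> lookup v l < lookup (w l) l)"
    using top_var_new_partners[OF finite_below closed vA nonzero[OF vA]] unfolding top by blast
  define C where "C = {w \<in> A. (\<forall>i>3. lookup w i = lookup v i) \<and> lookup w 3 + 1 = lookup v 3
                       \<and> (\<forall>i. 1 < i \<and> i < 3 \<longrightarrow> lookup w i = 1)}"
  have "single 1 (d - 1 - 1) + single 2 1 + single 3 1 \<in> C"
    using mem[of 1 1] unfolding C_def by (auto simp: lookup_add lookup_single_if lv)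
  then have ne: "C \<noteq> {}" by blast
  have k3: "3 \<in> keys v" using kv by auto
  have gap: "lookup v i = 0" if "1 < i" "i < 3" for i using that by (simp add: lv)
  have "1 < (3::nat)" by simp
  from pattern_new_partner[OF finite_below k3 this gap C_def ne]
  obtain x where x: "x \<in> C" "x \<in> new_partners A v" by blast
  have xm: "lookup x 3 = 1" "lookup x 2 = 1"
    using x(1) unfolding C_def by (auto simp: lv)
  have "w l \<noteq> x" if l3: "l < 3" for l
  proof (cases "l = 0")
    case True
    then have "lookup (w l) 3 = 2" using w(3) by (simp add: lv)
    then show ?thesis using xm(1) by auto
  next
    case False
    with l3 have "1 \<le> l \<and> l < 3" by simp
    from wl[OF this] obtain q where q: "q > l" "q \<in> keys v"
       "w l \<in> slice A v q l" "\<forall>c\<in>slice A v q l. lookup c l \<le> lookup (w l) l"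
      by blast
    have q3: "q = 3" using q(1,2) kv False by auto
    consider "l = 1" | "l = 2" using False l3 by linarith
    then show ?thesis
    proof cases
      case 1
      then have "lookup (w l) 2 = 0" using q(3) q3 by (auto simp: slice_def)
      then show ?thesis using xm(2) by auto
    next
      case 2
      have "single 1 (d - 2 - 1) + single 2 2 + single 3 1 \<in> slice A v q l"
        using mem[of 1 2] 2 q3 by (auto simp: slice_def lookup_add lookup_single_if lv)
      then have "2 \<le> lookup (w l) 2" using q(4) 2 by (fastforce simp: lookup_add lookup_single_if)
      then show ?thesis using xm(2) by auto
    qed
  qed
  then have "top_var v < card (new_partners A v)" using extra_partner[of w v x] w x top by simp
  with vA vL show ?thesis by blast
qed

text \<open>
  When \<open>m = 3\<close>, the excluded vector is the only one with tail sum at least 2 at index 3 and tail sum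
  less than 3 at index 2.
\<close>

theorem sumset_gt:
  assumes t3: "2 \<le> tail u 3" and u: "u \<noteq> single 1 (d - 2) + single 3 2"
  shows "m * card A < card (sumset A A) + (m choose 2)"
proof (cases "4 \<le> m")
  case True
  then show ?thesis using strict_four[OF t3] freiman_bound_strict by blast
next
  case False
  moreover have "3 \<le> m" using tail_pos_iff_top[OF u_nonzero, of 3] t3 by simp
  ultimately have m3: "m = 3" by simp
  have "3 \<le> tail u 2"
  proof (rule ccontr)
    assume "\<not> 3 \<le> tail u 2"
    moreover have "tail u 2 = lookup u 2 + tail u 3" using tail_Suc[of u 2] by simp
    moreover have "tail u 4 = 0" using tail_pos_iff_top[OF u_nonzero, of 4] m3 by simp
    then have "tail u 3 = lookup u 3" using tail_Suc[of u 3] by simp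
    moreover have "d = lookup u 1 + tail u 2" using tail_Suc[of u 1] tail_low[of 1] by (simp add: numeral_2_eq_2)
    ultimately have l: "lookup u 2 = 0" "lookup u 3 = 2" "lookup u 1 = d - 2" using t3 by auto
    have "lookup u i = lookup (single 1 (d - 2) + single 3 2) i" for i
    proof -
      consider "i = 0" | "i = 1" | "i = 2" | "i = 3" | "i > 3" by linarith
      then show ?thesis
        using l u0 above_top_var[of u i] m3 by cases (auto simp: lookup_add lookup_single_if in_keys_iff)
    qed
    then have "u = single 1 (d - 2) + single 3 2" by (rule poly_mapping_eqI)
    with u show False by simp
  qed
  from strict_three[OF t3 this m3] show ?thesis using freiman_bound_strict by blast
qed

end

section \<open>The Borel sets with equality\<close>

text \<open>
  Homogenisation by \<open>x\<^sub>1\<close>. It allows the counting to be done with \<open>x\<^sub>1 = 1\<close>, where the set \<open>A\<close> has a description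
  that does not depend on \<open>d\<close>.
\<close>

definition homog :: "nat \<Rightarrow> expo \<Rightarrow> expo" where
  "homog D t = single 1 (D - tdeg t) + t"

lemma homog_add:
  assumes "tdeg s \<le> D" "tdeg t \<le> E"
  shows "homog D s + homog E t = homog (D + E) (s + t)"
proof -
  have "single (1::nat) (D + E - (tdeg s + tdeg t)) = single 1 (D - tdeg s) + single 1 (E - tdeg t)"
    using assms by (simp flip: single_add)
  then show ?thesis by (simp add: homog_def tdeg_add ac_simps)
qed

lemma sumset_homog:
  assumes "\<And>t. t \<in> P \<Longrightarrow> tdeg t \<le> D"
  shows "sumset (homog D ` P) (homog D ` P) \<subseteq> homog (D + D) ` sumset P P"
  using assms homog_add unfolding sumset_def by blast

text \<open>
  The tail sum at index 3 counts the variables other than \<open>x\<^sub>1\<close> and \<open>x\<^sub>2\<close>, so there is at most one.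
\<close>

lemma nearly_two_variables:
  assumes "0 \<notin> keys t" "tail t 3 \<le> 1"
  obtains a b where "t = single 1 a + single 2 b"
    | a b j where "3 \<le> j" "t = single 1 a + single 2 b + single j 1"
proof (cases "tail t 3 = 0")
  case True
  have "lookup t i = lookup (single 1 (lookup t 1) + single 2 (lookup t 2)) i" for i
  proof -
    consider "i = 0" | "i = 1" | "i = 2" | "i \<ge> 3" by linarith
    then show ?thesis using True assms(1) by cases (auto simp: lookup_add lookup_single_if tail_eq_0 in_keys_iff)
  qed
  then have "t = single 1 (lookup t 1) + single 2 (lookup t 2)" by (rule poly_mapping_eqI)
  then show ?thesis by (rule that(1))
next
  case False
  then have t1: "tail t 3 = 1" using assms(2) by simp
  obtain j where j: "3 \<le> j" "lookup t j \<noteq> 0" using False by (auto simp: tail_eq_0)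
  define s where "s = t - single j 1"
  have "t = s + single j 1"
  proof (rule poly_mapping_eqI)
    show "lookup t i = lookup (s + single j 1) i" for i
      using j(2) by (cases "i = j") (auto simp: s_def lookup_add lookup_minus_nat lookup_single_if)
  qed
  then have ts: "tail s 3 = 0" using t1 j(1) by (simp add: tail_add tail_single)
  have "lookup t i = lookup (single 1 (lookup t 1) + single 2 (lookup t 2) + single j 1) i" for i
  proof -
    have "lookup t i = lookup s i + (if j = i then 1 else 0)"
      using arg_cong[OF \<open>t = s + single j 1\<close>, of "\<lambda>t. lookup t i"] by (simp add: lookup_add lookup_single_if)
    moreover have "i \<ge> 3 \<Longrightarrow> lookup s i = 0" using ts by (simp add: tail_eq_0)
    moreover consider "i = 0" | "i = 1" | "i = 2" | "i \<ge> 3" by linarith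
    then show ?thesis using calculation assms(1) j(1)
      by cases (simp_all add: lookup_add lookup_single_if in_keys_iff)
  qed
  then have "t = single 1 (lookup t 1) + single 2 (lookup t 2) + single j 1" by (rule poly_mapping_eqI)
  then show ?thesis by (rule that(2)[OF j(1)])
qed

lemma card_pairs: "card (SIGMA j:{3..m}. {3..j :: nat}) = ((m - 1) choose 2)"
proof -
  have "(\<Sum>j\<in>{3..m}. Suc j - 3) = ((m - 1) choose 2)"
  proof (induction m)
    case (Suc m)
    show ?case
    proof (cases "3 \<le> Suc m")
      case True
      then obtain k where k: "m = k + 2" by (metis add.commute add_2_eq_Suc Suc_le_D numeral_3_eq_3 Suc_le_mono add_Suc_right)
      have "(\<Sum>j\<in>{3..Suc m}. Suc j - 3) = (\<Sum>j\<in>{3..m}. Suc j - 3) + (Suc (Suc m) - 3)"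
        using True by (simp add: sum.nat_ivl_Suc')
      then show ?thesis using Suc k by (simp add: numeral_2_eq_2)
    next
      case False
      then have "m = 0 \<or> m = 1" by linarith
      then show ?thesis by auto
    qed
  qed simp
  then show ?thesis by simp
qed

context borel_generator
begin

text \<open>
  With \<open>x\<^sub>1 = 1\<close> and \<open>s\<close> the tail sum of \<open>u\<close> at index 2, the set \<open>A\<close> consists of 1 and the
  \<open>x\<^sub>2\<^sup>a x\<^sub>j\<close> with \<open>a < s\<close> and \<open>2 \<le> j \<le> m\<close>. Hence \<open>A + A\<close> consists of 1, the \<open>x\<^sub>2\<^sup>a x\<^sub>j\<close> with
  \<open>a < 2 s\<close>, and the \<open>x\<^sub>2\<^sup>a x\<^sub>i x\<^sub>j\<close> with \<open>a < 2 s - 1\<close> and \<open>3 \<le> i \<le> j \<le> m\<close>, and the count gives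
  exactly the Freiman number. The case \<open>s = 0\<close> is that of \<open>u = x\<^sub>1\<^sup>d\<close>, where \<open>A\<close> is a point.
\<close>

lemma sumset_le_of_tail_le_one:
  assumes t3: "tail u 3 \<le> 1"
  shows "card (sumset A A) + (m choose 2) \<le> m * card A"
proof (cases "tail u 2 = 0")
  case True
  then have m1: "m = 1" using tail_pos_iff_top[OF u_nonzero, of 2] top_var_range(1)[OF self_below[OF u0]] by simp
  have "A \<subseteq> {single 1 d}"
  proof
    fix t assume t: "t \<in> A"
    then have "tail t 2 \<le> 0" using True unfolding borel_below_def by (metis (mono_tags, lifting) mem_Collect_eq)
    then have "tail t 2 = 0" by simp
    moreover have "tail t 0 = lookup t 0 + (lookup t 1 + tail t 2)"
      using tail_Suc[of t 0] tail_Suc[of t 1] by (simp add: numeral_2_eq_2)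
    ultimately have "lookup t 1 = d" "lookup t 0 = 0" using t by (auto simp: borel_below_def tail_0 in_keys_iff)
    then have "lookup t i = lookup (single 1 d) i" for i
      using \<open>tail t 2 = 0\<close> by (cases "i = 0"; cases "i = 1") (auto simp: tail_eq_0 lookup_single_if)
    then show "t \<in> {single 1 d}" using poly_mapping_eqI by blast
  qed
  then have "A = {single 1 d}" using subset_singletonD[of A "single 1 d"] self_below[OF u0] by fastforce
  then show ?thesis using m1 by (simp add: sumset_def)
next
  case False
  define s where "s = tail u 2"
  define p where "p = m - 1"
  have s1: "1 \<le> s" using False s_def by simp
  have m2: "2 \<le> m" using False tail_pos_iff_top[OF u_nonzero, of 2] by simp
  have sd: "s \<le> d" using tail_antimono[of 0 2 u] by (simp add: s_def tail_0)
  define e where "e = (\<lambda>(a, j). single 2 a + single j 1 :: expo)"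
  define P where "P = insert 0 (e ` ({0..<s} \<times> {2..m}))"
  have tdeg_P: "tdeg t \<le> d" if "t \<in> P" for t
    using that sd by (auto simp: P_def e_def tdeg_add tdeg_single tdeg_zero)
  have lower: "homog d ` P \<subseteq> A"
  proof
    fix t assume "t \<in> homog d ` P"
    then consider "t = homog d 0" | a j where "a < s" "2 \<le> j" "j \<le> m" "t = homog d (e (a, j))"
      unfolding P_def by auto
    then show "t \<in> A"
    proof cases
      case 1
      have "tail (single 1 d) k \<le> tail u k" for k using tail_low[of k] by (simp add: tail_single)
      then show ?thesis unfolding 1 by (simp add: homog_def borel_below_def tdeg_zero tdeg_single in_keys_iff lookup_single_if)
    next
      case 2
      have "tail t k \<le> tail u k" for k
      proof -
        consider "k \<le> 1" | "k = 2" | "3 \<le> k" "k \<le> m" | "m < k" "2 < k" using m2 by linarith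
        then show ?thesis
          using 2 sd tail_low[of k] tail_ge1[of k]
          by cases (auto simp: homog_def e_def tail_add tail_single tdeg_add tdeg_single s_def)
      qed
      then show ?thesis using 2 sd
        by (auto simp: borel_below_def homog_def e_def tdeg_add tdeg_single in_keys_iff lookup_add lookup_single_if)
    qed
  qed
  have upper: "A \<subseteq> homog d ` P"
  proof
    fix t assume t: "t \<in> A"
    then have t0: "0 \<notin> keys t" and tt: "tail t 2 \<le> s" "tail t 3 \<le> 1"
      using t3 by (auto simp: borel_below_def s_def intro: le_trans)
    from t0 tt(2) show "t \<in> homog d ` P"
    proof (cases rule: nearly_two_variables)
      case (1 a b)
      have t: "tail t 2 = b" "d = a + b"
        using t unfolding 1 by (auto simp: borel_below_def tail_add tail_single tdeg_add tdeg_single)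
      show ?thesis
      proof (cases b)
        case 0
        then have "t = homog d 0" using t unfolding 1 by (simp add: homog_def tdeg_zero)
        then show ?thesis by (simp add: P_def)
      next
        case (Suc c)
        have "single 2 c + single 2 1 = (single 2 (Suc c) :: expo)" by (simp flip: single_add)
        then have "t = homog d (e (c, 2))"
          unfolding 1 using t(2) Suc by (simp add: homog_def e_def tdeg_single)
        moreover have "c < s" using Suc t tt by simp
        ultimately show ?thesis using m2 by (force simp: P_def)
      qed
    next
      case (2 a b j)
      have t2: "tail t 2 = b + 1" "d = a + b + 1"
        using t 2(1) unfolding 2(2) by (auto simp: borel_below_def tail_add tail_single tdeg_add tdeg_single)
      have "lookup t j \<noteq> 0" unfolding 2(2) by (simp add: lookup_add lookup_single_if)
      then have "j \<in> {1..m}" using keys_below[OF t] by (simp add: in_keys_iff subset_iff)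
      moreover have "t = homog d (e (b, j))"
        unfolding 2(2) using t2(2) by (simp add: homog_def e_def tdeg_add tdeg_single add.assoc)
      moreover have "b < s" using t2 tt by simp
      ultimately show ?thesis using 2(1) unfolding P_def by (intro image_eqI[of _ _ "e (b, j)"]) auto
    qed
  qed
  have inj_e: "inj_on e ({0..<s} \<times> {2..m})"
  proof (rule inj_onI, clarify)
    fix a j b k assume h: "e (a, j) = e (b, k)"
    have l: "(if 2 = i then a else 0) + (if j = i then 1 else 0) = (if 2 = i then b else 0) + (if k = i then 1 else 0)" for i
      using arg_cong[OF h, of "\<lambda>t. lookup t i"] by (simp only: e_def lookup_add lookup_single_if prod.case)
    from l[of 2] l[of j] l[of k] show "a = b \<and> j = k" by (auto split: if_splits)
  qed
  have e_nonzero: "e x \<noteq> 0" for x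
  proof
    assume "e x = 0"
    then have "lookup (e x) (snd x) = 0" by simp
    then show False by (cases x) (simp add: e_def lookup_add lookup_single_if)
  qed
  have card_P: "card P = 1 + s * p"
  proof -
    have "0 \<notin> e ` ({0..<s} \<times> {2..m})"
    proof
      assume "0 \<in> e ` ({0..<s} \<times> {2..m})"
      then obtain x where "e x = 0" by force
      with e_nonzero show False by blast
    qed
    then show ?thesis unfolding P_def by (simp add: card_image[OF inj_e] p_def)
  qed
  have inj_h: "inj_on (homog d) P"
  proof (rule inj_onI, rule poly_mapping_eqI)
    fix x y i assume h: "x \<in> P" "y \<in> P" "homog d x = homog d y"
    have l1: "lookup x 1 = 0" if "x \<in> P" for x
      using that by (auto simp: P_def e_def lookup_add lookup_single_if)
    show "lookup x i = lookup y i"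
      using arg_cong[OF h(3), of "\<lambda>t. lookup t i"] l1[OF h(1)] l1[OF h(2)]
      by (cases "i = 1") (auto simp: homog_def lookup_add lookup_single_if)
  qed
  have AP: "A = homog d ` P" using lower upper by blast
  have card_A: "card A = 1 + s * p" unfolding AP card_image[OF inj_h] by (rule card_P)
  define e2 where "e2 = (\<lambda>(a, (j, i)). single 2 a + single i 1 + single j 1 :: expo)"
  define Q where "Q = insert 0 (e ` ({0..<2*s} \<times> {2..m}) \<union> e2 ` ({0..<2*s-1} \<times> (SIGMA j:{3..m}. {3..j})))"
  \<comment> \<open>For \<open>i = 2\<close> the two factors \<open>x\<^sub>2\<close> merge into the power of \<open>x\<^sub>2\<close>.\<close>
  have e_sum: "e (a, i) + e (b, j) \<in> Q" if ab: "a < s" "b < s" and ij: "2 \<le> i" "i \<le> j" "j \<le> m" for a b i j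
  proof (cases "i = 2")
    case True
    have "single 2 (a + b + 1) = (single 2 a + single 2 b + single 2 1 :: expo)" by (simp flip: single_add)
    then have "e (a, i) + e (b, j) = e (a + b + 1, j)" using True by (simp add: e_def ac_simps)
    moreover have "a + b + 1 < 2 * s" using ab by simp
    ultimately show ?thesis unfolding Q_def using ij by (auto intro!: imageI)
  next
    case False
    have "e (a, i) + e (b, j) = e2 (a + b, (j, i))" by (simp add: e_def e2_def single_add ac_simps)
    moreover have "a + b < 2 * s - 1" using ab by linarith
    ultimately show ?thesis unfolding Q_def using ij False by (auto intro!: imageI)
  qed
  have "x + y \<in> Q" if xy: "x \<in> P" "y \<in> P" for x y
  proof -
    have PQ: "x \<in> Q" if "x \<in> P" for x using that unfolding P_def Q_def by auto
    have Pc: "z = 0 \<or> (\<exists>a i. z = e (a, i) \<and> a < s \<and> 2 \<le> i \<and> i \<le> m)" if "z \<in> P" for z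
      using that unfolding P_def by auto
    consider "x = 0" | "y = 0" | a i b j where "x = e (a, i)" "y = e (b, j)" "a < s" "b < s" "2 \<le> i" "i \<le> m" "2 \<le> j" "j \<le> m"
      using Pc[OF xy(1)] Pc[OF xy(2)] by blast
    then show ?thesis
    proof cases
      case 3
      then show ?thesis using e_sum[of a b i j] e_sum[of b a j i] by (cases "i \<le> j") (auto simp: add.commute)
    qed (use xy PQ in auto)
  qed
  then have PQ: "sumset P P \<subseteq> Q" by (auto simp: sumset_def)
  have finQ: "finite Q" by (simp add: Q_def)
  have "card Q \<le> Suc (card (e ` ({0..<2*s} \<times> {2..m}) \<union> e2 ` ({0..<2*s-1} \<times> (SIGMA j:{3..m}. {3..j}))))"
    unfolding Q_def by (rule card_insert_le_m1) auto
  also have "\<dots> \<le> Suc (card (e ` ({0..<2*s} \<times> {2..m})) + card (e2 ` ({0..<2*s-1} \<times> (SIGMA j:{3..m}. {3..j}))))"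
    using card_Un_le by simp
  also have "\<dots> \<le> Suc (card ({0..<2*s} \<times> {2..m}) + card ({0..<2*s-1} \<times> (SIGMA j:{3..m}. {3..j})))"
    by (intro Suc_le_mono[THEN iffD2] add_mono card_image_le) auto
  also have "\<dots> = 1 + 2 * s * p + (2 * s - 1) * (p choose 2)"
    using card_pairs[of m] by (simp add: p_def card_cartesian_product del: card_SigmaI)
  finally have cQ: "card Q \<le> 1 + 2 * s * p + (2 * s - 1) * (p choose 2)" .
  have "sumset A A \<subseteq> homog (d + d) ` Q"
    unfolding AP using sumset_homog[of P d] tdeg_P PQ by blast
  then have "card (sumset A A) \<le> card (homog (d + d) ` Q)" using finQ by (intro card_mono) auto
  also have "\<dots> \<le> card Q" using finQ by (rule card_image_le)
  finally have "card (sumset A A) \<le> card Q" .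
  with cQ have 1: "card (sumset A A) \<le> 1 + 2 * s * p + (2 * s - 1) * (p choose 2)" by simp
  have mp: "m = Suc p" using m2 by (simp add: p_def)
  have c2: "2 * (p choose 2) = p * (p - 1)"
  proof -
    have "even (p * (p - 1))" by (cases p) auto
    then show ?thesis unfolding choose_two by (rule dvd_mult_div_cancel)
  qed
  have "1 + 2 * s * p + (2 * s - 1) * (p choose 2) + (Suc p choose 2) = Suc p * (1 + s * p)"
  proof -
    have "(Suc p choose 2) = p + (p choose 2)" by (simp add: numeral_2_eq_2)
    moreover have "(2 * s - 1) * (p choose 2) + (p choose 2) = s * (2 * (p choose 2))"
    proof -
      have "(2 * s - 1) * (p choose 2) + (p choose 2) = ((2 * s - 1) + 1) * (p choose 2)" by (simp add: distrib_right)
      also have "(2 * s - 1) + 1 = 2 * s" using s1 by simp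
      finally show ?thesis by simp
    qed
    ultimately have "1 + 2 * s * p + (2 * s - 1) * (p choose 2) + (Suc p choose 2)
      = 1 + 2 * s * p + p + s * (p * (p - 1))" using c2 by simp
    also have "\<dots> = Suc p * (1 + s * p)" by (cases p) (auto simp: algebra_simps)
    finally show ?thesis .
  qed
  then show ?thesis using add_right_mono[OF 1, of "Suc p choose 2"] unfolding mp card_A by (simp only:)
qed

text \<open>
  With \<open>x\<^sub>1 = 1\<close>, the set \<open>A\<close> consists of the 6 monomials of degree at most 2 in \<open>x\<^sub>2, x\<^sub>3\<close>, and \<open>A + A\<close> is contained
  in the 15 monomials of degree at most 4; and \<open>15 = 3 * 6 - 3\<close>.
\<close>

lemma sumset_le_of_three_squared:
  assumes u: "u = single 1 (d - 2) + single 3 2"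
  shows "card (sumset A A) + (m choose 2) \<le> m * card A"
proof -
  have d2: "2 \<le> d" using arg_cong[OF u, of tdeg] by (simp add: tdeg_add tdeg_single)
  define f where "f = (\<lambda>D (a, b). single 1 (D - a - b) + single 2 a + single 3 b :: expo)"
  have lf: "lookup (f D (a, b)) i = (if i = 1 then D - a - b else if i = 2 then a else if i = 3 then b else 0)" for D a b i
    by (auto simp: f_def lookup_add lookup_single_if)
  have "top_var u = 3"
  proof -
    have lu: "lookup u i = (if i = 1 then d - 2 else if i = 3 then 2 else 0)" for i
      by (subst u) (simp add: lookup_add lookup_single_if)
    have "keys u = (if d = 2 then {3} else {1, 3})" using d2 by (auto simp: in_keys_iff lu split: if_splits)
    then show ?thesis by (auto simp: top_var_def)
  qed
  have tail_u: "tail u k = (if k \<le> 1 then d else if k \<le> 3 then 2 else 0)" for k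
    using arg_cong[OF u, of "\<lambda>t. tail t k"] d2 by (auto simp: tail_add tail_single)
  let ?T = "SIGMA a:{..2::nat}. {..2 - a}"
  have "f d ` ?T \<subseteq> A"
  proof clarify
    fix a b :: nat assume ab: "a \<le> 2" "b \<le> 2 - a"
    have "tail (f d (a, b)) k \<le> tail u k" for k
      using ab d2 by (auto simp: tail_u f_def tail_add tail_single)
    moreover have "0 \<notin> keys (f d (a, b))" by (simp add: in_keys_iff lf)
    moreover have "tdeg (f d (a, b)) = d" using ab d2 by (simp add: f_def tdeg_add tdeg_single)
    ultimately show "f d (a, b) \<in> A" by (simp add: borel_below_def)
  qed
  moreover have "inj_on (f d) ?T"
  proof (rule inj_onI, clarify)
    fix a b a' b' assume h: "f d (a, b) = f d (a', b')"
    show "a = a' \<and> b = b'"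
      using arg_cong[OF h, of "\<lambda>t. lookup t 2"] arg_cong[OF h, of "\<lambda>t. lookup t 3"] by (simp add: lf)
  qed
  moreover have "card ?T = 6" by (simp add: numeral_2_eq_2)
  ultimately have 6: "6 \<le> card A" using card_mono[OF finite_below, of "f d ` ?T"] by (simp add: card_image)
  have dec: "\<exists>a b. a + b \<le> 2 \<and> t = f d (a, b)" if t: "t \<in> A" for t
  proof -
    have tl: "tail t k \<le> tail u k" for k using t by (simp add: borel_below_def)
    have t4: "tail t 4 = 0" using tl[of 4] by (simp add: tail_u)
    have t0: "lookup t 0 = 0" "tail t 0 = d" using t by (auto simp: borel_below_def in_keys_iff tail_0)
    have "tail t 2 \<le> 2" using tl[of 2] by (simp add: tail_u)
    moreover have "tail t 2 = lookup t 2 + lookup t 3" using tail_Suc[of t 2] tail_Suc[of t 3] t4 by simp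
    moreover have "lookup t 1 + tail t 2 = d" using tail_Suc[of t 0] tail_Suc[of t 1] t0 by (simp add: numeral_2_eq_2)
    note calc = calculation this
    have "lookup t i = lookup (f d (lookup t 2, lookup t 3)) i" for i
    proof -
      consider "i = 0" | "i = 1" | "i = 2" | "i = 3" | "i \<ge> 4" by linarith
      then show ?thesis using t0 t4 calc by cases (auto simp: lf tail_eq_0)
    qed
    then have "t = f d (lookup t 2, lookup t 3)" by (rule poly_mapping_eqI)
    moreover have "lookup t 2 + lookup t 3 \<le> 2" using calc by simp
    ultimately show ?thesis by blast
  qed
  let ?U = "SIGMA a:{..4::nat}. {..4 - a}"
  have "sumset A A \<subseteq> f (d + d) ` ?U"
  proof
    fix z assume "z \<in> sumset A A"
    then obtain x y where "x \<in> A" "y \<in> A" "z = x + y" unfolding sumset_def by blast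
    then obtain a b a' b' where h: "a + b \<le> 2" "a' + b' \<le> 2" "z = f d (a, b) + f d (a', b')" using dec by metis
    have "z = f (d + d) (a + a', b + b')"
      unfolding h(3) by (rule poly_mapping_eqI) (use h d2 in \<open>auto simp: lookup_add lf\<close>)
    then show "z \<in> f (d + d) ` ?U" using h by (intro image_eqI[of _ _ "(a + a', b + b')"]) auto
  qed
  then have "card (sumset A A) \<le> card ?U"
    using card_image_le[of ?U "f (d + d)"] card_mono[of "f (d + d) ` ?U" "sumset A A"] by fastforce
  also have "card ?U = 15" by (simp add: atMost_atLeast0 eval_nat_numeral)
  finally show ?thesis using 6 \<open>top_var u = 3\<close> by (simp add: eval_nat_numeral)
qed

theorem freiman_iff:
  "card (sumset A A) + (m choose 2) = m * card A \<longleftrightarrow> tail u 3 \<le> 1 \<or> u = single 1 (d - 2) + single 3 2"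
proof (cases "tail u 3 \<le> 1 \<or> u = single 1 (d - 2) + single 3 2")
  case True
  then have "card (sumset A A) + (m choose 2) \<le> m * card A"
    using sumset_le_of_tail_le_one sumset_le_of_three_squared by blast
  with True freiman_bound show ?thesis by simp
next
  case False
  then have "2 \<le> tail u 3" "u \<noteq> single 1 (d - 2) + single 3 2" by auto
  from sumset_gt[OF this] False show ?thesis by simp
qed

end

section \<open>Subrings of a commutative ring type\<close>

text \<open>
  Both the polynomial ring and the Rees algebra carry the operations of an ambient ring type. Their ideals
  and prime ideals can then be described in terms of the type class operations.
\<close>

definition ring_on :: "'b::comm_ring_1 set \<Rightarrow> 'b ring" where
  "ring_on C = \<lparr>carrier = C, monoid.mult = (*), one = 1, zero = 0, add = (+)\<rparr>"

lemma ring_on_simps [simp]: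
  "carrier (ring_on C) = C" "x \<otimes>\<^bsub>ring_on C\<^esub> y = x * y" "\<one>\<^bsub>ring_on C\<^esub> = 1"
  "\<zero>\<^bsub>ring_on C\<^esub> = 0" "x \<oplus>\<^bsub>ring_on C\<^esub> y = x + y"
  by (simp_all add: ring_on_def)

definition subring_set :: "'b::comm_ring_1 set \<Rightarrow> bool" where
  "subring_set C \<longleftrightarrow> 0 \<in> C \<and> 1 \<in> C \<and> (\<forall>a\<in>C. - a \<in> C) \<and> (\<forall>a\<in>C. \<forall>b\<in>C. a + b \<in> C \<and> a * b \<in> C)"

lemma cring_ring_on: assumes "subring_set C" shows "cring (ring_on C)"
proof (rule cringI)
  show "abelian_group (ring_on C)"
  proof (rule abelian_groupI)
    fix x assume "x \<in> carrier (ring_on C)"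
    then show "\<exists>y\<in>carrier (ring_on C). y \<oplus>\<^bsub>ring_on C\<^esub> x = \<zero>\<^bsub>ring_on C\<^esub>"
      using assms by (intro bexI[of _ "- x"]) (auto simp: subring_set_def)
  qed (use assms in \<open>auto simp: subring_set_def algebra_simps\<close>)
  show "comm_monoid (ring_on C)"
    by (rule comm_monoidI) (use assms in \<open>auto simp: subring_set_def algebra_simps\<close>)
qed (simp add: algebra_simps)

lemma ideal_ring_on_iff:
  assumes "subring_set C"
  shows "ideal I (ring_on C) \<longleftrightarrow>
    I \<subseteq> C \<and> 0 \<in> I \<and> (\<forall>a\<in>I. \<forall>b\<in>I. a + b \<in> I) \<and> (\<forall>r\<in>C. \<forall>a\<in>I. r * a \<in> I)"
proof
  assume I: "ideal I (ring_on C)"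
  then have s: "additive_subgroup I (ring_on C)" by (rule ideal.axioms(1))
  show "I \<subseteq> C \<and> 0 \<in> I \<and> (\<forall>a\<in>I. \<forall>b\<in>I. a + b \<in> I) \<and> (\<forall>r\<in>C. \<forall>a\<in>I. r * a \<in> I)"
    using additive_subgroup.a_subset[OF s] additive_subgroup.zero_closed[OF s]
      additive_subgroup.a_closed[OF s] ideal.I_l_closed[OF I] by simp
next
  assume I: "I \<subseteq> C \<and> 0 \<in> I \<and> (\<forall>a\<in>I. \<forall>b\<in>I. a + b \<in> I) \<and> (\<forall>r\<in>C. \<forall>a\<in>I. r * a \<in> I)"
  interpret cring "ring_on C" by (rule cring_ring_on[OF assms])
  have neg: "- a \<in> I" if "a \<in> I" for a
  proof -
    have "- 1 \<in> C" using assms by (simp add: subring_set_def)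
    then have "(- 1) * a \<in> I" using I that by blast
    then show ?thesis by simp
  qed
  have inv: "inv\<^bsub>add_monoid (ring_on C)\<^esub> a = - a" if "a \<in> I" for a
    using minus_equality[of "- a" a] I that neg unfolding a_inv_def by auto
  show "ideal I (ring_on C)"
  proof (rule idealI)
    show "ring (ring_on C)" by (rule ring_axioms)
    show "subgroup I (add_monoid (ring_on C))"
      by (rule subgroup.intro) (use I neg inv in auto)
    fix a x assume ax: "a \<in> I" "x \<in> carrier (ring_on C)"
    then have "x * a \<in> I" using I by simp
    then show "x \<otimes>\<^bsub>ring_on C\<^esub> a \<in> I" "a \<otimes>\<^bsub>ring_on C\<^esub> x \<in> I"
      by (simp_all add: mult.commute)
  qed
qed

lemma primeideal_ring_on_iff:
  assumes "subring_set C"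
  shows "primeideal P (ring_on C) \<longleftrightarrow>
    ideal P (ring_on C) \<and> P \<noteq> C \<and> (\<forall>a\<in>C. \<forall>b\<in>C. a * b \<in> P \<longrightarrow> a \<in> P \<or> b \<in> P)"
  using cring_ring_on[OF assms] primeideal.I_notcarr[of P "ring_on C"] primeideal.I_prime[of P "ring_on C"]
    primeideal.axioms(1)[of P "ring_on C"] primeidealI[of P "ring_on C"] by auto

section \<open>Monomial ideals\<close>

definition polys :: "nat \<Rightarrow> 'a::field mpoly set" where
  "polys n = {p. \<forall>t\<in>keys p. keys t \<subseteq> {1..n}}"

lemma S_eq: "S n = ring_on (polys n)"
  by (simp add: S_def ring_on_def polys_def)

lemma mon_add: "mon (s + t) = mon s * (mon t :: 'a::field mpoly)"
  by (simp add: mon_def mult_single)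

lemma keys_mon [simp]: "keys (mon t :: 'a::field mpoly) = {t}"
  by (simp add: mon_def)

lemma mon_inj: "mon s = (mon t :: 'a::field mpoly) \<longleftrightarrow> s = t"
  by (metis keys_mon singleton_inject)

lemma mon_0: "mon 0 = (1 :: 'a::field mpoly)"
  by (simp add: mon_def)

lemma polys_D: "p \<in> polys n \<Longrightarrow> t \<in> keys p \<Longrightarrow> keys t \<subseteq> {1..n}"
  by (simp add: polys_def)

lemma keys_multE:
  fixes p q :: "'a::field mpoly"
  assumes "t \<in> keys (p * q)" obtains a b where "a \<in> keys p" "b \<in> keys q" "t = a + b"
  using assms keys_mult[of p q] by auto

lemma keys_addE:
  fixes p q :: "'a::field mpoly"
  assumes "t \<in> keys (p + q)" shows "t \<in> keys p \<or> t \<in> keys q"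
  using assms keys_add[of p q] by auto

lemma subring_polys: "subring_set (polys n :: 'a::field mpoly set)"
  unfolding subring_set_def
proof (intro conjI ballI)
  fix a b :: "'a mpoly" assume ab: "a \<in> polys n" "b \<in> polys n"
  show "a + b \<in> polys n" unfolding polys_def using ab polys_D keys_addE by blast
  show "a * b \<in> polys n" unfolding polys_def
  proof (intro CollectI ballI)
    fix t assume "t \<in> keys (a * b)"
    then obtain r s where "r \<in> keys a" "s \<in> keys b" "t = r + s" by (rule keys_multE)
    then show "keys t \<subseteq> {1..n}" using polys_D[OF ab(1)] polys_D[OF ab(2)] by (simp add: keys_add_expo)
  qed
qed (auto simp: polys_def in_keys_iff lookup_one)

lemmas cring_S = cring_ring_on[OF subring_polys, folded S_eq]
lemmas ideal_S_iff = ideal_ring_on_iff[OF subring_polys, folded S_eq]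
lemma ring_S: "ring (S n)" by (rule cring.axioms(1)[OF cring_S])

lemma carrier_S [simp]: "carrier (S n) = polys n" by (simp add: S_eq)
lemma mult_S [simp]: "x \<otimes>\<^bsub>S n\<^esub> y = x * y" by (simp add: S_eq)
lemma add_S [simp]: "x \<oplus>\<^bsub>S n\<^esub> y = x + y" by (simp add: S_eq)

definition expos :: "nat \<Rightarrow> expo set" where "expos n = {t. keys t \<subseteq> {1..n}}"

lemma mon_polys: "mon t \<in> polys n \<longleftrightarrow> t \<in> expos n"
  by (simp add: polys_def expos_def)

lemma expos_add: "s + t \<in> expos n \<longleftrightarrow> s \<in> expos n \<and> t \<in> expos n"
  by (simp add: expos_def keys_add_expo)

text \<open>
  The polynomials all of whose terms are divisible by a monomial in \<open>T\<close>. This is the ideal that \<open>T\<close>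
  generates, and unlike the generated ideal it can be tested term by term.
\<close>

definition mideal :: "nat \<Rightarrow> expo set \<Rightarrow> 'a::field mpoly set" where
  "mideal n T = {p \<in> polys n. \<forall>t\<in>keys p. \<exists>a\<in>T. \<exists>s. t = a + s}"

lemma mon_mideal: "t \<in> expos n \<Longrightarrow> mon t \<in> mideal n T \<longleftrightarrow> (\<exists>a\<in>T. \<exists>s. t = a + s)"
  by (simp add: mideal_def mon_polys)

lemma self_divides: "t \<in> T \<Longrightarrow> \<exists>a\<in>T. \<exists>s. t = a + (s :: expo)"
  by (rule bexI[of _ t], rule exI[of _ 0]) auto

lemma mon_in_mideal: "t \<in> T \<Longrightarrow> t \<in> expos n \<Longrightarrow> mon t \<in> mideal n T"
  using self_divides by (simp add: mon_mideal)

lemma ideal_mideal: "ideal (mideal n T) (S n)"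
  unfolding ideal_S_iff
proof (intro conjI ballI)
  show "mideal n T \<subseteq> polys n" by (auto simp: mideal_def)
  show "0 \<in> mideal n T" by (simp add: mideal_def polys_def)
next
  fix a b :: "'a mpoly" assume "a \<in> mideal n T" "b \<in> mideal n T"
  then show "a + b \<in> mideal n T"
    using subring_polys[of n] keys_addE[of _ a b] unfolding mideal_def subring_set_def by blast
next
  fix r a :: "'a mpoly" assume ra: "r \<in> polys n" "a \<in> mideal n T"
  have "\<exists>c\<in>T. \<exists>s. t = c + s" if "t \<in> keys (r * a)" for t
  proof -
    from that obtain x y where xy: "x \<in> keys r" "y \<in> keys a" "t = x + y" by (rule keys_multE)
    then obtain c s where "c \<in> T" "y = c + s" using ra unfolding mideal_def by blast
    then have "t = c + (x + s)" using xy by (simp add: ac_simps)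
    then show ?thesis using \<open>c \<in> T\<close> by blast
  qed
  moreover have "r * a \<in> polys n"
    using ra subring_polys[of n] unfolding mideal_def subring_set_def by blast
  ultimately show "r * a \<in> mideal n T" by (simp add: mideal_def)
qed

lemma mideal_add: "a \<in> mideal n T \<Longrightarrow> b \<in> mideal n T \<Longrightarrow> a + b \<in> mideal n T"
  using ideal_mideal unfolding ideal_S_iff by blast

lemma mpoly_sum_single: "p = (\<Sum>t\<in>keys p. single t (lookup p t))"
proof (rule poly_mapping_eqI)
  fix s
  have "(\<Sum>t\<in>keys p. lookup (single t (lookup p t)) s) = (\<Sum>t\<in>keys p. if t = s then lookup p s else 0)"
    by (intro sum.cong) (auto simp: lookup_single_if)
  also have "\<dots> = lookup p s" by (simp add: in_keys_iff)
  finally show "lookup p s = lookup (\<Sum>t\<in>keys p. single t (lookup p t)) s" by (simp add: lookup_sum)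
qed

lemma ideal_sum_closed:
  assumes "ideal I (S n)" "finite X" "\<And>x. x \<in> X \<Longrightarrow> f x \<in> I" shows "sum f X \<in> I"
  using assms(2,3)
proof (induction X)
  case empty
  then show ?case using assms(1) by (simp add: ideal_S_iff)
next
  case (insert x F)
  then show ?case using assms(1) by (simp add: ideal_S_iff)
qed

lemma mideal_subset_ideal:
  assumes I: "ideal I (S n)" and T: "mon ` T \<subseteq> I"
  shows "mideal n T \<subseteq> (I :: 'a::field mpoly set)"
proof
  fix p :: "'a mpoly" assume p: "p \<in> mideal n T"
  have "single t (lookup p t) \<in> I" if "t \<in> keys p" for t
  proof -
    have pn: "p \<in> polys n" and div: "\<forall>t\<in>keys p. \<exists>a\<in>T. \<exists>s. t = a + s" using p by (simp_all add: mideal_def)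
    from div[rule_format, OF that] obtain a s where as: "a \<in> T" "t = a + s" by blast
    from polys_D[OF pn that] have "keys s \<subseteq> {1..n}" unfolding as(2) by (simp add: keys_add_expo)
    then have s: "single s c \<in> polys n" for c :: 'a by (simp add: polys_def)
    have "mon a \<in> I" using T as(1) by blast
    then have "single s c * mon a \<in> I" for c using I s[of c] by (simp add: ideal_S_iff)
    moreover have "single s c * mon a = (single t c :: 'a mpoly)" for c
      unfolding as(2) by (simp add: mon_def mult_single add.commute)
    ultimately have "single t c \<in> I" for c by metis
    then show ?thesis .
  qed
  then have "(\<Sum>t\<in>keys p. single t (lookup p t)) \<in> I" by (intro ideal_sum_closed[OF I] finite_keys)
  then show "p \<in> I" unfolding mpoly_sum_single[of p, symmetric] .
qed

lemma Idl_mon: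
  assumes "T \<subseteq> expos n" shows "Idl\<^bsub>S n\<^esub> (mon ` T) = (mideal n T :: 'a::field mpoly set)"
proof
  have sub: "mon ` T \<subseteq> (mideal n T :: 'a mpoly set)"
  proof
    fix x :: "'a mpoly" assume "x \<in> mon ` T"
    then obtain t where t: "t \<in> T" "x = mon t" by blast
    then show "x \<in> mideal n T" using mon_in_mideal[of t T n] assms by blast
  qed
  show "Idl\<^bsub>S n\<^esub> (mon ` T) \<subseteq> (mideal n T :: 'a mpoly set)"
    using ring.genideal_minimal[OF ring_S ideal_mideal sub] .
  have "mon ` T \<subseteq> carrier (S n :: 'a mpoly ring)" using assms by (auto simp: mon_polys)
  then show "(mideal n T :: 'a mpoly set) \<subseteq> Idl\<^bsub>S n\<^esub> (mon ` T)"
    by (intro mideal_subset_ideal ring.genideal_ideal[OF ring_S] ring.genideal_self[OF ring_S])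
qed

lemma sumset_expos: "X \<subseteq> expos n \<Longrightarrow> Y \<subseteq> expos n \<Longrightarrow> sumset X Y \<subseteq> expos n"
  unfolding sumset_def by (auto simp: expos_add)

lemma mideal_prod:
  assumes "X \<subseteq> expos n" "Y \<subseteq> expos n"
  shows "ideal_prod (S n) (mideal n X) (mideal n Y) = (mideal n (sumset X Y) :: 'a::field mpoly set)"
proof
  show "ideal_prod (S n) (mideal n X) (mideal n Y) \<subseteq> (mideal n (sumset X Y) :: 'a mpoly set)"
  proof
    fix p :: "'a mpoly" assume "p \<in> ideal_prod (S n) (mideal n X) (mideal n Y)"
    then show "p \<in> mideal n (sumset X Y)"
    proof (induction rule: ideal_prod.induct)
      case (prod i j)
      have "\<exists>c\<in>sumset X Y. \<exists>s. t = c + s" if "t \<in> keys (i * j)" for t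
      proof -
        from that obtain x y where xy: "x \<in> keys i" "y \<in> keys j" "t = x + y" by (rule keys_multE)
        obtain a s where a: "a \<in> X" "x = a + s" using prod(1) xy(1) unfolding mideal_def by blast
        obtain b r where b: "b \<in> Y" "y = b + r" using prod(2) xy(2) unfolding mideal_def by blast
        have "t = (a + b) + (s + r)" using xy a b by (simp add: ac_simps)
        moreover have "a + b \<in> sumset X Y" using a b unfolding sumset_def by blast
        ultimately show ?thesis by blast
      qed
      moreover have "i * j \<in> polys n"
        using prod subring_polys[of n] unfolding mideal_def subring_set_def by blast
      ultimately show ?case by (simp add: mideal_def)
    next
      case (sum s1 s2)
      then show ?case by (simp add: mideal_add)
    qed
  qed
  have "mon ` sumset X Y \<subseteq> (ideal_prod (S n) (mideal n X) (mideal n Y) :: 'a mpoly set)"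
  proof
    fix p :: "'a mpoly" assume "p \<in> mon ` sumset X Y"
    then obtain a b where ab: "a \<in> X" "b \<in> Y" "p = mon (a + b)" unfolding sumset_def by blast
    have "mon a \<in> (mideal n X :: 'a mpoly set)"
      using ab assms by (intro mon_in_mideal) auto
    moreover have "mon b \<in> (mideal n Y :: 'a mpoly set)"
      using ab assms by (intro mon_in_mideal) auto
    ultimately show "p \<in> ideal_prod (S n) (mideal n X) (mideal n Y)"
      using ideal_prod.prod[of "mon a" "mideal n X" "mon b" "mideal n Y" "S n"] ab(3) by (simp add: mon_add)
  qed
  then show "(mideal n (sumset X Y) :: 'a mpoly set) \<subseteq> ideal_prod (S n) (mideal n X) (mideal n Y)"
    by (rule mideal_subset_ideal[OF ring.ideal_prod_is_ideal[OF ring_S ideal_mideal ideal_mideal]])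
qed

text \<open>
  The exponents of the products of \<open>j\<close> generators; they generate the \<open>j\<close>-th power of the ideal.
\<close>

primrec nsum :: "expo set \<Rightarrow> nat \<Rightarrow> expo set" where
  "nsum T 0 = {0}"
| "nsum T (Suc j) = sumset T (nsum T j)"

lemma nsum_expos: "T \<subseteq> expos n \<Longrightarrow> nsum T j \<subseteq> expos n"
proof (induction j)
  case 0
  show ?case by (simp add: expos_def)
next
  case (Suc j)
  then show ?case using sumset_expos[of T n "nsum T j"] by simp
qed

lemma mideal_power:
  assumes "T \<subseteq> expos n"
  shows "ideal_power (S n) (mideal n T) j = (mideal n (nsum T j) :: 'a::field mpoly set)"
proof (induction j)
  case 0
  show ?case by (simp add: mideal_def)
next
  case (Suc j)
  then show ?case using mideal_prod[OF assms nsum_expos[OF assms]] by simp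
qed

lemma nsum_2: "nsum T 2 = sumset T T"
  by (auto simp: numeral_2_eq_2 sumset_def)

lemma max_ideal_eq: "max_ideal n = (mideal n ((\<lambda>i. single i 1) ` {1..n}) :: 'a::field mpoly set)"
proof -
  have "var ` {1..n} = (mon ` (\<lambda>i. single i 1) ` {1..n} :: 'a mpoly set)"
    by (simp add: image_image var_def)
  moreover have "(\<lambda>i. single i 1) ` {1..n} \<subseteq> expos n" by (auto simp: expos_def)
  ultimately show ?thesis unfolding max_ideal_def by (simp only: Idl_mon)
qed

definition min_gens :: "expo set \<Rightarrow> expo set" where
  "min_gens T = {t \<in> T. \<forall>a\<in>T. \<forall>s. t = a + s \<longrightarrow> a = t}"

lemma min_gensD: "t \<in> min_gens T \<Longrightarrow> a \<in> T \<Longrightarrow> t = a + s \<Longrightarrow> a = t"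
  unfolding min_gens_def by blast

lemma min_gens_divides:
  assumes "t \<in> T" shows "\<exists>a\<in>min_gens T. \<exists>s. t = a + s"
  using assms
proof (induction "tdeg t" arbitrary: t rule: less_induct)
  case less
  show ?case
  proof (cases "t \<in> min_gens T")
    case True
    then show ?thesis by (rule self_divides)
  next
    case False
    then obtain a s where as: "a \<in> T" "t = a + s" "a \<noteq> t" using less(2) unfolding min_gens_def by blast
    then have "tdeg s \<noteq> 0" by (auto simp: tdeg_eq_0)
    then have "tdeg a < tdeg t" using as(2) by (simp add: tdeg_add)
    from less(1)[OF this as(1)] obtain b r where "b \<in> min_gens T" "a = b + r" by blast
    then have "t = b + (r + s)" using as(2) by (simp add: add.assoc)
    then show ?thesis using \<open>b \<in> min_gens T\<close> by blast
  qed
qed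

lemma mideal_mono:
  assumes "\<And>t. t \<in> X \<Longrightarrow> \<exists>a\<in>Y. \<exists>s. t = a + s"
  shows "mideal n X \<subseteq> mideal n Y"
proof
  fix p assume p: "p \<in> mideal n X"
  have "\<exists>a\<in>Y. \<exists>s. t = a + s" if t: "t \<in> keys p" for t
  proof -
    obtain x s where x: "x \<in> X" "t = x + s" using p t unfolding mideal_def by blast
    obtain a r where a: "a \<in> Y" "x = a + r" using assms[OF x(1)] by blast
    have "t = a + (r + s)" using x a by (simp add: ac_simps)
    then show ?thesis using a(1) by blast
  qed
  then show "p \<in> mideal n Y" using p by (simp add: mideal_def)
qed

lemma mideal_min_gens: "mideal n (min_gens T) = mideal n T"
proof
  show "mideal n (min_gens T) \<subseteq> mideal n T"
    by (rule mideal_mono, rule self_divides) (simp add: min_gens_def)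
  show "mideal n T \<subseteq> mideal n (min_gens T)"
    by (rule mideal_mono) (rule min_gens_divides)
qed

lemma monomials_eq: "monomials n = mon ` expos n"
  by (auto simp: monomials_def expos_def)

text \<open>
  A minimal generator in \<open>T\<close> is divisible by some element of any other monomial generating set, which is in
  turn divisible by an element of \<open>T\<close>; by minimality all three coincide. So every monomial generating set
  contains the minimal elements, and these generate.
\<close>

lemma G_mideal:
  assumes T: "T \<subseteq> expos n"
  shows "G n (mideal n T) = (mon ` min_gens T :: 'a::field mpoly set)"
  unfolding G_def
proof (rule the_equality)
  let ?M = "min_gens T"
  have ME: "?M \<subseteq> expos n" using T by (auto simp: min_gens_def)
  have IM: "Idl\<^bsub>S n\<^esub> (mon ` ?M) = (mideal n T :: 'a mpoly set)"
    by (simp only: Idl_mon[OF ME] mideal_min_gens)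
  have "Idl\<^bsub>S n\<^esub> A' \<noteq> mideal n T" if A': "A' \<subset> mon ` ?M" for A' :: "'a mpoly set"
  proof
    assume eq: "Idl\<^bsub>S n\<^esub> A' = mideal n T"
    define T' where "T' = {t \<in> ?M. (mon t :: 'a mpoly) \<in> A'}"
    have A'T': "A' = mon ` T'" using A' unfolding T'_def by auto
    have "T' \<subseteq> expos n" using ME unfolding T'_def by blast
    then have eq': "mideal n T' = (mideal n T :: 'a mpoly set)" using eq unfolding A'T' by (simp only: Idl_mon)
    obtain x where x: "x \<in> mon ` ?M" "x \<notin> A'" using A' by blast
    then obtain m where "m \<in> ?M" "x = mon m" by blast
    with x(2) have m: "m \<in> ?M" "m \<notin> T'" unfolding T'_def by simp_all
    have mT: "m \<in> T" "m \<in> expos n" using m T by (auto simp: min_gens_def)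
    then have "mon m \<in> (mideal n T :: 'a mpoly set)" by (rule mon_in_mideal)
    then obtain a s where as: "a \<in> T'" "m = a + s" using mon_mideal[OF mT(2), of T'] eq' by auto
    then have "a \<in> T" unfolding T'_def min_gens_def by simp
    then have "a = m" by (rule min_gensD[OF m(1) _ as(2)])
    then show False using as(1) m(2) by simp
  qed
  then show "mon ` ?M \<subseteq> (monomials n :: 'a mpoly set) \<and> Idl\<^bsub>S n\<^esub> (mon ` ?M) = (mideal n T :: 'a mpoly set) \<and>
    (\<forall>A'. A' \<subset> mon ` ?M \<longrightarrow> Idl\<^bsub>S n\<^esub> A' \<noteq> (mideal n T :: 'a mpoly set))"
    using IM image_mono[OF ME, of mon] unfolding monomials_eq by simp
  fix A :: "'a mpoly set"
  assume A: "A \<subseteq> monomials n \<and> Idl\<^bsub>S n\<^esub> A = mideal n T \<and> (\<forall>A'. A' \<subset> A \<longrightarrow> Idl\<^bsub>S n\<^esub> A' \<noteq> mideal n T)"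
  obtain T' where T': "T' \<subseteq> expos n" "A = mon ` T'" using A unfolding monomials_eq by (meson subset_imageE)
  then have eq': "mideal n T' = (mideal n T :: 'a mpoly set)" using A by (simp add: Idl_mon)
  have "mon ` ?M \<subseteq> A"
  proof
    fix x :: "'a mpoly" assume "x \<in> mon ` ?M"
    then obtain m where m: "m \<in> ?M" "x = mon m" by blast
    have mT: "m \<in> T" "m \<in> expos n" using m T by (auto simp: min_gens_def)
    then have "mon m \<in> (mideal n T :: 'a mpoly set)" by (rule mon_in_mideal)
    then obtain a s where as: "a \<in> T'" "m = a + s" using mon_mideal[OF mT(2), of T'] eq' by auto
    have aE: "a \<in> expos n" using as T' by blast
    with as(1) have "mon a \<in> (mideal n T' :: 'a mpoly set)" by (rule mon_in_mideal)
    then obtain b r where b: "b \<in> T" "a = b + r" using mon_mideal[OF aE, of T] eq' by auto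
    have "m = b + (r + s)" using as b by (simp add: ac_simps)
    then have "b = m" by (rule min_gensD[OF m(1) b(1)])
    have "b + (r + s) = b" using trans[OF \<open>m = b + (r + s)\<close>[symmetric] \<open>b = m\<close>[symmetric]] .
    then have "r + s = 0" by simp
    then have "tdeg r + tdeg s = 0" by (simp flip: tdeg_add add: tdeg_zero)
    then have "tdeg s = 0" by simp
    then have "a = m" using as by (simp add: tdeg_eq_0)
    then show "x \<in> A" using as m T' by blast
  qed
  moreover have "\<not> mon ` ?M \<subset> A" using A IM by blast
  ultimately show "A = mon ` ?M" by blast
qed

lemma min_gens_equigenerated:
  assumes "\<And>t. t \<in> T \<Longrightarrow> tdeg t = d" shows "min_gens T = T"
proof -
  have "a = t" if "t \<in> T" "a \<in> T" "t = a + s" for t a s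
  proof -
    have "tdeg s = 0" using assms[OF that(1)] assms[OF that(2)] that(3) by (simp add: tdeg_add)
    then show ?thesis using that(3) by (simp add: tdeg_eq_0)
  qed
  then show ?thesis unfolding min_gens_def by blast
qed

lemma G_equigenerated:
  assumes "T \<subseteq> expos n" "\<And>t. t \<in> T \<Longrightarrow> tdeg t = d"
  shows "G n (mideal n T) = (mon ` T :: 'a::field mpoly set)"
  using G_mideal[OF assms(1)] min_gens_equigenerated[of T d] assms(2) by simp

section \<open>Principal Borel ideals\<close>

text \<open>
  The sum of all indices of the variables, with multiplicity: it drops under Borel moves.
\<close>

lemma wt_ex: "\<exists>w :: expo \<Rightarrow> nat. (\<forall>s t. w (s + t) = w s + w t) \<and> (\<forall>i. w (single i 1) = i)"
proof (intro exI conjI allI)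
  let ?w = "\<lambda>t :: expo. \<Sum>i\<in>keys t. i * lookup t i"
  have sup: "?w t = (\<Sum>i\<in>X. i * lookup t i)" if "finite X" "keys t \<subseteq> X" for t X
    using that by (intro sum.mono_neutral_left) (auto simp: in_keys_iff)
  show "?w (s + t) = ?w s + ?w t" for s t
    using sup[of "keys s \<union> keys t" s] sup[of "keys s \<union> keys t" t]
    by (simp add: keys_add_expo lookup_add distrib_left sum.distrib)
  show "?w (single i 1) = i" for i by simp
qed

lemma tail_cong: "(\<And>i. i \<ge> k \<Longrightarrow> lookup s i = lookup t i) \<Longrightarrow> tail s k = tail t k"
  unfolding tail_def by (intro sum.cong) (auto simp: in_keys_iff)

text \<open>
  Every \<open>t\<close> below \<open>u\<close> is reached from \<open>u\<close> by Borel moves. At the largest index \<open>k\<close> where they differ, \<open>u\<close> has the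
  larger exponent, and moving one \<open>x\<^sub>k\<close> of \<open>u\<close> to \<open>x\<^sub>k\<^sub>-\<^sub>1\<close> lowers only the tail sum at \<open>k\<close>, so that the
  result is still above \<open>t\<close>.
\<close>

lemma below_subset_of_closed:
  assumes E: "borel_closed E" and "u \<in> E" "0 \<notin> keys u"
  shows "borel_below u \<subseteq> E"
proof -
  obtain w :: "expo \<Rightarrow> nat" where w: "\<And>s t. w (s + t) = w s + w t" "\<And>i. w (single i 1) = i"
    using wt_ex by blast
  have "t \<in> E" if "t \<in> borel_below u" "u \<in> E" "0 \<notin> keys u" for t
    using that
  proof (induction "w u" arbitrary: u rule: less_induct)
    case less
    note t = less(2) and uE = less(3) and u0 = less(4)
    have t0: "lookup t 0 = 0" and u0': "lookup u 0 = 0" using t u0 by (auto simp: borel_below_def in_keys_iff)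
    have tl: "tail t k \<le> tail u k" for k using t by (simp add: borel_below_def)
    show "t \<in> E"
    proof (cases "t = u")
      case True then show ?thesis using uE by simp
    next
      case False
      have "\<not> rlex u t"
      proof
        assume "rlex u t"
        then obtain i where i: "lookup u i < lookup t i" "\<forall>j>i. lookup u j = lookup t j"
          unfolding rlex_def by blast
        have "tail u (Suc i) = tail t (Suc i)" by (rule tail_cong) (use i(2) in simp)
        then show False using tl[of i] i(1) tail_Suc[of t i] tail_Suc[of u i] by simp
      qed
      then have "rlex t u" using False rlex_total by blast
      then obtain k where k: "lookup t k < lookup u k" "\<forall>j>k. lookup t j = lookup u j"
        unfolding rlex_def by blast
      have eqS: "tail t (Suc k) = tail u (Suc k)" by (rule tail_cong) (use k(2) in simp)
      have lt: "tail t k < tail u k" using k(1) eqS tail_Suc[of t k] tail_Suc[of u k] by simp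
      have "tail t 0 = tail u 0" using t by (simp add: borel_below_def tail_0)
      moreover have "tail t 1 = tail u 1" using calculation t0 u0' tail_Suc[of t 0] tail_Suc[of u 0] by simp
      ultimately have "k \<noteq> 0" "k \<noteq> 1" using lt by (metis less_irrefl)+
      then have k2: "2 \<le> k" by simp
      have ku: "k \<in> keys u" using k(1) by (simp add: in_keys_iff)
      define v where "v = borel_move u k (k - 1)"
      have v_add: "v + single k 1 = u + single (k - 1) 1" unfolding v_def by (rule borel_move_add[OF ku])
      have vE: "v \<in> E" using E uE ku k2 unfolding borel_closed_def v_def by simp
      have v0: "0 \<notin> keys v" using u0' k2 by (simp add: v_def in_keys_iff lookup_borel_move)
      have "w v + k = w u + (k - 1)" using arg_cong[OF v_add, of w] by (simp only: w)
      then have wv: "w v < w u" using k2 by linarith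
      have "tail t i \<le> tail v i" for i
        using arg_cong[OF v_add, of "\<lambda>x. tail x i"] tl[of i] lt k2
        by (cases "i = k") (auto simp: tail_add tail_single split: if_splits)
      moreover have "tdeg v = tdeg u" unfolding v_def by (rule tdeg_borel_move[OF ku])
      ultimately have "t \<in> borel_below v" using t by (simp add: borel_below_def)
      from less(1)[OF wv this vE v0] show ?thesis .
    qed
  qed
  with assms(2,3) show ?thesis by blast
qed

lemma expos_borel_move:
  assumes "t \<in> expos n" "j \<in> keys t" "1 \<le> i" "i < j" shows "borel_move t j i \<in> expos n"
proof -
  have "j \<le> n" using assms(1,2) by (auto simp: expos_def)
  then have "single i 1 \<in> expos n" using assms(3,4) by (simp add: expos_def)
  then have "t + single i 1 \<in> expos n" using assms(1) by (simp only: expos_add)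
  then have "borel_move t j i + single j 1 \<in> expos n" using borel_move_add[OF assms(2), of i] by simp
  then show ?thesis by (simp add: expos_add)
qed

lemma var_times_mon: "var i * mon t = (mon (single i 1 + t) :: 'a::field mpoly)"
  by (simp add: var_def mon_add)

lemma mon_eq_var_times:
  fixes w :: "'a::field mpoly"
  assumes "mon g = var j * w"
  obtains t where "w = mon t" "g = single j 1 + t" "j \<in> keys g"
proof -
  have "g \<in> keys (var j * w)" using assms[symmetric] by simp
  then obtain a t where at: "a \<in> keys (var j :: 'a mpoly)" "g = a + t" by (rule keys_multE)
  then have g: "g = single j 1 + t" by (simp add: var_def)
  have "var j * w = var j * mon t" using assms g by (simp add: var_times_mon)
  moreover have "var j \<noteq> (0 :: 'a mpoly)" by (metis empty_not_insert keys_mon keys_zero var_def)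
  ultimately have "w = mon t" by simp
  moreover have "j \<in> keys g" unfolding g by (simp add: keys_add_expo)
  ultimately show thesis using that g by blast
qed

lemma strongly_stable_mideal:
  assumes T: "T \<subseteq> expos n" "borel_closed T" "\<And>t. t \<in> T \<Longrightarrow> tdeg t = d"
  shows "strongly_stable n (mideal n T :: 'a::field mpoly set)"
  unfolding strongly_stable_def
proof (intro conjI ballI impI)
  show "monomial_ideal n (mideal n T :: 'a mpoly set)"
    unfolding monomial_ideal_def monomials_eq
    by (rule exI[of _ "mon ` T"]) (use T(1) in \<open>auto simp: Idl_mon\<close>)
  fix v w :: "'a mpoly" and i j
  assume h: "v \<in> G n (mideal n T)" "j \<in> {1..n}" "i \<in> {1..n}" "v = var j * w \<and> i < j"
  obtain g where g: "g \<in> T" "v = mon g" using h(1) G_equigenerated[OF T(1,3)] by auto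
  have "mon g = var j * w" using h(4) g(2) by simp
  then obtain t where t: "w = mon t" "g = single j 1 + t" "j \<in> keys g" by (rule mon_eq_var_times)
  have "borel_move g j i + single j 1 = (single i 1 + t) + single j 1"
    using borel_move_add[OF t(3), of i] t(2) by (simp add: ac_simps)
  then have "borel_move g j i = single i 1 + t" by (rule add_right_imp_eq)
  moreover have "borel_move g j i \<in> T" using T(2) g(1) t(3) h(3,4) unfolding borel_closed_def by simp
  ultimately have "single i 1 + t \<in> T" by simp
  then show "var i * w \<in> mideal n T" using T(1) mon_in_mideal[of "single i 1 + t" T n] by (auto simp: t(1) var_times_mon)
qed

text \<open>
  Strong stability constrains only the minimal generators. For a monomial \<open>g s\<close> with a generator \<open>g\<close>, the variable
  that is moved divides \<open>g\<close> or \<open>s\<close>: in the first case stability applies, in the second the result is still a multiple of \<open>g\<close>.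
\<close>

lemma strongly_stable_monomials_closed:
  assumes J: "strongly_stable n (J :: 'a::field mpoly set)"
  shows "borel_closed {t \<in> expos n. mon t \<in> J}"
proof -
  obtain X where X: "X \<subseteq> monomials n" "J = Idl\<^bsub>S n\<^esub> X" using J unfolding strongly_stable_def monomial_ideal_def by blast
  then obtain T where T: "T \<subseteq> expos n" "X = mon ` T" unfolding monomials_eq by (meson subset_imageE)
  have JT: "J = mideal n T" using X(2) T by (simp add: Idl_mon)
  have ideal: "ideal J (S n)" unfolding JT by (rule ideal_mideal)
  show ?thesis unfolding borel_closed_def
  proof (intro ballI allI impI)
    fix t j i assume a: "t \<in> {t \<in> expos n. mon t \<in> J}" "j \<in> keys t" "1 \<le> i \<and> i < j"
    have tE: "t \<in> expos n" and tJ: "mon t \<in> J" using a(1) by auto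
    then have jn: "j \<in> {1..n}" "i \<in> {1..n}" using a(2,3) unfolding expos_def by auto
    have mE: "borel_move t j i \<in> expos n" using expos_borel_move[OF tE a(2)] a(3) by simp
    obtain b r where b: "b \<in> T" "t = b + r" using tJ mon_mideal[OF tE, of T] unfolding JT by blast
    from min_gens_divides[OF b(1)] obtain g r' where g: "g \<in> min_gens T" "b = g + r'" by blast
    define s where "s = r' + r"
    have ts: "t = g + s" unfolding s_def b(2) g(2) by (simp add: ac_simps)
    have gE: "g \<in> expos n" "s \<in> expos n" using tE unfolding ts expos_add by auto
    have "mon (borel_move t j i) \<in> J"
    proof (cases "j \<in> keys g")
      case True
      define h where "h = g - single j 1"
      have gh: "g = single j 1 + h"
      proof (rule poly_mapping_eqI)
        show "lookup g k = lookup (single j 1 + h) k" for k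
          using True by (cases "k = j") (auto simp: h_def lookup_add lookup_minus_nat lookup_single_if in_keys_iff)
      qed
      have hE: "h \<in> expos n" using gE(1) unfolding gh expos_add by simp
      have "mon g \<in> G n J" unfolding JT G_mideal[OF T(1)] using g(1) by blast
      moreover have "mon g = var j * (mon h :: 'a mpoly)" by (simp add: var_times_mon gh)
      moreover have "mon h \<in> carrier (S n :: 'a mpoly ring)" using hE by (simp add: mon_polys)
      ultimately have "var i * mon h \<in> J" using J jn a(3) unfolding strongly_stable_def by blast
      then have "mon s * (var i * mon h) \<in> J" using ideal gE(2) by (simp add: ideal_S_iff mon_polys)
      moreover have "borel_move t j i = s + (single i 1 + h)"
      proof -
        have "borel_move t j i + single j 1 = s + (single i 1 + h) + single j 1"
          using borel_move_add[OF a(2), of i] by (simp add: ts gh ac_simps)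
        then show ?thesis by simp
      qed
      ultimately show ?thesis by (simp add: mon_add var_def)
    next
      case False
      then have "j \<in> keys s" using a(2) unfolding ts by (simp add: keys_add_expo)
      then have "borel_move t j i + single j 1 = g + borel_move s j i + single j 1"
        using borel_move_add[OF a(2), of i] borel_move_add[of j s i] by (simp add: ts add.assoc)
      then have "borel_move t j i = g + borel_move s j i" by simp
      moreover have "g \<in> T" using g(1) unfolding min_gens_def by simp
      ultimately show ?thesis using mon_mideal[OF mE, of T] unfolding JT by blast
    qed
    with mE show "borel_move t j i \<in> {t \<in> expos n. mon t \<in> J}" by simp
  qed
qed

lemma borel_below_expos: assumes "u \<in> expos n" shows "borel_below u \<subseteq> expos n"
proof
  fix t assume t: "t \<in> borel_below u"
  have "i \<in> {1..n}" if i: "i \<in> keys t" for i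
  proof -
    have "i \<noteq> 0" using i t by (auto simp: borel_below_def intro: ccontr)
    have "lookup t i \<le> tail t i" by (rule lookup_le_tail) simp
    also have "\<dots> \<le> tail u i" using t by (simp add: borel_below_def)
    finally have "tail u i \<noteq> 0" using i by (auto simp: in_keys_iff)
    then obtain k where "i \<le> k" "k \<in> keys u" by (auto simp: tail_eq_0 in_keys_iff)
    then show ?thesis using assms \<open>i \<noteq> 0\<close> by (auto simp: expos_def)
  qed
  then show "t \<in> expos n" by (auto simp: expos_def)
qed

text \<open>
  The vectors below \<open>u\<close> are closed under Borel moves and of one degree, hence generate a strongly stable ideal; and any strongly stable
  ideal that contains \<open>u\<close> contains them, because they arise from \<open>u\<close> by Borel moves.
\<close>

theorem B_mon:
  assumes u: "u \<in> expos n"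
  shows "B n (mon u) = (mideal n (borel_below u) :: 'a::field mpoly set)"
  unfolding B_def
proof (rule Least_equality)
  have u0: "0 \<notin> keys u" using u by (auto simp: expos_def)
  have "tdeg t = tdeg u" if "t \<in> borel_below u" for t using that by (simp add: borel_below_def)
  then have "strongly_stable n (mideal n (borel_below u) :: 'a mpoly set)"
    by (rule strongly_stable_mideal[OF borel_below_expos[OF u] borel_closed_below])
  moreover have "mon u \<in> (mideal n (borel_below u) :: 'a mpoly set)"
    by (rule mon_in_mideal[OF self_below[OF u0] u])
  ultimately show "strongly_stable n (mideal n (borel_below u) :: 'a mpoly set) \<and> mon u \<in> (mideal n (borel_below u) :: 'a mpoly set)"
    by blast
  fix J :: "'a mpoly set" assume J: "strongly_stable n J \<and> mon u \<in> J"
  then have "borel_below u \<subseteq> {t \<in> expos n. mon t \<in> J}"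
    using u u0 by (intro below_subset_of_closed strongly_stable_monomials_closed) auto
  then have "mon ` borel_below u \<subseteq> J" by blast
  moreover have "ideal J (S n)"
  proof -
    obtain X where X: "X \<subseteq> monomials n" "J = Idl\<^bsub>S n\<^esub> X" using J unfolding strongly_stable_def monomial_ideal_def by blast
    then have "X \<subseteq> carrier (S n)" by (auto simp: monomials_eq mon_polys)
    then show ?thesis unfolding X(2) by (rule ring.genideal_ideal[OF ring_S])
  qed
  ultimately show "mideal n (borel_below u) \<subseteq> J" by (intro mideal_subset_ideal)
qed

section \<open>Numbers of generators of equigenerated monomial ideals\<close>

definition scale :: "'a::field \<Rightarrow> 'a mpoly \<Rightarrow> 'a mpoly" where
  "scale c p = single 0 c * p"

lemma vector_space_scale: "vector_space (scale :: 'a::field \<Rightarrow> _)"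
proof
  fix a b :: 'a and x y :: "'a mpoly"
  show "scale a (x + y) = scale a x + scale a y" by (simp add: scale_def distrib_left)
  show "scale (a + b) x = scale a x + scale b x" by (simp add: scale_def single_add distrib_right)
  show "scale a (scale b x) = scale (a * b) x"
  proof -
    have "scale a (scale b x) = (single 0 a * single 0 b) * x" by (simp only: scale_def mult.assoc)
    then show ?thesis by (simp add: scale_def mult_single)
  qed
  show "scale 1 x = x" by (simp add: scale_def)
qed

interpretation mp: vector_space "scale :: 'a::field \<Rightarrow> 'a mpoly \<Rightarrow> 'a mpoly"
  by (rule vector_space_scale)

lemma lookup_scale: "lookup (scale c p) t = c * lookup p t"
  unfolding scale_def mult_map_scale_conv_mult[symmetric]
  by (auto simp: Poly_Mapping.map.rep_eq when_def)

lemma independent_mon: "mp.independent (mon ` T :: 'a::field mpoly set)"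
proof
  assume "mp.dependent (mon ` T :: 'a mpoly set)"
  then obtain X r and v :: "'a mpoly" where X: "finite X" "X \<subseteq> mon ` T" "(\<Sum>v\<in>X. scale (r v) v) = 0" "v \<in> X" "r v \<noteq> 0"
    unfolding mp.dependent_explicit by blast
  obtain s where s: "v = mon s" using X by blast
  have "lookup w s = (if w = v then 1 else 0)" if wX: "w \<in> X" for w
  proof -
    obtain s' where "w = mon s'" using X(2) wX by blast
    then show ?thesis unfolding s by (simp add: mon_inj) (simp add: mon_def lookup_single_if)
  qed
  then have "(\<Sum>w\<in>X. r w * lookup w s) = (\<Sum>w\<in>X. if w = v then r v else 0)"
    by (intro sum.cong) auto
  also have "\<dots> = r v" using X by simp
  finally have "lookup (\<Sum>v\<in>X. scale (r v) v) s = r v" by (simp add: lookup_sum lookup_scale)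
  with X show False by simp
qed

text \<open>
  The ideal starts in degree \<open>d\<close>, where \<open>T\<close> is a basis. Projecting to this degree, multiplication by \<open>r\<close> becomes multiplication
  by the constant term of \<open>r\<close>. Hence the projections of any generators span the span of \<open>T\<close>.
\<close>

lemma card_le_of_generators:
  fixes A :: "'a::field mpoly set"
  assumes T: "finite T" "T \<subseteq> expos n" "\<And>t. t \<in> T \<Longrightarrow> tdeg t = d"
    and A: "A \<subseteq> polys n" "finite A" "Idl\<^bsub>S n\<^esub> A = mideal n T"
  shows "card T \<le> card A"
proof -
  define pr where "pr p = (\<Sum>t\<in>T. single t (lookup p t))" for p :: "'a mpoly"
  have lpr: "lookup (pr p) t = (if t \<in> T then lookup p t else 0)" for p t
  proof -
    have "lookup (pr p) t = (\<Sum>s\<in>T. if s = t then lookup p t else 0)"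
      unfolding pr_def lookup_sum by (intro sum.cong) (auto simp: lookup_single_if)
    then show ?thesis using T(1) by simp
  qed
  have pr_mult: "pr (r * a) = scale (lookup r 0) (pr a)" if a: "a \<in> mideal n T" for r a
  proof (rule poly_mapping_eqI)
    fix t
    show "lookup (pr (r * a)) t = lookup (scale (lookup r 0) (pr a)) t"
    proof (cases "t \<in> T")
      case True
      define r' where "r' = r - single 0 (lookup r 0)"
      have "lookup (r' * a) t = 0"
      proof (rule ccontr)
        assume "lookup (r' * a) t \<noteq> 0"
        then have "t \<in> keys (r' * a)" by (simp add: in_keys_iff)
        then obtain x y where xy: "x \<in> keys r'" "y \<in> keys a" "t = x + y" by (rule keys_multE)
        have "x \<noteq> 0" using xy(1) by (auto simp: r'_def in_keys_iff lookup_minus)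
        moreover obtain b s where "b \<in> T" "y = b + s" using a xy(2) unfolding mideal_def by blast
        ultimately have "tdeg t > d" using T(3)[of b] xy(3) tdeg_eq_0[of x] by (auto simp: tdeg_add)
        then show False using T(3)[OF True] by simp
      qed
      moreover have "r * a = scale (lookup r 0) a + r' * a" by (simp add: r'_def scale_def left_diff_distrib)
      ultimately show ?thesis using True by (simp add: lpr lookup_add lookup_scale)
    next
      case False
      then show ?thesis by (simp add: lpr lookup_scale)
    qed
  qed
  have pr_add: "pr (a + b) = pr a + pr b" for a b
    by (rule poly_mapping_eqI) (simp add: lpr lookup_add)
  have pr_0: "pr 0 = 0" by (rule poly_mapping_eqI) (simp add: lpr)
  define J where "J = {p \<in> mideal n T. pr p \<in> mp.span (pr ` A)}"
  have idT: "ideal (mideal n T :: 'a mpoly set) (S n)" by (rule ideal_mideal)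
  have "ideal J (S n)"
    unfolding ideal_S_iff
  proof (intro conjI ballI)
    show "J \<subseteq> polys n" by (auto simp: J_def mideal_def)
    show "0 \<in> J" using idT by (simp add: J_def pr_0 mp.span_zero ideal_S_iff)
    fix a b assume "a \<in> J" "b \<in> J"
    then show "a + b \<in> J" by (simp add: J_def pr_add mp.span_add mideal_add)
  next
    fix r a :: "'a mpoly" assume "r \<in> polys n" "a \<in> J"
    then show "r * a \<in> J" using idT by (simp add: J_def pr_mult mp.span_scale ideal_S_iff)
  qed
  moreover have "A \<subseteq> J"
  proof -
    have "A \<subseteq> mideal n T" using ring.genideal_self[OF ring_S, of A n] A(1) unfolding A(3) by simp
    then show ?thesis by (auto simp: J_def intro: mp.span_base)
  qed
  ultimately have "Idl\<^bsub>S n\<^esub> A \<subseteq> J" by (rule ring.genideal_minimal[OF ring_S])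
  then have IJ: "mideal n T \<subseteq> J" unfolding A(3) .
  have "mon ` T \<subseteq> mp.span (pr ` A)"
  proof
    fix x :: "'a mpoly" assume "x \<in> mon ` T"
    then obtain t where t: "t \<in> T" "x = mon t" by blast
    have "x \<in> mideal n T" using mon_in_mideal t T(2) by blast
    then have "pr x \<in> mp.span (pr ` A)" using IJ by (auto simp: J_def)
    moreover have "pr x = x" unfolding t(2)
      by (rule poly_mapping_eqI) (use t(1) in \<open>auto simp: lpr mon_def lookup_single_if\<close>)
    ultimately show "x \<in> mp.span (pr ` A)" by simp
  qed
  then have "card (mon ` T :: 'a mpoly set) \<le> card (pr ` A)"
    using mp.independent_span_bound[of "pr ` A" "mon ` T"] A(2) independent_mon by blast
  also have "\<dots> \<le> card A" using A(2) by (rule card_image_le)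
  also have "card (mon ` T :: 'a mpoly set) = card T"
    by (rule card_image) (simp add: inj_on_def mon_inj)
  finally show ?thesis .
qed

theorem min_num_gens_mideal:
  assumes T: "finite T" "T \<subseteq> expos n" "\<And>t. t \<in> T \<Longrightarrow> tdeg t = d"
  shows "min_num_gens (S n) (mideal n T :: 'a::field mpoly set) = card T"
  unfolding min_num_gens_def
proof (rule Least_equality)
  have "card (mon ` T :: 'a mpoly set) = card T"
    by (rule card_image) (simp add: inj_on_def mon_inj)
  moreover have "mon ` T \<subseteq> carrier (S n :: 'a mpoly ring)" using T(2) by (auto simp: mon_polys)
  ultimately show "\<exists>A \<subseteq> carrier (S n). finite A \<and> card A = card T \<and> Idl\<^bsub>S n\<^esub> A = (mideal n T :: 'a mpoly set)"
    using T(1) Idl_mon[OF T(2)] by (intro exI[of _ "mon ` T"]) simp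
  fix k assume "\<exists>A \<subseteq> carrier (S n). finite A \<and> card A = k \<and> Idl\<^bsub>S n\<^esub> A = (mideal n T :: 'a mpoly set)"
  then obtain A :: "'a mpoly set" where "A \<subseteq> polys n" "finite A" "card A = k" "Idl\<^bsub>S n\<^esub> A = mideal n T" by auto
  then show "card T \<le> k" using card_le_of_generators[OF T] by blast
qed

section \<open>Algebraic independence along chains of prime ideals\<close>

definition prime_in :: "'b::comm_ring_1 set \<Rightarrow> 'b set \<Rightarrow> bool" where
  "prime_in C P \<longleftrightarrow> P \<subseteq> C \<and> 0 \<in> P \<and> 1 \<notin> P \<and> (\<forall>a\<in>P. \<forall>b\<in>P. a + b \<in> P) \<and> (\<forall>r\<in>C. \<forall>a\<in>P. r * a \<in> P) \<and>
     (\<forall>a\<in>C. \<forall>b\<in>C. a * b \<in> P \<longrightarrow> a \<in> P \<or> b \<in> P)"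

lemma primeideal_iff_prime_in:
  assumes C: "subring_set C"
  shows "primeideal P (ring_on C) \<longleftrightarrow> prime_in C P"
proof -
  have "P \<noteq> C \<longleftrightarrow> 1 \<notin> P" if "ideal P (ring_on C)"
  proof
    assume "P \<noteq> C"
    show "1 \<notin> P"
    proof
      assume "1 \<in> P"
      have "r \<in> P" if "r \<in> C" for r
      proof -
        have "r * 1 \<in> P" using \<open>ideal P _\<close> \<open>1 \<in> P\<close> that unfolding ideal_ring_on_iff[OF C] by blast
        then show ?thesis by simp
      qed
      moreover have "P \<subseteq> C" using \<open>ideal P _\<close> unfolding ideal_ring_on_iff[OF C] by blast
      ultimately show False using \<open>P \<noteq> C\<close> by blast
    qed
  next
    assume "1 \<notin> P"
    then show "P \<noteq> C" using C unfolding subring_set_def by blast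
  qed
  then show ?thesis
    unfolding primeideal_ring_on_iff[OF C] prime_in_def ideal_ring_on_iff[OF C] by blast
qed

text \<open>
  The list contains, for each step of a chain of primes that starts at \<open>P\<close>, an element of the larger prime that is not
  in the smaller one.
\<close>

fun prime_chain :: "'b::comm_ring_1 set \<Rightarrow> 'b set \<Rightarrow> 'b list \<Rightarrow> bool" where
  "prime_chain C P [] \<longleftrightarrow> prime_in C P"
| "prime_chain C P (z # zs) \<longleftrightarrow> prime_in C P \<and> z \<notin> P \<and> (\<exists>Q. P \<subseteq> Q \<and> z \<in> Q \<and> prime_chain C Q zs)"

fun list_power :: "'b::comm_ring_1 list \<Rightarrow> nat list \<Rightarrow> 'b" where
  "list_power (z # zs) (e # es) = z ^ e * list_power zs es"
| "list_power _ _ = 1"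

lemma prime_chain_prime: "prime_chain C P zs \<Longrightarrow> prime_in C P"
  by (cases zs) auto

lemma prime_chain_in: "prime_chain C P zs \<Longrightarrow> set zs \<subseteq> C"
proof (induction zs arbitrary: P)
  case (Cons z zs)
  then obtain Q where Q: "z \<in> Q" "prime_chain C Q zs" by auto
  then show ?case using Cons.IH[OF Q(2)] prime_chain_prime[OF Q(2)] by (auto simp: prime_in_def)
qed simp

lemma subring_set_power: "subring_set C \<Longrightarrow> z \<in> C \<Longrightarrow> z ^ e \<in> C"
  by (induction e) (auto simp: subring_set_def)

lemma subring_set_sum: "subring_set C \<Longrightarrow> (\<And>x. x \<in> X \<Longrightarrow> f x \<in> C) \<Longrightarrow> sum f X \<in> C"
  by (induction X rule: infinite_finite_induct) (auto simp: subring_set_def)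

lemma list_power_in: "subring_set C \<Longrightarrow> set zs \<subseteq> C \<Longrightarrow> list_power zs es \<in> C"
proof (induction zs es rule: list_power.induct)
  case (1 z zs e es)
  then have "z ^ e \<in> C" "list_power zs es \<in> C" using subring_set_power by auto
  then show ?case using 1(2) by (simp add: subring_set_def)
qed (auto simp: subring_set_def)

text \<open>
  Modulo \<open>z \<in> Q\<close> only \<open>g 0\<close> survives, so \<open>g 0 \<in> Q\<close> and hence \<open>g 0 = 0\<close>. The remaining sum is divisible by \<open>z\<close>, and since
  \<open>z \<notin> P\<close> the factor \<open>z\<close> can be cancelled.
\<close>

lemma coefficients_vanish:
  assumes C: "subring_set C" and P: "prime_in C P" and Q: "prime_in C Q" "P \<subseteq> Q" and z: "z \<in> Q" "z \<notin> P"
  shows "(\<And>e. g e \<in> C) \<Longrightarrow> (\<And>e. g e \<in> Q \<Longrightarrow> g e = 0) \<Longrightarrow> (\<Sum>e\<le>M. z ^ e * g e) \<in> P \<Longrightarrow> e \<le> M \<Longrightarrow> g e = 0"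
proof (induction M arbitrary: g e)
  case 0
  then have "g 0 \<in> Q" using Q by auto
  then show ?case using 0 by auto
next
  case (Suc M)
  have zC: "z \<in> C" using z(1) Q(1) by (auto simp: prime_in_def)
  define h where "h = (\<Sum>e\<le>M. z ^ e * g (Suc e))"
  have hC: "h \<in> C" unfolding h_def
  proof (rule subring_set_sum[OF C])
    fix e show "z ^ e * g (Suc e) \<in> C" using subring_set_power[OF C zC, of e] Suc(2)[of "Suc e"] C
      by (simp add: subring_set_def)
  qed
  have "(\<Sum>e\<le>Suc M. z ^ e * g e) = g 0 + z * h"
    unfolding h_def by (subst sum.atMost_Suc_shift) (simp add: sum_distrib_left mult.assoc)
  then have P0: "g 0 + z * h \<in> P" using Suc(4) by simp
  have "h * z \<in> Q" using Q(1) z(1) hC by (simp add: prime_in_def)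
  moreover have "- 1 \<in> C" using C by (simp add: subring_set_def)
  ultimately have "- 1 * (h * z) \<in> Q" using Q(1) unfolding prime_in_def by blast
  moreover have "g 0 + z * h \<in> Q" using P0 Q(2) by blast
  ultimately have "(g 0 + z * h) + - 1 * (h * z) \<in> Q" using Q(1) unfolding prime_in_def by blast
  then have "g 0 \<in> Q" by (simp add: mult.commute)
  then have g0: "g 0 = 0" using Suc(3) by blast
  then have "z * h \<in> P" using P0 by simp
  then have "h \<in> P" using P zC hC z(2) unfolding prime_in_def by blast
  then have IH: "g (Suc e) = 0" if "e \<le> M" for e
    using Suc(1)[of "\<lambda>e. g (Suc e)" e] Suc(2,3) that unfolding h_def by blast
  show ?case using g0 IH Suc(5) by (cases e) auto
qed

text \<open>
  The elements chosen along a chain of primes are algebraically independent modulo the smallest prime. The map \<open>\<kappa>\<close> embeds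
  the field of coefficients; a nonzero constant is a unit and thus lies in no prime.
\<close>

lemma chain_independent:
  fixes \<kappa> :: "'a::field \<Rightarrow> 'b::comm_ring_1"
  assumes C: "subring_set C"
    and \<kappa>: "\<And>c. \<kappa> c \<in> C" "\<And>c. c \<noteq> 0 \<Longrightarrow> \<kappa> (inverse c) * \<kappa> c = 1" "\<kappa> 0 = 0"
    and "prime_chain C P zs"
    and "(\<Sum>es | set es \<subseteq> {..M} \<and> length es = length zs. \<kappa> (c es) * list_power zs es) \<in> P"
    and "set es \<subseteq> {..M}" "length es = length zs"
  shows "c es = 0"
  using assms(5-)
proof (induction zs arbitrary: P c es)
  case Nil
  have "{es :: nat list. set es \<subseteq> {..M} \<and> length es = length ([] :: 'b list)} = {[]}" by auto
  then have cP: "\<kappa> (c []) \<in> P" using Nil(2) by simp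
  have "c [] = 0"
  proof (rule ccontr)
    assume "c [] \<noteq> 0"
    then have "1 \<in> P" using \<kappa>(1)[of "inverse (c [])"] \<kappa>(2) cP Nil(1) unfolding prime_chain.simps prime_in_def by metis
    then show False using Nil(1) by (simp add: prime_in_def)
  qed
  then show ?case using Nil by simp
next
  case (Cons z zs)
  obtain Q where Q: "P \<subseteq> Q" "z \<in> Q" "prime_chain C Q zs" and P: "prime_in C P" "z \<notin> P" using Cons(2) by auto
  let ?E = "{es :: nat list. set es \<subseteq> {..M} \<and> length es = length zs}"
  define g where "g e = (\<Sum>es\<in>?E. \<kappa> (c (e # es)) * list_power zs es)" for e
  have E: "{es. set es \<subseteq> {..M} \<and> length es = length (z # zs)} = (\<lambda>(e, es). e # es) ` ({..M} \<times> ?E)"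
    by (auto simp: length_Suc_conv image_iff)
  have "(\<Sum>es | set es \<subseteq> {..M} \<and> length es = length (z # zs). \<kappa> (c es) * list_power (z # zs) es)
     = (\<Sum>(e, es)\<in>{..M} \<times> ?E. \<kappa> (c (e # es)) * (z ^ e * list_power zs es))"
    unfolding E by (subst sum.reindex) (auto simp: inj_on_def intro!: sum.cong)
  also have "\<dots> = (\<Sum>e\<le>M. \<Sum>es\<in>?E. \<kappa> (c (e # es)) * (z ^ e * list_power zs es))"
    by (simp add: sum.cartesian_product)
  also have "\<dots> = (\<Sum>e\<le>M. z ^ e * g e)"
    unfolding g_def sum_distrib_left by (simp add: mult.left_commute)
  finally have sumP: "(\<Sum>e\<le>M. z ^ e * g e) \<in> P" using Cons(3) by simp
  have gC: "g e \<in> C" for e unfolding g_def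
  proof (rule subring_set_sum[OF C])
    fix es show "\<kappa> (c (e # es)) * list_power zs es \<in> C"
      using list_power_in[OF C prime_chain_in[OF Q(3)], of es] \<kappa>(1)[of "c (e # es)"] C by (simp add: subring_set_def)
  qed
  have IH: "c (e # es) = 0" if "g e \<in> Q" "es \<in> ?E" for e es
    using Cons.IH[OF Q(3), of "\<lambda>es. c (e # es)" es] that unfolding g_def by simp
  have gQ: "g e = 0" if "g e \<in> Q" for e
    unfolding g_def using IH[OF that] \<kappa>(3) by (intro sum.neutral) auto
  obtain e es' where es: "es = e # es'" "e \<le> M" "es' \<in> ?E" using Cons(4,5) by (cases es) auto
  have "g e = 0" by (rule coefficients_vanish[OF C P(1) prime_chain_prime[OF Q(3)] Q(1,2) P(2) gC gQ sumP es(2)])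
  moreover have "0 \<in> Q" using prime_chain_prime[OF Q(3)] by (simp add: prime_in_def)
  ultimately show ?case using IH[of e es'] es by simp
qed

lemma prime_chain_of_sequence:
  assumes "\<And>i. i \<le> k \<Longrightarrow> prime_in C (P i)" "\<And>i. i < k \<Longrightarrow> P i \<subset> P (Suc i)"
  shows "\<exists>zs. length zs = k \<and> prime_chain C (P 0) zs"
  using assms
proof (induction k arbitrary: P)
  case 0
  then show ?case by (intro exI[of _ "[]"]) auto
next
  case (Suc k)
  obtain z where z: "z \<in> P (Suc 0)" "z \<notin> P 0" using Suc(3)[of 0] by blast
  obtain zs where zs: "length zs = k" "prime_chain C (P (Suc 0)) zs"
    using Suc(1)[of "\<lambda>i. P (Suc i)"] Suc(2,3) by auto
  have "P 0 \<subseteq> P (Suc 0)" using Suc(3)[of 0] by blast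
  then have "prime_chain C (P 0) (z # zs)" using z zs Suc(2)[of 0] by auto
  then show ?case using zs(1) by (intro exI[of _ "z # zs"]) simp
qed

lemma (in vector_space) independent_family:
  assumes "finite E" and indep: "\<And>c. (\<Sum>e\<in>E. scale (c e) (f e)) = 0 \<Longrightarrow> \<forall>e\<in>E. c e = 0"
  shows "inj_on f E" "independent (f ` E)"
proof -
  show inj: "inj_on f E"
  proof (rule inj_onI, rule ccontr)
    fix a b assume ab: "a \<in> E" "b \<in> E" "f a = f b" "a \<noteq> b"
    define c where "c e = (if e = a then 1 else if e = b then -1 else (0::'a))" for e
    have "(\<Sum>e\<in>E. scale (c e) (f e)) = (\<Sum>e\<in>{a, b}. scale (c e) (f e))"
      using ab assms(1) by (intro sum.mono_neutral_right) (auto simp: c_def)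
    also have "\<dots> = 0" using ab by (simp add: c_def)
    finally have "c a = 0" using indep ab(1) by blast
    then show False by (simp add: c_def)
  qed
  show "independent (f ` E)"
  proof
    assume "dependent (f ` E)"
    then obtain r where r: "(\<Sum>v\<in>f ` E. scale (r v) v) = 0" "\<exists>v\<in>f ` E. r v \<noteq> 0"
      using dependent_finite[of "f ` E"] assms(1) by auto
    then have "(\<Sum>e\<in>E. scale (r (f e)) (f e)) = 0" by (simp add: sum.reindex[OF inj])
    from indep[OF this] r(2) show False by blast
  qed
qed

section \<open>The fiber cone of an equigenerated monomial ideal\<close>

text \<open>
  Polynomials in \<open>m\<close> variables grow too slowly to leave room for \<open>m + 1\<close> algebraically independent ones.
\<close>

lemma growth_bound:
  fixes k c m :: nat
  assumes "\<And>M. (M + 1) ^ k \<le> (c * M + 1) ^ m" shows "k \<le> (m::nat)"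
proof (rule ccontr)
  assume "\<not> k \<le> m"
  then have "Suc m \<le> k" by simp
  \<comment> \<open>For this \<open>M\<close>, \<open>(c M + 1)\<^sup>m \<le> ((c + 1) (M + 1))\<^sup>m = M (M + 1)\<^sup>m\<close>, which is too small.\<close>
  define M where "M = (c + 1) ^ m"
  have "(M + 1) ^ Suc m \<le> (M + 1) ^ k" using \<open>Suc m \<le> k\<close> by (intro power_increasing) auto
  also have "\<dots> \<le> (c * M + 1) ^ m" by (rule assms)
  also have "\<dots> \<le> ((c + 1) * (M + 1)) ^ m" by (intro power_mono) auto
  also have "\<dots> = M * (M + 1) ^ m" unfolding power_mult_distrib by (simp only: M_def)
  finally have "(M + 1) * (M + 1) ^ m \<le> M * (M + 1) ^ m" by simp
  then show False by simp
qed

definition restr :: "(expo \<Rightarrow> bool) \<Rightarrow> 'a::field mpoly \<Rightarrow> 'a mpoly" where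
  "restr P p = Poly_Mapping.mapp (\<lambda>t c. if P t then c else 0) p"

lemma lookup_restr: "lookup (restr P p) t = (if P t then lookup p t else 0)"
  by (auto simp: restr_def lookup_mapp in_keys_iff when_def)

lemma restr_add: "restr P (p + q) = restr P p + restr P q"
  by (rule poly_mapping_eqI) (simp add: lookup_restr lookup_add)

lemma restr_0: "restr P 0 = 0"
  by (rule poly_mapping_eqI) (simp add: lookup_restr)

lemma restr_sum: "restr P (sum f X) = (\<Sum>x\<in>X. restr P (f x))"
  by (induction X rule: infinite_finite_induct) (auto simp: restr_add restr_0)

lemma keys_restr: "keys (restr P p) = {t \<in> keys p. P t}"
  by (auto simp: in_keys_iff lookup_restr split: if_splits)

lemma restr_mult:
  assumes "\<And>a b. a \<in> keys p \<Longrightarrow> b \<in> keys q \<Longrightarrow> R (a + b) \<longleftrightarrow> P a \<and> Q b"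
  shows "restr R (p * q) = restr P p * restr Q q"
proof -
  have all: "restr R x = x" if "\<And>t. t \<in> keys x \<Longrightarrow> R t" for x :: "'a mpoly"
    by (rule poly_mapping_eqI) (use that in \<open>auto simp: lookup_restr in_keys_iff\<close>)
  have none: "restr R x = 0" if "\<And>t. t \<in> keys x \<Longrightarrow> \<not> R t" for x :: "'a mpoly"
    by (rule poly_mapping_eqI) (use that in \<open>auto simp: lookup_restr in_keys_iff\<close>)
  have split: "x = restr V x + restr (\<lambda>t. \<not> V t) x" for V and x :: "'a mpoly"
    by (rule poly_mapping_eqI) (simp add: lookup_add lookup_restr)
  have "p * q = restr P p * q + restr (\<lambda>t. \<not> P t) p * q"
    by (subst split[of p P]) (rule distrib_right)
  also have "restr P p * q = restr P p * restr Q q + restr P p * restr (\<lambda>t. \<not> Q t) q"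
    by (subst split[of q Q]) (rule distrib_left)
  finally have eq: "p * q = restr P p * restr Q q + restr P p * restr (\<lambda>t. \<not> Q t) q + restr (\<lambda>t. \<not> P t) p * q" .
  have 1: "restr R (restr P p * restr Q q) = restr P p * restr Q q"
    by (rule all, erule keys_multE) (simp add: keys_restr assms)
  have 2: "restr R (restr P p * restr (\<lambda>t. \<not> Q t) q) = 0"
    by (rule none, erule keys_multE) (simp add: keys_restr assms)
  have 3: "restr R (restr (\<lambda>t. \<not> P t) p * q) = 0"
    by (rule none, erule keys_multE) (simp add: keys_restr assms)
  show ?thesis unfolding arg_cong[OF eq, of "restr R"] restr_add 1 2 3 by simp
qed

lemma nsum_add: "a \<in> nsum T i \<Longrightarrow> b \<in> nsum T j \<Longrightarrow> a + b \<in> nsum T (i + j)"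
proof (induction i arbitrary: a)
  case (Suc i)
  then obtain x y where xy: "x \<in> T" "y \<in> nsum T i" "a = x + y" unfolding nsum.simps sumset_def by blast
  then have "y + b \<in> nsum T (i + j)" using Suc by blast
  then have "x + (y + b) \<in> nsum T (Suc i + j)" using xy(1) unfolding nsum.simps add_Suc sumset_def by blast
  then show ?case using xy(3) by (simp add: add.assoc)
qed simp

text \<open>
  The ideal generated by \<open>T\<close> lives in \<open>n\<close> variables, but only the first \<open>m\<close> of them occur in \<open>T\<close>. The type argument
  \<open>K\<close> fixes the field of coefficients.
\<close>

locale equigenerated =
  fixes T :: "expo set" and d m n :: nat and K :: "'a::field itself"
  assumes T_expos: "T \<subseteq> expos m" and mn: "m \<le> n" and T_deg: "t \<in> T \<Longrightarrow> tdeg t = d"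
    and d1: "d \<ge> 1" and lin_T: "1 \<le> j \<Longrightarrow> j \<le> m \<Longrightarrow> lin d j \<in> T"
begin

lemma expos_mono: "expos m \<subseteq> expos n"
  using mn by (auto simp: expos_def)

lemma T_n: "T \<subseteq> expos n"
  using T_expos expos_mono by blast

lemma nsum_deg: "t \<in> nsum T j \<Longrightarrow> tdeg t = d * j"
proof (induction j arbitrary: t)
  case (Suc j)
  then obtain x y where "x \<in> T" "y \<in> nsum T j" "t = x + y" unfolding nsum.simps sumset_def by blast
  then show ?case using T_deg[of x] Suc(1)[of y] by (simp add: tdeg_add)
qed (simp add: tdeg_zero)

definition C :: "'a mpoly poly set" where
  "C = {f. \<forall>j. poly.coeff f j \<in> mideal n (nsum T j)}"

lemma rees_eq: "rees_algebra n (mideal n T :: 'a mpoly set) = ring_on C"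
  by (simp add: rees_algebra_def ring_on_def C_def mideal_power[OF T_n])

lemma mideal_zero: "0 \<in> (mideal n X :: 'a mpoly set)"
  by (simp add: mideal_def polys_def)

lemma mideal_uminus: assumes "a \<in> mideal n X" shows "- a \<in> (mideal n X :: 'a mpoly set)"
proof -
  have "- 1 \<in> (polys n :: 'a mpoly set)" using subring_polys unfolding subring_set_def by blast
  then have "- 1 * a \<in> mideal n X" using assms ideal_mideal[of n X] unfolding ideal_S_iff by blast
  then show ?thesis by simp
qed

lemma mideal_nsum_mult:
  assumes "p \<in> mideal n (nsum T i)" "q \<in> mideal n (nsum T j)"
  shows "p * q \<in> (mideal n (nsum T (i + j)) :: 'a mpoly set)"
proof -
  have "p * q \<in> ideal_prod (S n) (mideal n (nsum T i)) (mideal n (nsum T j))"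
    using ideal_prod.prod[OF assms, of "S n"] by simp
  then have "p * q \<in> mideal n (sumset (nsum T i) (nsum T j))"
    unfolding mideal_prod[OF nsum_expos[OF T_n] nsum_expos[OF T_n]] .
  moreover have "mideal n (sumset (nsum T i) (nsum T j)) \<subseteq> (mideal n (nsum T (i + j)) :: 'a mpoly set)"
  proof (rule mideal_mono)
    fix t assume "t \<in> sumset (nsum T i) (nsum T j)"
    then have "t \<in> nsum T (i + j)" using nsum_add unfolding sumset_def by blast
    then show "\<exists>a\<in>nsum T (i + j). \<exists>s. t = a + s" by (rule self_divides)
  qed
  ultimately show ?thesis by blast
qed

lemma subring_C: "subring_set C"
  unfolding subring_set_def
proof (intro conjI ballI)
  show "0 \<in> C" by (simp add: C_def mideal_zero)
  show "1 \<in> C" unfolding C_def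
  proof (intro CollectI allI)
    fix j
    have "1 \<in> (mideal n {0} :: 'a mpoly set)" by (simp add: mideal_def polys_def)
    then show "poly.coeff 1 j \<in> (mideal n (nsum T j) :: 'a mpoly set)"
      by (cases j) (simp_all add: mideal_zero)
  qed
  fix f assume f: "f \<in> C"
  then show "- f \<in> C" by (simp add: C_def mideal_uminus)
  fix g assume g: "g \<in> C"
  show "f + g \<in> C" using f g by (simp add: C_def mideal_add)
  show "f * g \<in> C" unfolding C_def
  proof (intro CollectI allI)
    fix k
    have "poly.coeff f i * poly.coeff g (k - i) \<in> mideal n (nsum T k)" if "i \<in> {..k}" for i
      using mideal_nsum_mult[of "poly.coeff f i" i "poly.coeff g (k - i)" "k - i"] f g that by (simp add: C_def)
    then show "poly.coeff (f * g) k \<in> mideal n (nsum T k)"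
      unfolding coeff_mult by (intro ideal_sum_closed[OF ideal_mideal] finite_atMost)
  qed
qed

text \<open>
  The leading parts: in the coefficient of \<open>t\<^sup>j\<close>, which has only terms of degree at least \<open>d j\<close>, keep the terms of
  degree exactly \<open>d j\<close>, and set the variables beyond \<open>x\<^sub>k\<close> to zero. On the Rees algebra this is a ring
  homomorphism into a domain, so its kernel is prime.
\<close>

definition \<chi> :: "nat \<Rightarrow> 'a mpoly poly \<Rightarrow> 'a mpoly poly" where
  "\<chi> k f = (\<Sum>j\<le>degree f. monom (restr (\<lambda>t. tdeg t = d * j \<and> keys t \<subseteq> {1..k}) (poly.coeff f j)) j)"

lemma coeff_\<chi>: "poly.coeff (\<chi> k f) j = restr (\<lambda>t. tdeg t = d * j \<and> keys t \<subseteq> {1..k}) (poly.coeff f j)"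
proof -
  have "poly.coeff (\<chi> k f) j = (if j \<le> degree f then restr (\<lambda>t. tdeg t = d * j \<and> keys t \<subseteq> {1..k}) (poly.coeff f j) else 0)"
    unfolding \<chi>_def by (simp add: coeff_sum)
  moreover have "restr (\<lambda>t. tdeg t = d * j \<and> keys t \<subseteq> {1..k}) (poly.coeff f j) = 0" if "\<not> j \<le> degree f"
    using that by (simp add: coeff_eq_0 restr_0)
  ultimately show ?thesis by auto
qed

lemma \<chi>_add: "\<chi> k (f + g) = \<chi> k f + \<chi> k g"
  by (rule poly_eqI) (simp add: coeff_\<chi> restr_add)

lemma \<chi>_0: "\<chi> k 0 = 0"
  by (rule poly_eqI) (simp add: coeff_\<chi> restr_0)

lemma \<chi>_sum: "\<chi> k (sum f X) = (\<Sum>x\<in>X. \<chi> k (f x))"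
  by (induction X rule: infinite_finite_induct) (auto simp: \<chi>_add \<chi>_0)

lemma mideal_nsum_deg: "p \<in> mideal n (nsum T j) \<Longrightarrow> t \<in> keys p \<Longrightarrow> d * j \<le> tdeg t"
  unfolding mideal_def using nsum_deg by (force simp: tdeg_add)

lemma \<chi>_mult: assumes "f \<in> C" "g \<in> C" shows "\<chi> k (f * g) = \<chi> k f * \<chi> k g"
proof (rule poly_eqI)
  fix l
  let ?R = "\<lambda>j t. tdeg t = d * j \<and> keys t \<subseteq> {1..k}"
  have "restr (?R l) (poly.coeff f i * poly.coeff g (l - i)) = restr (?R i) (poly.coeff f i) * restr (?R (l - i)) (poly.coeff g (l - i))"
    if "i \<in> {..l}" for i
  proof (rule restr_mult)
    fix a b assume ab: "a \<in> keys (poly.coeff f i)" "b \<in> keys (poly.coeff g (l - i))"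
    have "d * i \<le> tdeg a" "d * (l - i) \<le> tdeg b" using mideal_nsum_deg ab assms unfolding C_def by blast+
    moreover have "d * l = d * i + d * (l - i)" using that by (simp flip: distrib_left)
    ultimately show "?R l (a + b) \<longleftrightarrow> ?R i a \<and> ?R (l - i) b" by (auto simp: tdeg_add keys_add_expo)
  qed
  then show "poly.coeff (\<chi> k (f * g)) l = poly.coeff (\<chi> k f * \<chi> k g) l"
    unfolding coeff_\<chi> coeff_mult restr_sum by (intro sum.cong) auto
qed

lemma \<chi>_const: "\<chi> k [:single 0 c:] = [:single 0 c:]"
proof (rule poly_eqI)
  fix j
  show "poly.coeff (\<chi> k [:single 0 c:]) j = poly.coeff [:single 0 c:] j"
    by (cases j) (auto simp: coeff_\<chi> restr_0 tdeg_zero lookup_restr lookup_single_if intro!: poly_mapping_eqI)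
qed

lemma const_in_C: "[:single 0 c:] \<in> C"
  unfolding C_def
proof (intro CollectI allI)
  fix j
  have "single 0 c \<in> (mideal n {0} :: 'a mpoly set)" by (simp add: mideal_def polys_def)
  then show "poly.coeff [:single 0 c:] j \<in> mideal n (nsum T j)"
    by (cases j) (simp_all add: mideal_zero)
qed

definition ker where "ker k = {f \<in> C. \<chi> k f = 0}"

lemma prime_ker: "prime_in C (ker k)"
  unfolding prime_in_def
proof (intro conjI ballI impI)
  have "\<chi> k 1 = 1" using \<chi>_const[of k 1] by (simp flip: one_pCons add: single_one)
  then show "1 \<notin> ker k" by (simp add: ker_def)
  show "0 \<in> ker k" using subring_C by (simp add: ker_def \<chi>_0 subring_set_def)
  show "ker k \<subseteq> C" by (auto simp: ker_def)
  show "a + b \<in> ker k" if "a \<in> ker k" "b \<in> ker k" for a b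
    using that subring_C by (simp add: ker_def \<chi>_add subring_set_def)
  show "r * a \<in> ker k" if "r \<in> C" "a \<in> ker k" for r a
    using that subring_C by (simp add: ker_def \<chi>_mult subring_set_def)
  show "a \<in> ker k \<or> b \<in> ker k" if "a \<in> C" "b \<in> C" "a * b \<in> ker k" for a b
    using that by (simp add: ker_def \<chi>_mult)
qed

lemma ker_antimono: "ker (Suc k) \<subseteq> ker k"
proof
  fix f assume f: "f \<in> ker (Suc k)"
  have "poly.coeff (\<chi> k f) j = 0" for j
  proof (rule poly_mapping_eqI)
    fix t
    have "lookup (poly.coeff (\<chi> (Suc k) f) j) t = 0" using f by (simp add: ker_def)
    moreover have "{1..k} \<subseteq> {1..Suc k}" by auto
    ultimately show "lookup (poly.coeff (\<chi> k f) j) t = lookup 0 t"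
      by (auto simp: coeff_\<chi> lookup_restr split: if_splits)
  qed
  then have "\<chi> k f = 0" by (intro poly_eqI) simp
  then show "f \<in> ker k" using f by (simp add: ker_def)
qed

text \<open>
  The difference is witnessed by \<open>x\<^sub>1\<^sup>d\<^sup>-\<^sup>1 x\<^sub>k\<^sub>+\<^sub>1 t\<close>.
\<close>

lemma ker_strict: assumes "k < m" shows "ker (Suc k) \<subset> ker k"
proof -
  let ?t = "lin d (Suc k)"
  define f :: "'a mpoly poly" where "f = monom (mon ?t) 1"
  have t: "?t \<in> T" using lin_T assms by simp
  then have "mon ?t \<in> (mideal n (nsum T 1) :: 'a mpoly set)"
    using T_n by (intro mon_in_mideal) (auto simp: sumset_def)
  then have "poly.coeff f j \<in> mideal n (nsum T j)" for j
    unfolding f_def by (cases "j = 1") (auto simp: mideal_zero)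
  then have fC: "f \<in> C" by (simp add: C_def)
  have keys: "Suc k \<in> keys ?t" "keys ?t \<subseteq> {1..Suc k}" by (auto simp: in_keys_iff lookup_lin split: if_splits)
  have "\<chi> k f = 0"
  proof (rule poly_eqI)
    fix j
    show "poly.coeff (\<chi> k f) j = poly.coeff 0 j"
    proof (rule poly_mapping_eqI)
      fix s
      show "lookup (poly.coeff (\<chi> k f) j) s = lookup (poly.coeff 0 j) s"
        using keys(1) by (auto simp: coeff_\<chi> lookup_restr f_def mon_def lookup_single_if)
    qed
  qed
  then have "f \<in> ker k" using fC by (simp add: ker_def)
  moreover have "f \<notin> ker (Suc k)"
  proof
    assume "f \<in> ker (Suc k)"
    then have "lookup (poly.coeff (\<chi> (Suc k) f) 1) ?t = 0" by (simp add: ker_def)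
    moreover have "tdeg ?t = d" using T_deg[OF t] .
    ultimately show False using keys(2) by (simp add: coeff_\<chi> lookup_restr f_def mon_def)
  qed
  ultimately show ?thesis using ker_antimono by blast
qed

lemma lead_term_in_nsum:
  assumes "f \<in> C" "t \<in> keys (poly.coeff f j)" "tdeg t = d * j" shows "t \<in> nsum T j"
proof -
  have "poly.coeff f j \<in> mideal n (nsum T j)" using assms(1) by (simp add: C_def)
  then obtain a s where as: "a \<in> nsum T j" "t = a + s" using assms(2) unfolding mideal_def by blast
  have "tdeg s = 0" using nsum_deg[OF as(1)] as(2) assms(3) by (simp add: tdeg_add)
  then show ?thesis using as by (simp add: tdeg_eq_0)
qed

lemma \<chi>_zero_iff: assumes "f \<in> C"
  shows "\<chi> m f = 0 \<longleftrightarrow> (\<forall>j. \<forall>t\<in>keys (poly.coeff f j). tdeg t \<noteq> d * j)"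
proof
  assume z: "\<chi> m f = 0"
  show "\<forall>j. \<forall>t\<in>keys (poly.coeff f j). tdeg t \<noteq> d * j"
  proof (intro allI ballI notI)
    fix j t assume t: "t \<in> keys (poly.coeff f j)" "tdeg t = d * j"
    have "t \<in> expos m" using lead_term_in_nsum[OF assms t] nsum_expos[OF T_expos] by blast
    then have "lookup (poly.coeff (\<chi> m f) j) t = lookup (poly.coeff f j) t"
      using t(2) by (simp add: coeff_\<chi> lookup_restr expos_def)
    then show False using z t(1) by (simp add: in_keys_iff)
  qed
next
  assume h: "\<forall>j. \<forall>t\<in>keys (poly.coeff f j). tdeg t \<noteq> d * j"
  have "poly.coeff (\<chi> m f) j = 0" for j
  proof (rule poly_mapping_eqI)
    fix t
    have "lookup (poly.coeff f j) t = 0" if "tdeg t = d * j"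
    proof (rule ccontr)
      assume "lookup (poly.coeff f j) t \<noteq> 0"
      then have "t \<in> keys (poly.coeff f j)" by (simp add: in_keys_iff)
      with h that show False by blast
    qed
    then show "lookup (poly.coeff (\<chi> m f) j) t = lookup 0 t"
      by (simp add: coeff_\<chi> lookup_restr)
  qed
  then show "\<chi> m f = 0" by (intro poly_eqI) simp
qed

text \<open>
  A term of \<open>I\<^sup>j\<close> lies in \<open>\<mm>I\<^sup>j\<close> if and only if its degree exceeds \<open>d j\<close>. So the fiber cone is the image of \<open>\<chi> m\<close>, the ring
  spanned by the products of monomials in \<open>T\<close>.
\<close>

lemma irrelevant_eq_ker:
  "{f. \<forall>j. poly.coeff f j \<in> ideal_prod (S n) (max_ideal n) (ideal_power (S n) (mideal n T) j)} = ker m"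
proof -
  let ?X = "(\<lambda>i. single i 1) ` {1..n} :: expo set"
  have X: "?X \<subseteq> expos n" by (auto simp: expos_def)
  have prod: "ideal_prod (S n) (max_ideal n) (ideal_power (S n) (mideal n T) j) = (mideal n (sumset ?X (nsum T j)) :: 'a mpoly set)" for j
    unfolding max_ideal_eq mideal_power[OF T_n] by (rule mideal_prod[OF X nsum_expos[OF T_n]])
  have key: "p \<in> mideal n (sumset ?X (nsum T j)) \<longleftrightarrow> p \<in> mideal n (nsum T j) \<and> (\<forall>t\<in>keys p. tdeg t \<noteq> d * j)" for p :: "'a mpoly" and j
  proof
    assume p: "p \<in> mideal n (sumset ?X (nsum T j))"
    have "\<exists>a\<in>nsum T j. \<exists>s. t = a + s \<and> tdeg t \<noteq> d * j" if t: "t \<in> keys p" for t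
    proof -
      obtain c s where "c \<in> sumset ?X (nsum T j)" "t = c + s" using p t unfolding mideal_def by blast
      then obtain i a where ia: "a \<in> nsum T j" "t = single i 1 + a + s" unfolding sumset_def by blast
      then have "t = a + (single i 1 + s)" by (simp add: ac_simps)
      moreover have "tdeg t \<noteq> d * j" using nsum_deg[OF ia(1)] ia(2) by (simp add: tdeg_add tdeg_single)
      ultimately show ?thesis using ia(1) by blast
    qed
    then show "p \<in> mideal n (nsum T j) \<and> (\<forall>t\<in>keys p. tdeg t \<noteq> d * j)"
      using p unfolding mideal_def by blast
  next
    assume p: "p \<in> mideal n (nsum T j) \<and> (\<forall>t\<in>keys p. tdeg t \<noteq> d * j)"
    then have pn: "p \<in> polys n" unfolding mideal_def by blast
    have "\<exists>c\<in>sumset ?X (nsum T j). \<exists>s. t = c + s" if t: "t \<in> keys p" for t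
    proof -
      obtain a s where as: "a \<in> nsum T j" "t = a + s" using p t unfolding mideal_def by blast
      have "s \<noteq> 0" using as p t nsum_deg[OF as(1)] by auto
      then obtain i where i: "i \<in> keys s" by (metis all_not_in_conv keys_eq_empty)
      then have "i \<in> {1..n}" using polys_D[OF pn t] as(2) by (auto simp: keys_add_expo)
      define r where "r = s - single i 1"
      have "s = single i 1 + r"
      proof (rule poly_mapping_eqI)
        show "lookup s k = lookup (single i 1 + r) k" for k
          using i by (cases "k = i") (auto simp: r_def lookup_add lookup_minus_nat lookup_single_if in_keys_iff)
      qed
      then have "t = (single i 1 + a) + r" using as(2) by (simp add: ac_simps)
      moreover have "single i 1 + a \<in> sumset ?X (nsum T j)" unfolding sumset_def using \<open>i \<in> {1..n}\<close> as(1) by blast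
      ultimately show ?thesis by blast
    qed
    then show "p \<in> mideal n (sumset ?X (nsum T j))" using pn unfolding mideal_def by blast
  qed
  show ?thesis
    unfolding prod
  proof (intro equalityI subsetI)
    fix f :: "'a mpoly poly"
    assume f: "f \<in> {f. \<forall>j. poly.coeff f j \<in> mideal n (sumset ?X (nsum T j))}"
    then have "f \<in> C" unfolding C_def using key by blast
    then show "f \<in> ker m" using f \<chi>_zero_iff key unfolding ker_def by blast
  next
    fix f assume f: "f \<in> ker m"
    then have fC: "f \<in> C" "\<chi> m f = 0" unfolding ker_def by auto
    then have "\<forall>j. \<forall>t\<in>keys (poly.coeff f j). tdeg t \<noteq> d * j" using \<chi>_zero_iff by blast
    then show "f \<in> {f. \<forall>j. poly.coeff f j \<in> mideal n (sumset ?X (nsum T j))}"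
      using key fC(1) unfolding C_def by blast
  qed
qed

lemma fiber_cone_eq: "fiber_cone n (mideal n T) = ring_on C Quot ker m"
  unfolding fiber_cone_def irrelevant_eq_ker rees_eq ..

end

section \<open>Prime ideals of a quotient\<close>

lemma coset_ring_on: "x \<in> N +>\<^bsub>ring_on C\<^esub> a \<longleftrightarrow> (\<exists>h\<in>N. x = h + a)"
  unfolding a_r_coset_def r_coset_def by auto

lemma carrier_quot_ring_on: "carrier (ring_on C Quot N) = (\<lambda>a. N +>\<^bsub>ring_on C\<^esub> a) ` C"
  unfolding FactRing_def by (auto simp: A_RCOSETS_def')

lemma prime_in_ideal: "subring_set C \<Longrightarrow> prime_in C P \<Longrightarrow> ideal P (ring_on C)"
  using primeideal_iff_prime_in primeideal.axioms(1) by blast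

lemma coset_in_image:
  assumes "prime_in C P" "N \<subseteq> P" "0 \<in> N" "a \<in> C" "N +>\<^bsub>ring_on C\<^esub> a \<in> (\<lambda>p. N +>\<^bsub>ring_on C\<^esub> p) ` P"
  shows "a \<in> P"
proof -
  obtain p where p: "p \<in> P" "N +>\<^bsub>ring_on C\<^esub> a = N +>\<^bsub>ring_on C\<^esub> p" using assms(5) by blast
  have "a \<in> N +>\<^bsub>ring_on C\<^esub> a" unfolding coset_ring_on using assms(3) by (intro bexI[of _ 0]) auto
  then obtain h where "h \<in> N" "a = h + p" unfolding p(2) coset_ring_on by blast
  then show ?thesis using p(1) assms(1,2) unfolding prime_in_def by blast
qed

lemma prime_image_quot:
  assumes C: "subring_set C" and N: "prime_in C N" and P: "prime_in C P" "N \<subseteq> P"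
  shows "primeideal ((\<lambda>p. N +>\<^bsub>ring_on C\<^esub> p) ` P) (ring_on C Quot N)"
proof (rule primeidealI)
  let ?R = "ring_on C"
  have cr: "cring ?R" by (rule cring_ring_on[OF C])
  then have r: "ring ?R" by (rule cring.axioms(1))
  have iN: "ideal N ?R" by (rule prime_in_ideal[OF C N])
  have N0: "0 \<in> N" using N by (simp add: prime_in_def)
  show "ideal ((\<lambda>p. N +>\<^bsub>?R\<^esub> p) ` P) (?R Quot N)"
    by (rule ring.ring_ideal_imp_quot_ideal[OF r iN prime_in_ideal[OF C P(1)]])
  show "cring (?R Quot N)" by (rule ideal.quotient_is_cring[OF iN cr])
  show "carrier (?R Quot N) \<noteq> (\<lambda>p. N +>\<^bsub>?R\<^esub> p) ` P"
  proof
    assume eq: "carrier (?R Quot N) = (\<lambda>p. N +>\<^bsub>?R\<^esub> p) ` P"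
    have "1 \<in> C" using C by (simp add: subring_set_def)
    then have "N +>\<^bsub>?R\<^esub> 1 \<in> (\<lambda>p. N +>\<^bsub>?R\<^esub> p) ` P" unfolding eq[symmetric] carrier_quot_ring_on by blast
    from coset_in_image[OF P N0 \<open>1 \<in> C\<close> this] show False using P(1) by (simp add: prime_in_def)
  qed
  fix x y assume xy: "x \<in> carrier (?R Quot N)" "y \<in> carrier (?R Quot N)"
    "x \<otimes>\<^bsub>?R Quot N\<^esub> y \<in> (\<lambda>p. N +>\<^bsub>?R\<^esub> p) ` P"
  obtain a b where ab: "a \<in> C" "b \<in> C" "x = N +>\<^bsub>?R\<^esub> a" "y = N +>\<^bsub>?R\<^esub> b"
    using xy(1,2) unfolding carrier_quot_ring_on by blast
  have "x \<otimes>\<^bsub>?R Quot N\<^esub> y = N +>\<^bsub>?R\<^esub> (a * b)"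
    using ideal.rcoset_mult_add[OF iN, of a b] ab by (simp add: FactRing_def)
  then have "N +>\<^bsub>?R\<^esub> (a * b) \<in> (\<lambda>p. N +>\<^bsub>?R\<^esub> p) ` P" using xy(3) by simp
  moreover have "a * b \<in> C" using ab C by (simp add: subring_set_def)
  ultimately have "a * b \<in> P" using coset_in_image[OF P N0] by blast
  then have "a \<in> P \<or> b \<in> P" using ab P(1) unfolding prime_in_def by blast
  then show "x \<in> (\<lambda>p. N +>\<^bsub>?R\<^esub> p) ` P \<or> y \<in> (\<lambda>p. N +>\<^bsub>?R\<^esub> p) ` P" using ab by blast
qed

lemma prime_preimage_quot:
  assumes C: "subring_set C" and N: "prime_in C N" and Q: "primeideal Q (ring_on C Quot N)"
  shows "prime_in C {r \<in> C. N +>\<^bsub>ring_on C\<^esub> r \<in> Q}" "N \<subseteq> {r \<in> C. N +>\<^bsub>ring_on C\<^esub> r \<in> Q}"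
proof -
  let ?R = "ring_on C"
  have cr: "cring ?R" by (rule cring_ring_on[OF C])
  have iN: "ideal N ?R" by (rule prime_in_ideal[OF C N])
  from ring_hom_ring.primeideal_vimage[OF ideal.rcos_ring_hom_ring[OF iN] cr Q]
  show "prime_in C {r \<in> C. N +>\<^bsub>?R\<^esub> r \<in> Q}" using primeideal_iff_prime_in[OF C] by simp
  have "additive_subgroup Q (?R Quot N)"
    using Q primeideal.axioms(1) ideal.axioms(1) by blast
  from additive_subgroup.zero_closed[OF this] have NQ: "N \<in> Q" by (simp add: FactRing_def)
  show "N \<subseteq> {r \<in> C. N +>\<^bsub>?R\<^esub> r \<in> Q}"
  proof
    fix a assume a: "a \<in> N"
    have aC: "a \<in> C" using a N unfolding prime_in_def by blast
    have "N +>\<^bsub>?R\<^esub> a = N"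
    proof (intro equalityI subsetI)
      fix x assume "x \<in> N +>\<^bsub>?R\<^esub> a"
      then obtain h where "h \<in> N" "x = h + a" unfolding coset_ring_on by blast
      then show "x \<in> N" using a N unfolding prime_in_def by blast
    next
      fix x assume x: "x \<in> N"
      have "- 1 \<in> C" using C by (simp add: subring_set_def)
      then have "- 1 * a \<in> N" using a N unfolding prime_in_def by blast
      then have "x + - 1 * a \<in> N" using x N unfolding prime_in_def by blast
      moreover have "x = (x + - 1 * a) + a" by simp
      ultimately show "x \<in> N +>\<^bsub>?R\<^esub> a" unfolding coset_ring_on by blast
    qed
    then show "a \<in> {r \<in> C. N +>\<^bsub>?R\<^esub> r \<in> Q}" using NQ aC by simp
  qed
qed

section \<open>The analytic spread\<close>

definition pscale :: "'a::field \<Rightarrow> 'a mpoly poly \<Rightarrow> 'a mpoly poly" where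
  "pscale c f = [:single 0 c:] * f"

lemma vector_space_pscale: "vector_space (pscale :: 'a::field \<Rightarrow> _)"
proof
  fix a b :: 'a and x y :: "'a mpoly poly"
  show "pscale a (x + y) = pscale a x + pscale a y" by (simp add: pscale_def smult_add_right)
  show "pscale (a + b) x = pscale a x + pscale b x" by (simp add: pscale_def single_add smult_add_left)
  show "pscale a (pscale b x) = pscale (a * b) x" by (simp add: pscale_def mult_single mult.commute)
  show "pscale 1 x = x" by (simp add: pscale_def)
qed

interpretation pp: vector_space "pscale :: 'a::field \<Rightarrow> 'a mpoly poly \<Rightarrow> 'a mpoly poly"
  by (rule vector_space_pscale)

lemma degree_list_power:
  fixes zs :: "'b::{comm_ring_1} poly list"
  assumes "\<And>z. z \<in> set zs \<Longrightarrow> degree z \<le> D" "set es \<subseteq> {..M}" "length es = length zs"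
  shows "degree (list_power zs es) \<le> length zs * (M * D)"
  using assms
proof (induction zs es rule: list_power.induct)
  case (1 z zs e es)
  have "degree (z ^ e) \<le> degree z * e" by (rule degree_power_le)
  also have "\<dots> \<le> D * M" using 1(2,3) by (intro mult_mono) auto
  finally have "degree (z ^ e) \<le> M * D" by (simp add: mult.commute)
  moreover have "degree (list_power zs es) \<le> length zs * (M * D)" using 1 by simp
  ultimately show ?case using degree_mult_le[of "z ^ e" "list_power zs es"] by simp
qed auto

lemma monom_sum_single:
  fixes p :: "'a::field mpoly"
  shows "monom p j = (\<Sum>t\<in>keys p. pscale (lookup p t) (monom (mon t) j))"
proof (rule poly_eqI)
  fix i
  have "poly.coeff (pscale c (monom (mon t) j)) i = (if j = i then single t c else 0)" for c :: 'a and t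
    by (simp add: pscale_def mon_def mult_single)
  then have "poly.coeff (\<Sum>t\<in>keys p. pscale (lookup p t) (monom (mon t) j)) i
     = (if j = i then \<Sum>t\<in>keys p. single t (lookup p t) else 0)"
    by (simp add: coeff_sum)
  then show "poly.coeff (monom p j) i = poly.coeff (\<Sum>t\<in>keys p. pscale (lookup p t) (monom (mon t) j)) i"
    using mpoly_sum_single[of p] by (cases "j = i") simp_all
qed

context equigenerated
begin

lemma \<chi>_in_span:
  assumes "degree f \<le> D"
  shows "\<chi> m f \<in> pp.span ((\<lambda>s. monom (mon s) (tdeg s div d)) ` {s. keys s \<subseteq> {1..m} \<and> tdeg s \<le> d * D})"
    (is "_ \<in> pp.span ?B")
  unfolding \<chi>_def
proof (rule pp.span_sum)
  fix j assume j: "j \<in> {..degree f}"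
  let ?p = "restr (\<lambda>t. tdeg t = d * j \<and> keys t \<subseteq> {1..m}) (poly.coeff f j)"
  have "pscale (lookup ?p t) (monom (mon t) j) \<in> pp.span ?B" if t: "t \<in> keys ?p" for t
  proof (rule pp.span_scale, rule pp.span_base)
    have tt: "tdeg t = d * j" "keys t \<subseteq> {1..m}" using t by (auto simp: keys_restr)
    have "tdeg t \<le> d * D" using tt j assms by simp
    moreover have "tdeg t div d = j" using tt d1 by simp
    ultimately show "monom (mon t) j \<in> ?B" using tt(2) by (intro image_eqI[of _ _ t]) auto
  qed
  then show "monom ?p j \<in> pp.span ?B" unfolding monom_sum_single[of ?p] by (rule pp.span_sum)
qed

lemma \<chi>_pscale: assumes "f \<in> C" shows "\<chi> k ([:single 0 c:] * f) = pscale c (\<chi> k f)"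
  unfolding pscale_def \<chi>_mult[OF const_in_C assms] \<chi>_const ..

text \<open>
  Compare, for large \<open>M\<close>, the \<open>(M + 1)\<^sup>k\<close> products of powers with exponents at most \<open>M\<close> of the \<open>k\<close> elements chosen
  along the chain with the dimension of the space that contains their leading parts. The latter is bounded by a polynomial of degree \<open>m\<close> in \<open>M\<close>:
  a leading part of degree \<open>j\<close> in \<open>t\<close> has total degree \<open>d j\<close> in \<open>x\<^sub>1, \<dots>, x\<^sub>m\<close>, so its terms are determined by
  their exponents in these variables.
\<close>

lemma chain_length_le:
  assumes ch: "prime_chain C P zs" and P: "ker m \<subseteq> P"
  shows "length zs \<le> m"
proof (rule growth_bound)
  define D where "D = sum_list (map degree zs)"
  have D: "degree z \<le> D" if "z \<in> set zs" for z
    unfolding D_def using that by (intro member_le_sum_list) auto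
  fix M :: nat
  let ?k = "length zs"
  let ?E = "{es :: nat list. set es \<subseteq> {..M} \<and> length es = ?k}"
  let ?f = "\<lambda>es. \<chi> m (list_power zs es)"
  let ?B = "(\<lambda>s. monom (mon s) (tdeg s div d)) ` {s. keys s \<subseteq> {1..m} \<and> tdeg s \<le> d * (?k * (M * D))} :: 'a mpoly poly set"
  have lpC: "list_power zs es \<in> C" for es by (rule list_power_in[OF subring_C prime_chain_in[OF ch]])
  have finE: "finite ?E" by (rule finite_lists_length_eq) simp
  have indep: "\<forall>es\<in>?E. c es = 0" if c: "(\<Sum>es\<in>?E. pscale (c es) (?f es)) = 0" for c
  proof
    fix es assume es: "es \<in> ?E"
    let ?s = "\<Sum>es\<in>?E. [:single 0 (c es):] * list_power zs es"
    have "?s \<in> C"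
    proof (rule subring_set_sum[OF subring_C])
      fix es show "[:single 0 (c es):] * list_power zs es \<in> C"
        using const_in_C[of "c es"] lpC[of es] subring_C unfolding subring_set_def by blast
    qed
    moreover have "\<chi> m ?s = 0" unfolding \<chi>_sum using c by (simp only: \<chi>_pscale[OF lpC])
    ultimately have sP: "?s \<in> P" using P unfolding ker_def by blast
    show "c es = 0"
    proof (rule chain_independent[OF subring_C, where \<kappa> = "\<lambda>c. [:single 0 c:]"])
      show "[:single 0 (inverse c):] * [:single 0 c:] = 1" if "c \<noteq> 0" for c :: 'a
        using that by (simp add: mult_single one_pCons)
      show "[:single 0 c:] \<in> C" for c by (rule const_in_C)
      show "[:single 0 0:] = (0 :: 'a mpoly poly)" by simp
      show "prime_chain C P zs" by (rule ch)
      show "?s \<in> P" by (rule sP)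
      show "set es \<subseteq> {..M}" "length es = ?k" using es by simp_all
    qed
  qed
  have finB: "finite ?B" by (intro finite_imageI finite_expos) simp
  have sub: "?f ` ?E \<subseteq> pp.span ?B"
  proof clarify
    fix es assume "set es \<subseteq> {..M}" "length es = ?k"
    from degree_list_power[OF D this] show "?f es \<in> pp.span ?B" by (rule \<chi>_in_span)
  qed
  have "card (?f ` ?E) \<le> card ?B"
    using pp.independent_span_bound[OF finB pp.independent_family(2)[OF finE indep] sub] by (rule conjunct2)
  also have "\<dots> \<le> card {s :: expo. keys s \<subseteq> {1..m} \<and> tdeg s \<le> d * (?k * (M * D))}"
    by (intro card_image_le finite_expos) simp
  also have "\<dots> \<le> Suc (d * (?k * (M * D))) ^ m"
    using card_expos_le[of "{1..m}" "d * (?k * (M * D))"] by simp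
  also have "card (?f ` ?E) = card ?E" by (rule card_image[OF pp.independent_family(1)[OF finE indep]])
  also have "card ?E = (M + 1) ^ ?k" using card_lists_length_eq[of "{..M}" ?k] by simp
  finally show "(M + 1) ^ ?k \<le> (d * ?k * D * M + 1) ^ m" by (simp add: ac_simps)
qed

text \<open>
  The kernels of \<open>\<chi> m, \<chi> (m - 1), \<dots>, \<chi> 0\<close> form a chain of length \<open>m\<close> that starts at the ideal by which the Rees algebra is
  divided, and \<open>chain_length_le\<close> excludes longer ones.
\<close>

theorem analytic_spread_eq: "analytic_spread n (mideal n T :: 'a mpoly set) = enat m"
proof -
  let ?N = "ker m"
  let ?Q = "ring_on C Quot ?N"
  let ?co = "\<lambda>a. ?N +>\<^bsub>ring_on C\<^esub> a"
  have mono: "ker m \<subseteq> ker i" if "i \<le> m" for i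
    using that by (induction rule: inc_induct) (use ker_antimono in auto)
  have N0: "0 \<in> ?N" using prime_ker[of m] by (simp add: prime_in_def)
  have "\<exists>P. (\<forall>i\<le>m. primeideal (P i) ?Q) \<and> (\<forall>i<m. P i \<subset> P (Suc i))"
  proof (intro exI[of _ "\<lambda>i. ?co ` ker (m - i)"] conjI allI impI)
    fix i assume "i \<le> m"
    show "primeideal (?co ` ker (m - i)) ?Q"
      by (rule prime_image_quot[OF subring_C prime_ker prime_ker mono]) simp
  next
    fix i assume i: "i < m"
    then have "Suc (m - Suc i) = m - i" by simp
    then have st: "ker (m - i) \<subset> ker (m - Suc i)" using ker_strict[of "m - Suc i"] i by simp
    then obtain a where a: "a \<in> ker (m - Suc i)" "a \<notin> ker (m - i)" by blast
    have "a \<in> C" using a(1) by (simp add: ker_def)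
    then have "?co a \<notin> ?co ` ker (m - i)"
      using coset_in_image[OF prime_ker[of "m - i"] mono[of "m - i"] N0, of a] a(2) by auto
    moreover have "?co a \<in> ?co ` ker (m - Suc i)" using a(1) by blast
    ultimately show "?co ` ker (m - i) \<subset> ?co ` ker (m - Suc i)" using st by blast
  qed
  moreover have "k \<le> m" if Pk: "\<forall>i\<le>k. primeideal (P i) ?Q" "\<forall>i<k. P i \<subset> P (Suc i)" for k P
  proof -
    let ?pre = "\<lambda>i. {r \<in> C. ?co r \<in> P i}"
    have pr: "prime_in C (?pre i)" if "i \<le> k" for i
      using prime_preimage_quot(1)[OF subring_C prime_ker] Pk(1) that by blast
    have "?pre i \<subset> ?pre (Suc i)" if i: "i < k" for i
    proof -
      obtain x where x: "x \<in> P (Suc i)" "x \<notin> P i" using Pk(2) i by blast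
      have "additive_subgroup (P (Suc i)) ?Q" using Pk(1) i primeideal.axioms(1) ideal.axioms(1) Suc_leI by blast
      then have "x \<in> carrier ?Q" using x(1) additive_subgroup.a_subset by blast
      then obtain a where "a \<in> C" "x = ?co a" unfolding carrier_quot_ring_on by blast
      then have "a \<in> ?pre (Suc i)" "a \<notin> ?pre i" using x by auto
      moreover have "?pre i \<subseteq> ?pre (Suc i)" using Pk(2) i by blast
      ultimately show ?thesis by blast
    qed
    with pr obtain zs where zs: "length zs = k" "prime_chain C (?pre 0) zs"
      using prime_chain_of_sequence[of k C ?pre] by blast
    have "?N \<subseteq> ?pre 0" using prime_preimage_quot(2)[OF subring_C prime_ker] Pk(1) by blast
    from chain_length_le[OF zs(2) this] zs(1) show ?thesis by simp
  qed
  ultimately show ?thesis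
    unfolding analytic_spread_def fiber_cone_eq krull_dim_def
    by (intro antisym Sup_least Sup_upper) auto
qed

end

section \<open>Freiman principal Borel ideals\<close>

theorem freiman_borel_iff:
  assumes t: "t \<in> expos n" and d: "tdeg t = d" "1 \<le> d"
  shows "freiman n (B n (mon t) :: 'a::field mpoly set) \<longleftrightarrow> tail t 3 \<le> 1 \<or> t = single 1 (d - 2) + single 3 2"
proof -
  let ?m = "top_var t"
  let ?A = "borel_below t"
  interpret bg: borel_generator t
    using t d by unfold_locales (auto simp: expos_def)
  have mn: "?m \<le> n"
    using bg.top_var_keys[OF self_below[OF bg.u0]] t by (auto simp: expos_def)
  interpret eq: equigenerated ?A d ?m n "TYPE('a)"
    using bg.keys_below bg.tdeg_A bg.lin_below mn d by unfold_locales (auto simp: expos_def)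
  have I: "B n (mon t) = (mideal n ?A :: 'a mpoly set)" by (rule B_mon[OF t])
  have spread: "analytic_spread n (mideal n ?A :: 'a mpoly set) = enat ?m" by (rule eq.analytic_spread_eq)
  have \<mu>1: "min_num_gens (S n) (mideal n ?A :: 'a mpoly set) = card ?A"
    by (rule min_num_gens_mideal[OF bg.finite_below eq.T_n eq.T_deg])
  have "sumset ?A ?A = (\<lambda>(a, b). a + b) ` (?A \<times> ?A)" unfolding sumset_def by auto
  then have fin2: "finite (sumset ?A ?A)" using bg.finite_below by simp
  have deg2: "tdeg s = 2 * d" if "s \<in> sumset ?A ?A" for s
    using that eq.T_deg unfolding sumset_def by (auto simp: tdeg_add)
  have \<mu>2: "min_num_gens (S n) (ideal_power (S n) (mideal n ?A) 2 :: 'a mpoly set) = card (sumset ?A ?A)"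
    unfolding mideal_power[OF eq.T_n] nsum_2
    by (rule min_num_gens_mideal[OF fin2 sumset_expos[OF eq.T_n eq.T_n] deg2])
  have "freiman n (mideal n ?A :: 'a mpoly set) \<longleftrightarrow>
      int (card (sumset ?A ?A)) = int ?m * int (card ?A) - int (?m choose 2)"
    unfolding freiman_def spread \<mu>1 \<mu>2 by simp
  also have "\<dots> \<longleftrightarrow> int (card (sumset ?A ?A) + (?m choose 2)) = int (?m * card ?A)"
    by (simp add: eq_diff_eq)
  also have "\<dots> \<longleftrightarrow> card (sumset ?A ?A) + (?m choose 2) = ?m * card ?A" by (rule of_nat_eq_iff)
  also have "\<dots> \<longleftrightarrow> tail t 3 \<le> 1 \<or> t = single 1 (d - 2) + single 3 2"
    using bg.freiman_iff unfolding d(1) .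
  finally show ?thesis unfolding I .
qed

section \<open>The generators listed in the theorem\<close>

definition vexp :: "nat set \<Rightarrow> expo set" where "vexp J = (\<lambda>i. single i 1) ` J"

lemma vexp_expos: "J \<subseteq> {1..n} \<Longrightarrow> vexp J \<subseteq> expos n"
  by (auto simp: vexp_def expos_def)

lemma vexp_deg: "s \<in> vexp J \<Longrightarrow> tdeg s = 1"
  by (auto simp: vexp_def tdeg_single)

lemma Idl_vars: "J \<subseteq> {1..n} \<Longrightarrow> Idl\<^bsub>S n\<^esub> (var ` J) = (mideal n (vexp J) :: 'a::field mpoly set)"
proof -
  assume "J \<subseteq> {1..n}"
  moreover have "var ` J = (mon ` vexp J :: 'a mpoly set)" by (simp add: vexp_def image_image var_def)
  ultimately show ?thesis using Idl_mon[OF vexp_expos] by simp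
qed

lemma Idl_single: "s \<in> expos n \<Longrightarrow> Idl\<^bsub>S n\<^esub> {mon s} = (mideal n {s} :: 'a::field mpoly set)"
  using Idl_mon[of "{s}" n] by simp

lemma var_power: "var i ^ k = (mon (single i k) :: 'a::field mpoly)"
proof (induction k)
  case 0
  then show ?case by (simp add: mon_0)
next
  case (Suc k)
  have "single i (Suc k) = single i 1 + (single i k :: expo)" by (simp flip: single_add)
  then show ?case using Suc by (simp add: var_times_mon)
qed

lemma var_eq_mon: "var i = mon (single i 1)"
  by (simp add: var_def)

lemma mon_mem_G_prod:
  assumes "X \<subseteq> expos n" "Y \<subseteq> expos n" "\<And>s. s \<in> X \<Longrightarrow> tdeg s = a" "\<And>s. s \<in> Y \<Longrightarrow> tdeg s = b"
  shows "(mon t :: 'a::field mpoly) \<in> G n (ideal_prod (S n) (mideal n X) (mideal n Y)) \<longleftrightarrow> t \<in> sumset X Y"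
proof -
  have "tdeg s = a + b" if "s \<in> sumset X Y" for s
    using that assms(3,4) unfolding sumset_def by (auto simp: tdeg_add)
  then have "G n (ideal_prod (S n) (mideal n X) (mideal n Y)) = (mon ` sumset X Y :: 'a mpoly set)"
    unfolding mideal_prod[OF assms(1,2)] by (rule G_equigenerated[OF sumset_expos[OF assms(1,2)]])
  then show ?thesis by (auto simp: mon_inj)
qed

lemma sumset_single_vexp: "t \<in> sumset {s} (vexp J) \<longleftrightarrow> (\<exists>j\<in>J. t = s + single j 1)"
  unfolding sumset_def vexp_def by blast

lemma mem_G_single_vars:
  assumes "s \<in> expos n" "J \<subseteq> {1..n}"
  shows "(mon t :: 'a::field mpoly) \<in> G n (ideal_prod (S n) (Idl\<^bsub>S n\<^esub> {mon s}) (Idl\<^bsub>S n\<^esub> (var ` J)))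
     \<longleftrightarrow> (\<exists>j\<in>J. t = s + single j 1)"
  unfolding Idl_single[OF assms(1)] Idl_vars[OF assms(2)]
  using mon_mem_G_prod[of "{s}" n "vexp J" "tdeg s" 1 t] vexp_expos[OF assms(2)] vexp_deg assms(1)
  by (simp add: sumset_single_vexp)

lemma Idl_three_vars:
  assumes "{1, 2, 3} \<subseteq> {1..n}"
  shows "Idl\<^bsub>S n\<^esub> {var 1, var 2, var 3} = (mideal n (vexp {1, 2, 3}) :: 'a::field mpoly set)"
  using Idl_vars[OF assms] by (simp only: image_insert image_empty)

lemma inj_mon: "inj (mon :: expo \<Rightarrow> 'a::field mpoly)"
  by (simp add: inj_on_def mon_inj)

lemma mem_G_square:
  assumes "n \<ge> 3"
  shows "(mon t :: 'a::field mpoly) \<in> G n (ideal_power (S n) (Idl\<^bsub>S n\<^esub> {var 1, var 2, var 3}) 2)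
    \<longleftrightarrow> (\<exists>i\<in>{1,2,3}. \<exists>j\<in>{1,2,3}. t = single i 1 + single j 1)"
proof -
  have J: "{1, 2, 3} \<subseteq> {1..n}" using assms by auto
  have "tdeg s = 2" if "s \<in> sumset (vexp {1,2,3}) (vexp {1,2,3})" for s
    using that vexp_deg unfolding sumset_def by (auto simp: tdeg_add)
  then have "G n (mideal n (sumset (vexp {1,2,3}) (vexp {1,2,3}))) = (mon ` sumset (vexp {1,2,3}) (vexp {1,2,3}) :: 'a mpoly set)"
    by (rule G_equigenerated[OF sumset_expos[OF vexp_expos[OF J] vexp_expos[OF J]]])
  then have "(mon t :: 'a mpoly) \<in> G n (ideal_power (S n) (Idl\<^bsub>S n\<^esub> {var 1, var 2, var 3}) 2) \<longleftrightarrow> t \<in> sumset (vexp {1,2,3}) (vexp {1,2,3})"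
    unfolding Idl_three_vars[OF J] mideal_power[OF vexp_expos[OF J]] nsum_2 by (simp only: inj_image_mem_iff[OF inj_mon])
  then show ?thesis unfolding sumset_def vexp_def by blast
qed

lemma mem_G_var_square:
  assumes "n \<ge> 3"
  shows "(mon t :: 'a::field mpoly) \<in> G n (ideal_prod (S n) (Idl\<^bsub>S n\<^esub> {var 1}) (ideal_power (S n) (Idl\<^bsub>S n\<^esub> {var 1, var 2, var 3}) 2))
    \<longleftrightarrow> (\<exists>i\<in>{1,2,3}. \<exists>j\<in>{1,2,3}. t = single 1 1 + (single i 1 + single j 1))"
proof -
  have J: "{1, 2, 3} \<subseteq> {1..n}" using assms by auto
  have s1: "single 1 1 \<in> expos n" using assms by (simp add: expos_def)
  have deg: "tdeg s = 2" if "s \<in> sumset (vexp {1,2,3}) (vexp {1,2,3})" for s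
    using that vexp_deg unfolding sumset_def by (auto simp: tdeg_add)
  have "(mon t :: 'a mpoly) \<in> G n (ideal_prod (S n) (mideal n {single 1 1}) (mideal n (sumset (vexp {1,2,3}) (vexp {1,2,3}))))
     \<longleftrightarrow> t \<in> sumset {single 1 1} (sumset (vexp {1,2,3}) (vexp {1,2,3}))"
    by (rule mon_mem_G_prod[OF _ sumset_expos[OF vexp_expos[OF J] vexp_expos[OF J]] _ deg, where a = 1])
      (use s1 in \<open>auto simp: tdeg_single\<close>)
  moreover have "Idl\<^bsub>S n\<^esub> {var 1} = (mideal n {single 1 1} :: 'a mpoly set)"
    unfolding var_eq_mon by (rule Idl_single[OF s1])
  ultimately have "(mon t :: 'a mpoly) \<in> G n (ideal_prod (S n) (Idl\<^bsub>S n\<^esub> {var 1}) (ideal_power (S n) (Idl\<^bsub>S n\<^esub> {var 1, var 2, var 3}) 2))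
     \<longleftrightarrow> t \<in> sumset {single 1 1} (sumset (vexp {1,2,3}) (vexp {1,2,3}))"
    unfolding Idl_three_vars[OF J] mideal_power[OF vexp_expos[OF J]] nsum_2 by (simp only:)
  then show ?thesis unfolding sumset_def vexp_def by blast
qed

text \<open>
  The normal forms that the lists for the various degrees enumerate.
\<close>

lemma allowed_cases:
  assumes t: "t \<in> expos n" "tdeg t = d" and al: "tail t 3 \<le> 1 \<or> t = single 1 (d - 2) + single 3 2"
  obtains a b where "t = single 1 a + single 2 b" "a + b = d"
    | a b j where "3 \<le> j" "j \<le> n" "t = single 1 a + single 2 b + single j 1" "a + b + 1 = d"
    | "t = single 1 (d - 2) + single 3 2"
proof (cases "tail t 3 \<le> 1")
  case True
  have "0 \<notin> keys t" using t(1) by (auto simp: expos_def)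
  from this True show thesis
  proof (cases rule: nearly_two_variables)
    case (1 a b)
    then have "a + b = d" using t(2) by (simp add: tdeg_add tdeg_single)
    with 1 show thesis by (rule that(1))
  next
    case (2 a b j)
    then have "a + b + 1 = d" using t(2) by (simp add: tdeg_add tdeg_single)
    moreover have "single j 1 \<in> expos n" using t(1) 2(2) by (simp add: expos_add)
    then have "j \<le> n" by (simp add: expos_def)
    ultimately show thesis using 2 that(2) by blast
  qed
next
  case False
  then show thesis using al that(3) by blast
qed

lemma single_two: "single i 2 = single i 1 + (single i 1 :: expo)"
  by (simp add: numeral_2_eq_2 flip: single_add)

lemma single_three: "single i 3 = single i 1 + (single i 1 + single i 1 :: expo)"
  by (simp add: numeral_3_eq_3 flip: single_add)

lemma single_Suc: "single i (Suc k) = single i k + (single i 1 :: expo)"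
  by (simp flip: single_add)

lemma quadric_iff:
  assumes n: "3 \<le> n" and t: "t \<in> expos n" "tdeg t = 2"
  shows "tail t 3 \<le> 1 \<or> t = single 1 (2 - 2) + single 3 2 \<longleftrightarrow>
    (\<exists>i\<in>{1,2,3}. \<exists>j\<in>{1,2,3}. t = single i 1 + single j 1) \<or>
    (\<exists>j\<in>{4..n}. t = single 1 1 + single j 1) \<or> (\<exists>j\<in>{4..n}. t = single 2 1 + single j 1)"
    (is "?l \<longleftrightarrow> ?r")
proof
  assume ?l
  with t show ?r
  proof (cases rule: allowed_cases)
    case (1 a b)
    from 1(2) consider "a = 2" "b = 0" | "a = 1" "b = 1" | "a = 0" "b = 2" by linarith
    then show ?r by cases (simp_all add: 1(1) single_two)
  next
    case (2 a b j)
    then obtain i where i: "i \<in> {1, 2}" "t = single i 1 + single j 1"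
      by (cases a) auto
    show ?r
    proof (cases "j = 3")
      case True
      then show ?thesis using i by blast
    next
      case False
      then have "j \<in> {4..n}" using \<open>3 \<le> j\<close> \<open>j \<le> n\<close> by simp
      then show ?thesis using i by blast
    qed
  next
    case 3
    then have "t = single 3 1 + single 3 1" by (simp add: single_two)
    then show ?r by blast
  qed
next
  assume ?r
  then show ?l by (elim disjE bexE) (auto simp: tail_add tail_single single_two)
qed

lemma cubic_iff:
  assumes n: "3 \<le> n" and t: "t \<in> expos n" "tdeg t = 3"
  shows "tail t 3 \<le> 1 \<or> t = single 1 (3 - 2) + single 3 2 \<longleftrightarrow>
    (\<exists>i\<in>{1,2,3}. \<exists>j\<in>{1,2,3}. t = single 1 1 + (single i 1 + single j 1)) \<or>
    (\<exists>i. 3 < i \<and> i \<le> n \<and> (\<exists>j\<in>{1,2}. t = (single 1 1 + single i 1) + single j 1)) \<or>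
    (\<exists>j\<in>{2..n}. t = single 2 2 + single j 1)"
    (is "?l \<longleftrightarrow> ?r")
proof
  note two = single_two and three = single_three
  assume ?l
  with t show ?r
  proof (cases rule: allowed_cases)
    case (1 a b)
    from 1(2) consider "a = 3" "b = 0" | "a = 2" "b = 1" | "a = 1" "b = 2" | "a = 0" "b = 3" by linarith
    then show ?r using n by cases (auto simp: 1(1) single_two single_three add.assoc)
  next
    case (2 a b j)
    have mixed: ?r if i: "i \<in> {1, 2}" "t = single 1 1 + (single i 1 + single j 1)" for i
    proof (cases "j = 3")
      case True
      then show ?thesis using i by blast
    next
      case False
      then have "3 < j" using 2(1) by simp
      moreover have "t = (single 1 1 + single j 1) + single i 1" unfolding i(2) by (simp only: ac_simps)
      ultimately show ?thesis using 2(2) i(1) by blast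
    qed
    from 2(4) consider "a = 2" "b = 0" | "a = 1" "b = 1" | "a = 0" "b = 2" by linarith
    then show ?r
    proof cases
      case 1
      then have "t = single 1 1 + (single 1 1 + single j 1)" unfolding 2(3) by (simp add: two add.assoc)
      then show ?thesis by (rule mixed[rotated]) simp
    next
      case 2
      then have "t = single 1 1 + (single 2 1 + single j 1)" unfolding \<open>t = _\<close> by (simp add: add.assoc)
      then show ?thesis by (rule mixed[rotated]) simp
    next
      case 3
      then have "t = single 2 2 + single j 1" unfolding 2(3) by simp
      moreover have "j \<in> {2..n}" using 2(1,2) by simp
      ultimately show ?thesis by blast
    qed
  next
    case 3
    then have "t = single 1 1 + (single 3 1 + single 3 1)" by (simp add: two)
    then show ?r by blast
  qed
next
  assume ?r
  then show ?l by (elim disjE bexE exE conjE) (auto simp: tail_add tail_single single_two)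
qed

text \<open>
  A factor \<open>x\<^sub>2\<close> or \<open>x\<^sub>1\<close> can play the role of the last variable \<open>x\<^sub>j\<close>, so the monomials in \<open>x\<^sub>1, x\<^sub>2\<close> alone are covered as well.
\<close>

lemma higher_degree_iff:
  assumes n: "3 \<le> n" and t: "t \<in> expos n" "tdeg t = d" and d: "2 \<le> d"
  shows "tail t 3 \<le> 1 \<or> t = single 1 (d - 2) + single 3 2 \<longleftrightarrow>
    t = single 1 (d - 2) + single 3 2 \<or>
    (\<exists>j\<in>{1..n}. t = single 1 (d - 1) + single j 1) \<or>
    (\<exists>r i. 1 \<le> r \<and> r \<le> d - 1 \<and> 2 \<le> i \<and> (\<exists>j\<in>{i..n}. t = (single 1 (d - r - 1) + single 2 r) + single j 1))"
    (is "?l \<longleftrightarrow> ?r")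
proof
  assume ?l
  have c1: "?r" if "t = single 1 (d - 1) + single j 1" "1 \<le> j" "j \<le> n" for j
  proof -
    have "j \<in> {1..n}" using that by simp
    then show ?thesis using that(1) by blast
  qed
  have c2: "?r" if "t = (single 1 (d - r - 1) + single 2 r) + single j 1" "1 \<le> r" "r \<le> d - 1" "2 \<le> j" "j \<le> n" for r j
  proof -
    have "j \<in> {2..n}" using that by simp
    then show ?thesis using that(1,2,3) by blast
  qed
  from t \<open>?l\<close> show ?r
  proof (cases rule: allowed_cases)
    case (1 a b)
    show ?r
    proof (cases b)
      case 0
      then have "a = Suc (d - 1)" using 1(2) d by simp
      then have "t = single 1 (d - 1) + single 1 1" unfolding 1(1) 0 by (simp flip: single_add)
      then show ?thesis using n by (intro c1[of 1]) auto
    next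
      case (Suc r)
      show ?thesis
      proof (cases "r = 0")
        case True
        then have "t = single 1 (d - 1) + single 2 1" using 1(2) Suc unfolding 1(1) by auto
        then show ?thesis using n by (intro c1[of 2]) auto
      next
        case False
        have "a = d - r - 1" using 1(2) Suc by simp
        then have "t = (single 1 (d - r - 1) + single 2 r) + single 2 1"
          unfolding 1(1) Suc single_Suc by (simp add: add.assoc)
        then show ?thesis using n False 1(2) Suc by (intro c2[of r 2]) auto
      qed
    qed
  next
    case (2 a b j)
    show ?r
    proof (cases "b = 0")
      case True
      then have "a = d - 1" using 2(4) by simp
      then have "t = single 1 (d - 1) + single j 1" unfolding 2(3) using True by simp
      then show ?thesis using 2(1,2) by (intro c1[of j]) auto
    next
      case False
      have "a = d - b - 1" using 2(4) by simp
      then have "t = (single 1 (d - b - 1) + single 2 b) + single j 1" unfolding 2(3) by simp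
      then show ?thesis using False 2(1,2,4) by (intro c2[of b j]) auto
    qed
  next
    case 3
    then show ?r by blast
  qed
next
  assume ?r
  then consider "t = single 1 (d - 2) + single 3 2" | j where "t = single 1 (d - 1) + single j 1"
    | r j where "t = (single 1 (d - r - 1) + single 2 r) + single j 1" by blast
  then show ?l
  proof cases
    case 2
    then have "tail t 3 \<le> 1" unfolding 2 by (auto simp: tail_add tail_single)
    then show ?thesis ..
  next
    case 3
    then have "tail t 3 \<le> 1" unfolding 3 by (auto simp: tail_add tail_single)
    then show ?thesis ..
  qed simp
qed

theorem theorem2p2:
  fixes d n :: nat and u :: "'k::field mpoly"
  assumes "d \<ge> 2" and "n \<ge> 3"
    and "u \<in> monomials_of_degree n d"
  shows
    "(d = 2 \<longrightarrow>
       (freiman n (B n u) \<longleftrightarrow>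
          u \<in> G n (ideal_power (S n) (Idl\<^bsub>S n\<^esub> {var 1, var 2, var 3}) 2) \<or>
          u \<in> G n (ideal_prod (S n) (Idl\<^bsub>S n\<^esub> {var 1}) (Idl\<^bsub>S n\<^esub> (var ` {4..n}))) \<or>
          u \<in> G n (ideal_prod (S n) (Idl\<^bsub>S n\<^esub> {var 2}) (Idl\<^bsub>S n\<^esub> (var ` {4..n}))))) \<and>
     (d = 3 \<longrightarrow>
       (freiman n (B n u) \<longleftrightarrow>
          u \<in> G n (ideal_prod (S n) (Idl\<^bsub>S n\<^esub> {var 1})
                    (ideal_power (S n) (Idl\<^bsub>S n\<^esub> {var 1, var 2, var 3}) 2)) \<or>
          (\<exists>i. 3 < i \<and> i \<le> n \<and>
             u \<in> G n (ideal_prod (S n) (Idl\<^bsub>S n\<^esub> {var 1 * var i}) (Idl\<^bsub>S n\<^esub> {var 1, var 2}))) \<or>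
          u \<in> G n (ideal_prod (S n) (Idl\<^bsub>S n\<^esub> {var 2 ^ 2}) (Idl\<^bsub>S n\<^esub> (var ` {2..n}))))) \<and>
     (d \<ge> 4 \<longrightarrow>
       (freiman n (B n u) \<longleftrightarrow>
          u = var 1 ^ (d - 2) * var 3 ^ 2 \<or>
          u \<in> G n (ideal_prod (S n) (Idl\<^bsub>S n\<^esub> {var 1 ^ (d - 1)}) (Idl\<^bsub>S n\<^esub> (var ` {1..n}))) \<or>
          (\<exists>r i. 1 \<le> r \<and> r \<le> d - 1 \<and> 2 \<le> i \<and>
             u \<in> G n (ideal_prod (S n) (Idl\<^bsub>S n\<^esub> {var 1 ^ (d - r - 1) * var 2 ^ r})
                       (Idl\<^bsub>S n\<^esub> (var ` {i..n}))))))"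
proof -
  obtain t where u: "u = mon t" and t: "t \<in> expos n" "tdeg t = d"
    using assms(3) unfolding monomials_of_degree_def expos_def tdeg_def by blast
  have freiman: "freiman n (B n (mon t :: 'k mpoly)) \<longleftrightarrow> tail t 3 \<le> 1 \<or> t = single 1 (d - 2) + single 3 2"
    by (rule freiman_borel_iff[OF t]) (use assms(1) in simp)
  have e: "single 1 a \<in> expos n" "single 2 a \<in> expos n" for a
    using assms(2) by (auto simp: expos_def)
  have e': "single i 1 \<in> expos n" if "3 < i" "i \<le> n" for i using that by (simp add: expos_def)
  have linear: "(mon t :: 'k mpoly) \<in> G n (ideal_prod (S n) (Idl\<^bsub>S n\<^esub> {var i}) (Idl\<^bsub>S n\<^esub> (var ` {4..n})))
      \<longleftrightarrow> (\<exists>j\<in>{4..n}. t = single i 1 + single j 1)" if "single i 1 \<in> expos n" for i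
    unfolding var_eq_mon[of i] by (rule mem_G_single_vars[OF that]) auto
  show ?thesis
  proof (intro conjI impI, goal_cases)
    case 1
    note d2 = 1
    show ?case
      unfolding u freiman[unfolded d2] mem_G_square[OF assms(2)] linear[OF e(1)] linear[OF e(2)]
      by (rule quadric_iff[OF assms(2) t[unfolded d2]])
  next
    case 2
    note d3 = 2
    have J: "{2..n} \<subseteq> {1..n}" "{1, 2} \<subseteq> {1..n}" using assms(2) by auto
    have mid: "(mon t :: 'k mpoly) \<in> G n (ideal_prod (S n) (Idl\<^bsub>S n\<^esub> {var 1 * var i}) (Idl\<^bsub>S n\<^esub> {var 1, var 2}))
      \<longleftrightarrow> (\<exists>j\<in>{1,2}. t = (single 1 1 + single i 1) + single j 1)" if "3 < i" "i \<le> n" for i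
    proof -
      have s: "single 1 1 + single i 1 \<in> expos n" using e(1) e'[OF that] by (simp add: expos_add)
      have "var 1 * var i = (mon (single 1 1 + single i 1) :: 'k mpoly)" by (simp add: var_eq_mon mon_add)
      moreover have "{var 1, var 2} = (var ` {1, 2} :: 'k mpoly set)" by simp
      ultimately show ?thesis using mem_G_single_vars[OF s J(2), of t, where 'a = 'k] by (simp only:)
    qed
    have last: "(mon t :: 'k mpoly) \<in> G n (ideal_prod (S n) (Idl\<^bsub>S n\<^esub> {var 2 ^ 2}) (Idl\<^bsub>S n\<^esub> (var ` {2..n})))
      \<longleftrightarrow> (\<exists>j\<in>{2..n}. t = single 2 2 + single j 1)"
      unfolding var_power by (rule mem_G_single_vars[OF e(2) J(1)])
    show ?case
      unfolding u freiman[unfolded d3] mem_G_var_square[OF assms(2)] last cubic_iff[OF assms(2) t[unfolded d3]]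
      by (intro arg_cong2[where f = "(\<or>)"] refl ex_cong) (simp only: mid conj_assoc cong: conj_cong)
  next
    case 3
    have square: "u = var 1 ^ (d - 2) * var 3 ^ 2 \<longleftrightarrow> t = single 1 (d - 2) + single 3 2"
      unfolding u var_power by (simp add: mon_inj flip: mon_add)
    have lin: "u \<in> G n (ideal_prod (S n) (Idl\<^bsub>S n\<^esub> {var 1 ^ (d - 1)}) (Idl\<^bsub>S n\<^esub> (var ` {1..n})))
      \<longleftrightarrow> (\<exists>j\<in>{1..n}. t = single 1 (d - 1) + single j 1)"
      unfolding u var_power by (rule mem_G_single_vars[OF e(1) order_refl])
    have mixed: "u \<in> G n (ideal_prod (S n) (Idl\<^bsub>S n\<^esub> {var 1 ^ (d - r - 1) * var 2 ^ r}) (Idl\<^bsub>S n\<^esub> (var ` {i..n})))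
      \<longleftrightarrow> (\<exists>j\<in>{i..n}. t = (single 1 (d - r - 1) + single 2 r) + single j 1)" if "2 \<le> i" for r i
    proof -
      have s: "single 1 (d - r - 1) + single 2 r \<in> expos n" using e by (simp add: expos_add)
      have J: "{i..n} \<subseteq> {1..n}" using that by auto
      show ?thesis unfolding u var_power mon_add[symmetric] by (rule mem_G_single_vars[OF s J])
    qed
    show ?case
      unfolding freiman[folded u] square lin higher_degree_iff[OF assms(2) t assms(1)]
      by (simp only: mixed cong: conj_cong)
  qed
qed

end
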